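(* Let $\Omega\subset\mathbb R^N$ be a bounded open set with Lipschitz continuous boundary, $0<s<1$, and let $f:\Omega\times\mathbb R\to\mathbb R$ satisfy the structural, global $(\triangle_2)$ and local Lipschitz conditions listed in the context. In addition, let $0\le\beta<1$, let $g\in\mathbb H^\beta(\Omega)\cap L^p(\Omega)$ with $p>\frac N{2s}$ if $N>2s$, $p>1$ if $N=2s$, and $p=1$ if $N<2s$, and let $u\in\mathbb H^s(\Omega)$ be the weak solution of $$(-\Delta_D)^su+f(x,u)=g\ \text{ in }\Omega,\qquad u=0\ \text{ on }\partial\Omega.$$ Then $u\in\mathbb H^{2s+\beta}(\Omega)$.
   Context: Spectral fractional Laplacian. $-\Delta_D$ is the positive self-adjoint operator on $L^2(\Omega)$ associated with the form $\int_\Omega\nabla u\cdot\nabla v\,dx$, $u,v\in H^1_0(\Omega)$. Its eigenvalues are $0<\lambda_1\le\lambda_2\le\cdots\to\infty$, with $L^2$-orthonormal eigenfunctions $\varphi_n$. For $r\ge0$, $\mathbb H^r(\Omega)=\{u=\sum_n u_n\varphi_n\in L^2(\Omega):\|u\|_{\mathbb H^r(\Omega)}^2:=\sum_n\lambda_n^r u_n^2<\infty\}$, $u_n=\int_\Omega u\varphi_n\,dx$. For $r\in(0,1)$, $(-\Delta_D)^r u=\sum_n\lambda_n^r u_n\varphi_n$. Conditions on $f$. (i) For a.e. $x\in\Omega$: $f(x,\cdot)$ is odd, strictly increasing and continuous, $f(x,0)=0$ and $\lim_{t\to\infty}f(x,t)=\infty$; for all $t\in\mathbb R$, $f(\cdot,t)$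 is measurable. Let $\widetilde f(x,\cdot)$ be the inverse function of $f(x,\cdot)$, and $F(x,t)=\int_0^{|t|}f(x,\tau)\,d\tau$, $\widetilde F(x,t)=\int_0^{|t|}\widetilde f(x,\tau)\,d\tau$. (ii) Global $(\triangle_2)$-condition: there are constants $c_1,c_2\in(0,1]$, independent of $x$, such that for a.e. $x\in\Omega$ and all $t\ge0$, $c_1tf(x,t)\le F(x,t)\le tf(x,t)$ and $c_2t\widetilde f(x,t)\le\widetilde F(x,t)\le t\widetilde f(x,t)$. (iii) Local Lipschitz condition: for all $M>0$ there is $L_M>0$ such that $|f(x,u_1)-f(y,u_2)|\le L_M|u_1-u_2|$ for a.e. $x,y\in\Omega$ and all $u_1,u_2\in\mathbb R$ with $|u_1|,|u_2|\le M$. Spaces. $L_F(\Omega)=\{u:\Omega\to\mathbb R\text{ measurable}: F(\cdot,u(\cdot))\in L^1(\Omega)\}$ with the Luxemburg norm $\|u\|_{F,\Omega}=\inf\{k>0:\int_\Omega F(x,u(x)/k)\,dx\le1\}$. $\mathcal V=\mathbb H^s(\Omega)\cap L_F(\Omega)$ with norm $\|u\|_{\mathbb H^s(\Omega)}+\|u\|_{F,\Omega}$; $\mathcal V^\star$ is its dual. A function $g$ as in the claim defines an element of $\mathcal V^\star$ by $\langle g,v\rangle=\int_\Omega gv\,dx$. Weak solution. $u\in\mathcal V$ is a weak solution if $\int_\Omega(-\Delta_D)^{s/2}u\,(-\Delta_D)^{s/2}v\,dx+\int_\Omega f(x,u)v\,dx=\langle g,v\rangle$ for every $v\in\mathcal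 V$; for every $g\in\mathcal V^\star$ it exists and is unique. *)

theory Defs
  imports "HOL-Analysis.Analysis"
begin

text \<open>
  Function spaces over \<open>\<Omega>\<close> are sets of honest functions on the whole ambient space: values outside
  \<open>\<Omega>\<close> are irrelevant, and functions are not identified almost everywhere.
\<close>

section \<open>Lipschitz domains\<close>

text \<open>
  Near every boundary point, in a rotated coordinate system with vertical direction \<open>e\<close>, the set is
  the part of a ball lying strictly above the graph of a Lipschitz function \<open>\<gamma>\<close> of the horizontal
  component \<open>y - (e \<bullet> y) *\<^sub>R e\<close>.
\<close>

definition lipschitz_boundary :: "'a::euclidean_space set \<Rightarrow> bool" where
  "lipschitz_boundary \<Omega> \<longleftrightarrow>
     (\<forall>x0\<in>frontier \<Omega>. \<exists>r>0. \<exists>e L \<gamma>. norm e = 1 \<and> L-lipschitz_on {z. e \<bullet> z = 0} \<gamma> \<and>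
        \<Omega> \<inter> ball x0 r = {y \<in> ball x0 r. \<gamma> (y - (e \<bullet> y) *\<^sub>R e) < e \<bullet> y})"

section \<open>Lebesgue and Sobolev spaces\<close>

definition Lp_space :: "'a::euclidean_space set \<Rightarrow> ereal \<Rightarrow> ('a \<Rightarrow> real) set" where
  "Lp_space \<Omega> p = {u \<in> borel_measurable (lebesgue_on \<Omega>).
     if p = \<infinity> then \<exists>C. AE x in lebesgue_on \<Omega>. \<bar>u x\<bar> \<le> C
     else integrable (lebesgue_on \<Omega>) (\<lambda>x. \<bar>u x\<bar> powr real_of_ereal p)}"

definition L2_space :: "'a::euclidean_space set \<Rightarrow> ('a \<Rightarrow> real) set" where
  "L2_space \<Omega> = {u \<in> borel_measurable (lebesgue_on \<Omega>). integrable (lebesgue_on \<Omega>) (\<lambda>x. (u x)\<^sup>2)}"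

definition L2_inner :: "'a::euclidean_space set \<Rightarrow> ('a \<Rightarrow> real) \<Rightarrow> ('a \<Rightarrow> real) \<Rightarrow> real" where
  "L2_inner \<Omega> u v = (LINT x|lebesgue_on \<Omega>. u x * v x)"

definition L2_norm :: "'a::euclidean_space set \<Rightarrow> ('a \<Rightarrow> real) \<Rightarrow> real" where
  "L2_norm \<Omega> u = sqrt (LINT x|lebesgue_on \<Omega>. (u x)\<^sup>2)"

text \<open>\<open>Ck k h\<close>: \<open>h\<close> is \<open>k\<close> times continuously differentiable on the whole space.\<close>

primrec Ck :: "nat \<Rightarrow> ('a::euclidean_space \<Rightarrow> real) \<Rightarrow> bool" where
  "Ck 0 h \<longleftrightarrow> continuous_on UNIV h"
| "Ck (Suc k) h \<longleftrightarrow> (\<forall>x. h differentiable (at x)) \<and>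
     (\<forall>i\<in>Basis. Ck k (\<lambda>x. frechet_derivative h (at x) i))"

definition test_functions :: "'a::euclidean_space set \<Rightarrow> ('a \<Rightarrow> real) set" where
  "test_functions \<Omega> =
     {\<psi>. (\<forall>k. Ck k \<psi>) \<and> compact (closure {x. \<psi> x \<noteq> 0}) \<and> closure {x. \<psi> x \<noteq> 0} \<subseteq> \<Omega>}"

definition has_L2_weak_gradient ::
  "'a::euclidean_space set \<Rightarrow> ('a \<Rightarrow> real) \<Rightarrow> ('a \<Rightarrow> 'a) \<Rightarrow> bool" where
  "has_L2_weak_gradient \<Omega> u G \<longleftrightarrow>
     G \<in> borel_measurable (lebesgue_on \<Omega>) \<and>
     integrable (lebesgue_on \<Omega>) (\<lambda>x. (norm (G x))\<^sup>2) \<and>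
     (\<forall>\<psi>\<in>test_functions \<Omega>. \<forall>i\<in>Basis.
        (LINT x|lebesgue_on \<Omega>. u x * frechet_derivative \<psi> (at x) i) =
        - (LINT x|lebesgue_on \<Omega>. (G x \<bullet> i) * \<psi> x))"

text \<open>Weak gradients are unique almost everywhere, so the choice does not affect integrals.\<close>

definition weak_gradient :: "'a::euclidean_space set \<Rightarrow> ('a \<Rightarrow> real) \<Rightarrow> 'a \<Rightarrow> 'a" where
  "weak_gradient \<Omega> u = (SOME G. has_L2_weak_gradient \<Omega> u G)"

definition H1_space :: "'a::euclidean_space set \<Rightarrow> ('a \<Rightarrow> real) set" where
  "H1_space \<Omega> = {u \<in> L2_space \<Omega>. \<exists>G. has_L2_weak_gradient \<Omega> u G}"

definition H1_norm :: "'a::euclidean_space set \<Rightarrow> ('a \<Rightarrow> real) \<Rightarrow> real" where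
  "H1_norm \<Omega> u = sqrt ((LINT x|lebesgue_on \<Omega>. (u x)\<^sup>2) +
     (LINT x|lebesgue_on \<Omega>. (norm (weak_gradient \<Omega> u x))\<^sup>2))"

text \<open>\<open>H\<^sup>1\<^sub>0(\<Omega>)\<close> is the closure of the test functions in \<open>H\<^sup>1(\<Omega>)\<close>.\<close>

definition H10_space :: "'a::euclidean_space set \<Rightarrow> ('a \<Rightarrow> real) set" where
  "H10_space \<Omega> = {u \<in> H1_space \<Omega>.
     \<forall>\<epsilon>>0. \<exists>\<psi>\<in>test_functions \<Omega>. H1_norm \<Omega> (\<lambda>x. u x - \<psi> x) < \<epsilon>}"

section \<open>The Dirichlet Laplacian and its spectral fractional powers\<close>

text \<open>
  The graph of the operator associated with the Dirichlet form: \<open>dirichlet_laplacian \<Omega> u w\<close> says that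
  \<open>u\<close> lies in the domain of \<open>-\<Delta>\<^sub>D\<close> and \<open>-\<Delta>\<^sub>D u = w\<close>.
\<close>

definition dirichlet_laplacian ::
  "'a::euclidean_space set \<Rightarrow> ('a \<Rightarrow> real) \<Rightarrow> ('a \<Rightarrow> real) \<Rightarrow> bool" where
  "dirichlet_laplacian \<Omega> u w \<longleftrightarrow> u \<in> H10_space \<Omega> \<and> w \<in> L2_space \<Omega> \<and>
     (\<forall>v\<in>H10_space \<Omega>.
        (LINT x|lebesgue_on \<Omega>. weak_gradient \<Omega> u x \<bullet> weak_gradient \<Omega> v x) = L2_inner \<Omega> w v)"

definition L2_expansion ::
  "'a::euclidean_space set \<Rightarrow> (nat \<Rightarrow> 'a \<Rightarrow> real) \<Rightarrow> (nat \<Rightarrow> real) \<Rightarrow> ('a \<Rightarrow> real) \<Rightarrow> bool" where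
  "L2_expansion \<Omega> \<phi> c u \<longleftrightarrow> u \<in> L2_space \<Omega> \<and>
     (\<lambda>n. L2_norm \<Omega> (\<lambda>x. u x - (\<Sum>k<n. c k * \<phi> k x))) \<longlonglongrightarrow> 0"

text \<open>
  An enumeration, from index 0, of all eigenvalues of \<open>-\<Delta>\<^sub>D\<close> repeated according to multiplicity,
  together with an orthonormal basis of \<open>L\<^sup>2(\<Omega>)\<close> consisting of corresponding eigenfunctions.
\<close>

definition dirichlet_eigensystem ::
  "'a::euclidean_space set \<Rightarrow> (nat \<Rightarrow> real) \<Rightarrow> (nat \<Rightarrow> 'a \<Rightarrow> real) \<Rightarrow> bool" where
  "dirichlet_eigensystem \<Omega> lam \<phi> \<longleftrightarrow>
     (\<forall>n. 0 < lam n) \<and> mono lam \<and> filterlim lam at_top sequentially \<and>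
     (\<forall>n. dirichlet_laplacian \<Omega> (\<phi> n) (\<lambda>x. lam n * \<phi> n x)) \<and>
     (\<forall>m n. L2_inner \<Omega> (\<phi> m) (\<phi> n) = (if m = n then 1 else 0)) \<and>
     (\<forall>u\<in>L2_space \<Omega>. L2_expansion \<Omega> \<phi> (\<lambda>n. L2_inner \<Omega> u (\<phi> n)) u)"

definition spectral_space ::
  "'a::euclidean_space set \<Rightarrow> (nat \<Rightarrow> real) \<Rightarrow> (nat \<Rightarrow> 'a \<Rightarrow> real) \<Rightarrow> real \<Rightarrow> ('a \<Rightarrow> real) set" where
  "spectral_space \<Omega> lam \<phi> r =
     {u \<in> L2_space \<Omega>. summable (\<lambda>n. lam n powr r * (L2_inner \<Omega> u (\<phi> n))\<^sup>2)}"

text \<open>\<open>(-\<Delta>\<^sub>D)\<^sup>r u\<close>, the \<open>L\<^sup>2\<close> sum of the series; it exists, uniquely a.e., for \<open>u\<close> in the spectral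
  space of order \<open>2 * r\<close>.\<close>

definition frac_laplacian ::
  "'a::euclidean_space set \<Rightarrow> (nat \<Rightarrow> real) \<Rightarrow> (nat \<Rightarrow> 'a \<Rightarrow> real) \<Rightarrow> real \<Rightarrow> ('a \<Rightarrow> real) \<Rightarrow> 'a \<Rightarrow> real" where
  "frac_laplacian \<Omega> lam \<phi> r u =
     (SOME w. L2_expansion \<Omega> \<phi> (\<lambda>n. lam n powr r * L2_inner \<Omega> u (\<phi> n)) w)"

section \<open>The nonlinearity\<close>

definition structural_condition :: "'a::euclidean_space set \<Rightarrow> ('a \<Rightarrow> real \<Rightarrow> real) \<Rightarrow> bool" where
  "structural_condition \<Omega> f \<longleftrightarrow>
     (AE x in lebesgue_on \<Omega>. (\<forall>t. f x (- t) = - f x t) \<and> strict_mono (f x) \<and>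
        continuous_on UNIV (f x) \<and> f x 0 = 0 \<and> filterlim (f x) at_top at_top) \<and>
     (\<forall>t. (\<lambda>x. f x t) \<in> borel_measurable (lebesgue_on \<Omega>))"

definition inverse_nonlinearity :: "('a \<Rightarrow> real \<Rightarrow> real) \<Rightarrow> 'a \<Rightarrow> real \<Rightarrow> real" where
  "inverse_nonlinearity f x = inv (f x)"

definition primitive_of :: "('a \<Rightarrow> real \<Rightarrow> real) \<Rightarrow> 'a \<Rightarrow> real \<Rightarrow> real" where
  "primitive_of f x t = integral {0..\<bar>t\<bar>} (f x)"

definition global_Delta2 :: "'a::euclidean_space set \<Rightarrow> ('a \<Rightarrow> real \<Rightarrow> real) \<Rightarrow> bool" where
  "global_Delta2 \<Omega> f \<longleftrightarrow> (\<exists>c1\<in>{0<..1}. \<exists>c2\<in>{0<..1}. AE x in lebesgue_on \<Omega>. \<forall>t\<ge>0.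
     c1 * (t * f x t) \<le> primitive_of f x t \<and> primitive_of f x t \<le> t * f x t \<and>
     c2 * (t * inverse_nonlinearity f x t) \<le> primitive_of (inverse_nonlinearity f) x t \<and>
     primitive_of (inverse_nonlinearity f) x t \<le> t * inverse_nonlinearity f x t)"

definition local_lipschitz_condition :: "'a::euclidean_space set \<Rightarrow> ('a \<Rightarrow> real \<Rightarrow> real) \<Rightarrow> bool" where
  "local_lipschitz_condition \<Omega> f \<longleftrightarrow> (\<forall>M>0. \<exists>L>0.
     AE x in lebesgue_on \<Omega>. AE y in lebesgue_on \<Omega>. \<forall>u1 u2. \<bar>u1\<bar> \<le> M \<and> \<bar>u2\<bar> \<le> M \<longrightarrow>
       \<bar>f x u1 - f y u2\<bar> \<le> L * \<bar>u1 - u2\<bar>)"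

text \<open>The Musielak-Orlicz space \<open>L\<^sub>F(\<Omega>)\<close>, where \<open>F\<close> is the primitive of \<open>f\<close>.\<close>

definition orlicz_space ::
  "'a::euclidean_space set \<Rightarrow> ('a \<Rightarrow> real \<Rightarrow> real) \<Rightarrow> ('a \<Rightarrow> real) set" where
  "orlicz_space \<Omega> f = {u \<in> borel_measurable (lebesgue_on \<Omega>).
     integrable (lebesgue_on \<Omega>) (\<lambda>x. primitive_of f x (u x))}"

definition energy_space ::
  "'a::euclidean_space set \<Rightarrow> (nat \<Rightarrow> real) \<Rightarrow> (nat \<Rightarrow> 'a \<Rightarrow> real) \<Rightarrow> real \<Rightarrow> ('a \<Rightarrow> real \<Rightarrow> real)
     \<Rightarrow> ('a \<Rightarrow> real) set" where
  "energy_space \<Omega> lam \<phi> s f = spectral_space \<Omega> lam \<phi> s \<inter> orlicz_space \<Omega> f"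

text \<open>The right-hand side is a functional \<open>l\<close> on the energy space.\<close>

definition weak_solution ::
  "'a::euclidean_space set \<Rightarrow> (nat \<Rightarrow> real) \<Rightarrow> (nat \<Rightarrow> 'a \<Rightarrow> real) \<Rightarrow> real \<Rightarrow> ('a \<Rightarrow> real \<Rightarrow> real)
     \<Rightarrow> (('a \<Rightarrow> real) \<Rightarrow> real) \<Rightarrow> ('a \<Rightarrow> real) \<Rightarrow> bool" where
  "weak_solution \<Omega> lam \<phi> s f l u \<longleftrightarrow> u \<in> energy_space \<Omega> lam \<phi> s f \<and>
     (\<forall>v\<in>energy_space \<Omega> lam \<phi> s f.
        (LINT x|lebesgue_on \<Omega>.
           frac_laplacian \<Omega> lam \<phi> (s / 2) u x * frac_laplacian \<Omega> lam \<phi> (s / 2) v x) +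
        (LINT x|lebesgue_on \<Omega>. f x (u x) * v x) = l v)"

end

theory Submission
  imports Defs
begin

text \<open>
  Taking equal arguments in the local Lipschitz condition shows that \<open>f\<close> does not depend on \<open>x\<close>.

  For \<open>0 < r < 1\<close> the squared norm of the spectral space is, up to a constant, the integral of
  \<open>t powr (- 1 - r)\<close> times the squared \<open>K\<close>-functional of the couple \<open>(L\<^sup>2, H\<^sup>1\<^sub>0)\<close>, which for each
  \<open>t\<close> is the infimum of \<open>\<parallel>u - \<psi>\<parallel>\<^sup>2 + t \<parallel>\<nabla>\<psi>\<parallel>\<^sup>2\<close> over test functions \<open>\<psi>\<close>. If \<open>\<Phi>\<close> is Lipschitz and
  vanishes at \<open>0\<close>, then comparing \<open>\<Phi> u\<close> with \<open>\<Phi> \<psi>\<close> shows that composition with \<open>\<Phi>\<close> acts on these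
  spaces with the Lipschitz constant as a bound; no heat semigroup is involved.

  The same description of the norm bounds the \<open>L\<^sup>2\<close> modulus of continuity of \<open>u\<close> under translations.
  Averaging over translations by more than the size of the support gives
  \<open>\<parallel>w\<parallel>\<^sup>2 \<le> C * |supp w| powr (2 * s / N) * E w\<close> for the energy \<open>E\<close> of order \<open>s\<close>, and Stampacchia's
  iteration on the excess of \<open>u\<close> over the levels \<open>k\<close> shows that \<open>u\<close> is bounded. Since
  \<open>g \<in> L\<^sup>2\<close>, the exponent of \<open>g\<close> may be taken at least 2.

  So \<open>f\<close> may be replaced by a globally Lipschitz \<open>\<Phi>\<close>, the equation reads
  \<open>\<lambda>\<^sub>n powr s * u\<^sub>n = (g - \<Phi> u)\<^sub>n\<close>, and as long as \<open>r \<le> \<beta>\<close>, regularity \<open>r\<close> of \<open>u\<close> improves to \<open>r + 2 * s\<close>.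
\<close>

section \<open>Square integrable functions\<close>

text \<open>The \<open>K\<close>-functional is explicit because of a one-dimensional fact:
  \<open>(c - a)^2 + q * a^2\<close> is smallest at \<open>a = c / (1 + q)\<close>, with value
  \<open>q / (1 + q) * c^2\<close>. In the eigenbasis the infimum at \<open>t\<close> therefore has
  the weights \<open>t * lam n / (1 + t * lam n)\<close>. Integrated against
  \<open>t powr (- 1 - r)\<close> these converge exactly for 0 < r < 1, which is where \<beta> < 1
  enters.

  Taking test functions as competitors keeps the chain rule classical. A Lipschitz \<Phi> would
  still destroy smoothness, so it is replaced by polynomials, under which test functions are closed
  if the constant term vanishes.

  Boundedness of \<open>u\<close> is the obstacle because the nonlinearity is only locally
  Lipschitz. In place of a Sobolev embedding, Faber-Krahn combined with Cauchy-Schwarz gives the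
  iteration exponent \<open>4 * s / N + 1 - 2 / p\<close>, with N the dimension, which exceeds 1
  exactly when p > N / (2 * s). An exponent of at least 2 is what allows the part of
  \<open>g\<close> on a small set to be measured in L2.\<close>

definition sq_integrable :: "'a measure \<Rightarrow> ('a \<Rightarrow> 'b::euclidean_space) \<Rightarrow> bool" where
  "sq_integrable M f \<longleftrightarrow> f \<in> borel_measurable M \<and> integrable M (\<lambda>x. (norm (f x))\<^sup>2)"

definition sq_norm :: "'a measure \<Rightarrow> ('a \<Rightarrow> 'b::euclidean_space) \<Rightarrow> real" where
  "sq_norm M f = (LINT x|M. (norm (f x))\<^sup>2)"

lemma sq_norm_nonneg [simp]: "0 \<le> sq_norm M f"
  by (simp add: sq_norm_def)

lemma sq_integrable_measurable: "sq_integrable M f \<Longrightarrow> f \<in> borel_measurable M"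
  by (simp add: sq_integrable_def)

lemma sq_integrable_zero [simp]: "sq_integrable M (\<lambda>x. 0)"
  by (simp add: sq_integrable_def)

lemma integrable_inner:
  assumes "sq_integrable M f" "sq_integrable M g"
  shows "integrable M (\<lambda>x. f x \<bullet> g x)"
proof (rule Bochner_Integration.integrable_bound)
  show "integrable M (\<lambda>x. (norm (f x))\<^sup>2 + (norm (g x))\<^sup>2)"
    using assms by (simp add: sq_integrable_def)
  show "(\<lambda>x. f x \<bullet> g x) \<in> borel_measurable M"
    using assms by (auto simp: sq_integrable_def)
  have "\<bar>f x \<bullet> g x\<bar> \<le> (norm (f x))\<^sup>2 + (norm (g x))\<^sup>2" for x
    using Cauchy_Schwarz_ineq2[of "f x" "g x"] sum_squares_bound[of "norm (f x)" "norm (g x)"]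
      mult_nonneg_nonneg[OF norm_ge_zero[of "f x"] norm_ge_zero[of "g x"]] by linarith
  then show "AE x in M. norm (f x \<bullet> g x) \<le> norm ((norm (f x))\<^sup>2 + (norm (g x))\<^sup>2)"
    by simp
qed

lemma norm_sq_add: "(norm (a + b))\<^sup>2 = (norm a)\<^sup>2 + 2 * (a \<bullet> b) + (norm (b::'b::real_inner))\<^sup>2"
  by (simp add: power2_norm_eq_inner inner_add_left inner_add_right inner_commute)

lemma sq_integrable_add [intro]:
  assumes "sq_integrable M f" "sq_integrable M g"
  shows "sq_integrable M (\<lambda>x. f x + g x)"
  using assms integrable_inner[OF assms] by (auto simp: sq_integrable_def norm_sq_add)

lemma sq_integrable_scaleR [intro]:
  assumes "sq_integrable M f"
  shows "sq_integrable M (\<lambda>x. c *\<^sub>R f x)"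
  using assms by (auto simp: sq_integrable_def power_mult_distrib)

lemma sq_integrable_diff [intro]:
  assumes "sq_integrable M f" "sq_integrable M g"
  shows "sq_integrable M (\<lambda>x. f x - g x)"
  using sq_integrable_add[OF assms(1) sq_integrable_scaleR[OF assms(2), of "-1"]] by simp

lemma sq_integrable_cmult [intro]: "sq_integrable M f \<Longrightarrow> sq_integrable M (\<lambda>x. c * f x)"
  for f :: "'a \<Rightarrow> real"
  using sq_integrable_scaleR[of M f c] by simp

lemma sq_integrable_sum:
  assumes "\<And>i. i \<in> I \<Longrightarrow> sq_integrable M (f i)"
  shows "sq_integrable M (\<lambda>x. \<Sum>i\<in>I. f i x)"
  using assms by (induction I rule: infinite_finite_induct) auto

lemma sq_norm_scaleR [simp]: "sq_norm M (\<lambda>x. c *\<^sub>R f x) = c\<^sup>2 * sq_norm M f"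
  by (simp add: sq_norm_def power_mult_distrib)

lemma sq_norm_cmult [simp]: "sq_norm M (\<lambda>x. c * f x) = c\<^sup>2 * sq_norm M f"
  for f :: "'a \<Rightarrow> real"
  using sq_norm_scaleR[of M c f] by simp

lemma sq_norm_add:
  assumes "sq_integrable M f" "sq_integrable M g"
  shows "sq_norm M (\<lambda>x. f x + g x) = sq_norm M f + 2 * (LINT x|M. f x \<bullet> g x) + sq_norm M g"
  using assms integrable_inner[OF assms] by (simp add: sq_integrable_def sq_norm_def norm_sq_add)

lemma sq_norm_diff:
  assumes "sq_integrable M f" "sq_integrable M g"
  shows "sq_norm M (\<lambda>x. f x - g x) = sq_norm M f - 2 * (LINT x|M. f x \<bullet> g x) + sq_norm M g"
  using sq_norm_add[OF assms(1) sq_integrable_scaleR[OF assms(2), of "-1"]] 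
  by (simp add: sq_norm_def)

lemma Cauchy_Schwarz_integral:
  assumes f: "sq_integrable M f" and g: "sq_integrable M g"
  shows "(LINT x|M. f x \<bullet> g x)\<^sup>2 \<le> sq_norm M f * sq_norm M g"
proof -
  define I where "I = (LINT x|M. f x \<bullet> g x)"
  have quad: "0 \<le> sq_norm M f + 2 * t * I + t\<^sup>2 * sq_norm M g" for t
    using sq_norm_add[OF f sq_integrable_scaleR[OF g, of t]] sq_norm_nonneg[of M "\<lambda>x. f x + t *\<^sub>R g x"]
    by (simp add: I_def)
  show ?thesis
  proof (cases "sq_norm M g = 0")
    case True
    have "I = 0"
    proof (rule ccontr)
      assume "I \<noteq> 0"
      \<comment> \<open>When \<open>g\<close> has norm 0 the quadratic is affine in
        \<open>t\<close>; this \<open>t\<close> gives it the value -1.\<close>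
      then show False using quad[of "- (sq_norm M f + 1) / (2 * I)"] True sq_norm_nonneg[of M f] \<open>I \<noteq> 0\<close> by simp argo
    qed
    then show ?thesis using True by (simp add: I_def)
  next
    case False
    then have pos: "0 < sq_norm M g" using sq_norm_nonneg[of M g] by linarith
    have "0 \<le> sq_norm M f + 2 * (- I / sq_norm M g) * I + (- I / sq_norm M g)\<^sup>2 * sq_norm M g"
      by (rule quad)
    also have "\<dots> = sq_norm M f - I\<^sup>2 / sq_norm M g"
      using pos by (simp add: power2_eq_square field_simps)
    finally show ?thesis using pos by (simp add: I_def field_simps)
  qed
qed

lemma sqrt_sq_norm_triangle:
  assumes f: "sq_integrable M f" and g: "sq_integrable M g"
  shows "sqrt (sq_norm M (\<lambda>x. f x + g x)) \<le> sqrt (sq_norm M f) + sqrt (sq_norm M g)"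
proof (rule real_le_lsqrt)
  have "(LINT x|M. f x \<bullet> g x) \<le> sqrt (sq_norm M f) * sqrt (sq_norm M g)"
    using Cauchy_Schwarz_integral[OF f g] by (metis real_le_rsqrt real_sqrt_mult)
  then show "sq_norm M (\<lambda>x. f x + g x) \<le> (sqrt (sq_norm M f) + sqrt (sq_norm M g))\<^sup>2"
    by (simp add: sq_norm_add[OF f g] power2_sum)
qed simp

lemma sqrt_sq_norm_triangle_diff:
  assumes f: "sq_integrable M f" and g: "sq_integrable M g"
  shows "sqrt (sq_norm M (\<lambda>x. f x - g x)) \<le> sqrt (sq_norm M f) + sqrt (sq_norm M g)"
  using sqrt_sq_norm_triangle[OF f sq_integrable_scaleR[OF g, of "-1"]] by (simp add: sq_norm_def)

lemma sq_norm_mono: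
  assumes "sq_integrable M g" "AE x in M. norm (f x) \<le> norm (g x)"
  shows "sq_norm M f \<le> sq_norm M g"
  unfolding sq_norm_def
  by (rule integral_mono_AE') (use assms in \<open>auto simp: sq_integrable_def power_mono elim!: eventually_mono\<close>)

lemma sq_integrable_bound:
  assumes "sq_integrable M g" "f \<in> borel_measurable M" "AE x in M. norm (f x) \<le> norm (g x)"
  shows "sq_integrable M f"
proof -
  have "integrable M (\<lambda>x. (norm (f x))\<^sup>2)"
    by (rule Bochner_Integration.integrable_bound[where f="\<lambda>x. (norm (g x))\<^sup>2"])
      (use assms in \<open>auto simp: sq_integrable_def power_mono elim!: eventually_mono\<close>)
  then show ?thesis using assms by (simp add: sq_integrable_def)
qed

lemma sq_norm_cong_AE:
  assumes "f \<in> borel_measurable M" "g \<in> borel_measurable M" "AE x in M. f x = g x"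
  shows "sq_norm M f = sq_norm M g"
  unfolding sq_norm_def by (rule integral_cong_AE) (use assms in auto)

lemma sq_norm_eq_0D:
  assumes "sq_integrable M f" "sq_norm M f = 0"
  shows "AE x in M. f x = 0"
  using assms integral_nonneg_eq_0_iff_AE[of M "\<lambda>x. (norm (f x))\<^sup>2"]
  by (simp add: sq_integrable_def sq_norm_def)

lemma (in finite_measure) sq_integrable_const: "sq_integrable M (\<lambda>x. c)"
  by (simp add: sq_integrable_def)

lemma (in finite_measure) sq_integrable_bounded:
  assumes "f \<in> borel_measurable M" "AE x in M. norm (f x) \<le> C"
  shows "sq_integrable M f"
  by (rule sq_integrable_bound[OF sq_integrable_const[of C] assms(1)]) (use assms(2) in auto)

lemma (in finite_measure) sq_integrable_imp_integrable:
  assumes "sq_integrable M f"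
  shows "integrable M f"
proof -
  have "integrable M (\<lambda>x. 1 + (norm (f x))\<^sup>2)" using assms by (simp add: sq_integrable_def)
  moreover have "norm (f x) \<le> norm (1 + (norm (f x))\<^sup>2)" for x
  proof -
    have "2 * norm (f x) \<le> (norm (f x))\<^sup>2 + 1" using sum_squares_bound[of "norm (f x)" 1] by simp
    then have "norm (f x) \<le> 1 + (norm (f x))\<^sup>2" using norm_ge_zero[of "f x"] by linarith
    then show ?thesis by simp
  qed
  ultimately show ?thesis
    using assms by (intro Bochner_Integration.integrable_bound[where g=f and f="\<lambda>x. 1 + (norm (f x))\<^sup>2"])
      (auto simp: sq_integrable_def)
qed

lemma (in finite_measure) integral_norm_le_sq_norm:
  assumes "sq_integrable M f"
  shows "(LINT x|M. norm (f x)) \<le> sqrt (measure M (space M)) * sqrt (sq_norm M f)"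
proof -
  have nf: "sq_integrable M (\<lambda>x. norm (f x))" using assms by (auto simp: sq_integrable_def)
  have "(LINT x|M. norm (f x))\<^sup>2 \<le> measure M (space M) * sq_norm M f"
    using Cauchy_Schwarz_integral[OF sq_integrable_const[of 1] nf] by (simp add: sq_norm_def)
  then show ?thesis by (metis real_le_rsqrt real_sqrt_mult)
qed

lemma L2_space_iff: "u \<in> L2_space \<Omega> \<longleftrightarrow> sq_integrable (lebesgue_on \<Omega>) u"
  by (simp add: L2_space_def sq_integrable_def)

lemma L2_norm_eq: "L2_norm \<Omega> u = sqrt (sq_norm (lebesgue_on \<Omega>) u)"
  by (simp add: L2_norm_def sq_norm_def)

section \<open>Orthonormal expansions\<close>

text \<open>Cauchy in L2 implies Cauchy in L1 on a finite measure space, so a subsequence converges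
  almost everywhere. Its pointwise limit is then compared with every \<open>S n\<close>, not merely
  with the subsequence, by Fatou's lemma.\<close>

lemma (in finite_measure) sq_norm_complete:
  fixes S :: "nat \<Rightarrow> 'a \<Rightarrow> real"
  assumes S: "\<And>n. sq_integrable M (S n)"
    and Cauchy: "\<And>e. e > 0 \<Longrightarrow> \<exists>N. \<forall>i\<ge>N. \<forall>j\<ge>N. sq_norm M (\<lambda>x. S i x - S j x) < e"
  obtains w where "sq_integrable M w" "(\<lambda>n. sq_norm M (\<lambda>x. w x - S n x)) \<longlonglongrightarrow> 0"
proof -
  define \<mu> where "\<mu> = sqrt (measure M (space M))"
  have [measurable]: "S n \<in> borel_measurable M" for n
    using S by (rule sq_integrable_measurable)
  obtain r where r: "strict_mono r" and rC: "AE x in M. Cauchy (\<lambda>i. S (r i) x)"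
  proof (rule cauchy_L1_AE_cauchy_subseq)
    show "integrable M (S n)" for n using S by (rule sq_integrable_imp_integrable)
    show "\<exists>N. \<forall>i\<ge>N. \<forall>j\<ge>N. (LINT x|M. norm (S i x - S j x)) < e" if "e > 0" for e
    proof -
      have "\<mu> \<ge> 0" by (simp add: \<mu>_def)
      obtain N where N: "\<And>i j. i \<ge> N \<Longrightarrow> j \<ge> N \<Longrightarrow> sq_norm M (\<lambda>x. S i x - S j x) < (e / (\<mu> + 1))\<^sup>2"
        using Cauchy[of "(e / (\<mu> + 1))\<^sup>2"] \<open>e > 0\<close> \<open>\<mu> \<ge> 0\<close> by (auto simp: zero_less_divide_iff)
      show ?thesis
      proof (intro exI allI impI)
        fix i j assume ij: "i \<ge> N" "j \<ge> N"
        have "(LINT x|M. norm (S i x - S j x)) \<le> \<mu> * sqrt (sq_norm M (\<lambda>x. S i x - S j x))"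
          unfolding \<mu>_def by (rule integral_norm_le_sq_norm) (use S in auto)
        also have "\<dots> \<le> \<mu> * (e / (\<mu> + 1))"
          using N[OF ij] \<open>\<mu> \<ge> 0\<close> \<open>e > 0\<close> 
          by (intro mult_left_mono real_le_lsqrt) auto
        also have "\<dots> < e" using \<open>\<mu> \<ge> 0\<close> \<open>e > 0\<close> by (simp add: field_simps)
        finally show "(LINT x|M. norm (S i x - S j x)) < e" .
      qed
    qed
  qed
  define w where "w x = lim (\<lambda>i. S (r i) x)" for x
  have [measurable]: "w \<in> borel_measurable M" unfolding w_def by measurable
  have lim: "AE x in M. (\<lambda>i. S (r i) x) \<longlonglongrightarrow> w x"
    using rC by eventually_elim (simp add: w_def convergent_LIMSEQ_iff[symmetric] Cauchy_convergent)
  \<comment> \<open>Fatou along the subsequence with \<open>n\<close> fixed. Working with the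
    nonnegative integral avoids presupposing that \<open>w - S n\<close> is square
    integrable.\<close>
  have key: "(\<integral>\<^sup>+ x. ennreal ((w x - S n x)\<^sup>2) \<partial>M) \<le> ennreal e"
    if "e > 0" and N: "\<And>i j. i \<ge> N \<Longrightarrow> j \<ge> N \<Longrightarrow> sq_norm M (\<lambda>x. S i x - S j x) < e" and "n \<ge> N" for e N n
  proof -
    have "(\<integral>\<^sup>+ x. ennreal ((w x - S n x)\<^sup>2) \<partial>M) = (\<integral>\<^sup>+ x. liminf (\<lambda>i. ennreal ((S (r i) x - S n x)\<^sup>2)) \<partial>M)"
    proof (rule nn_integral_cong_AE, use lim in eventually_elim)
      case (elim x)
      then have "(\<lambda>i. ennreal ((S (r i) x - S n x)\<^sup>2)) \<longlonglongrightarrow> ennreal ((w x - S n x)\<^sup>2)"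
        by (intro tendsto_intros)
      from lim_imp_Liminf[OF _ this] show ?case by simp
    qed
    also have "\<dots> \<le> liminf (\<lambda>i. \<integral>\<^sup>+ x. ennreal ((S (r i) x - S n x)\<^sup>2) \<partial>M)"
      by (rule nn_integral_liminf) measurable
    also have "\<dots> \<le> ennreal e"
    proof -
      have "(\<integral>\<^sup>+ x. ennreal ((S (r i) x - S n x)\<^sup>2) \<partial>M) \<le> ennreal e" if "i \<ge> N" for i
      proof -
        have si: "sq_integrable M (\<lambda>x. S (r i) x - S n x)" using S by auto
        have "(\<integral>\<^sup>+ x. ennreal ((S (r i) x - S n x)\<^sup>2) \<partial>M) = ennreal (sq_norm M (\<lambda>x. S (r i) x - S n x))"
          using nn_integral_eq_integral[of M "\<lambda>x. (S (r i) x - S n x)\<^sup>2"] si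
          by (simp add: sq_norm_def sq_integrable_def)
        moreover have "r i \<ge> N" using that strict_mono_imp_increasing[OF r, of i] by simp
        ultimately show ?thesis using N[of "r i" n] \<open>n \<ge> N\<close> by (simp add: ennreal_leI)
      qed
      then have "liminf (\<lambda>i. \<integral>\<^sup>+ x. ennreal ((S (r i) x - S n x)\<^sup>2) \<partial>M) \<le> limsup (\<lambda>i. \<integral>\<^sup>+ x. ennreal ((S (r i) x - S n x)\<^sup>2) \<partial>M)"
        by (intro Liminf_le_Limsup) simp
      also have "\<dots> \<le> ennreal e"
        by (rule Limsup_bounded) (use \<open>\<And>i. i \<ge> N \<Longrightarrow> _ \<le> _\<close> in \<open>auto simp: eventually_sequentially\<close>)
      finally show ?thesis .
    qed
    finally show ?thesis .
  qed
  have sq: "sq_integrable M (\<lambda>x. w x - S n x) \<and> sq_norm M (\<lambda>x. w x - S n x) \<le> e"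
    if "e > 0" and N: "\<And>i j. i \<ge> N \<Longrightarrow> j \<ge> N \<Longrightarrow> sq_norm M (\<lambda>x. S i x - S j x) < e" and "n \<ge> N" for e N n
  proof -
    have le: "(\<integral>\<^sup>+ x. ennreal ((w x - S n x)\<^sup>2) \<partial>M) \<le> ennreal e" by (rule key[OF that])
    have int: "integrable M (\<lambda>x. (w x - S n x)\<^sup>2)"
      by (rule integrableI_nonneg) (use le in \<open>auto intro: le_less_trans\<close>)
    moreover have "ennreal (LINT x|M. (w x - S n x)\<^sup>2) \<le> ennreal e"
      using le nn_integral_eq_integral[OF int] by simp
    ultimately show ?thesis using \<open>e > 0\<close> by (simp add: sq_integrable_def sq_norm_def)
  qed
  show thesis
  proof
    obtain N where N: "\<And>i j. i \<ge> N \<Longrightarrow> j \<ge> N \<Longrightarrow> sq_norm M (\<lambda>x. S i x - S j x) < 1"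
      using Cauchy[of 1] by auto
    have "sq_integrable M (\<lambda>x. w x - S N x)" using sq[OF _ N, of N] by simp
    from sq_integrable_add[OF this S[of N]] show "sq_integrable M w" by simp
    show "(\<lambda>n. sq_norm M (\<lambda>x. w x - S n x)) \<longlonglongrightarrow> 0"
    proof (rule LIMSEQ_I)
      fix e :: real assume "e > 0"
      then obtain N where N: "\<And>i j. i \<ge> N \<Longrightarrow> j \<ge> N \<Longrightarrow> sq_norm M (\<lambda>x. S i x - S j x) < e / 2"
        using Cauchy[of "e / 2"] by auto
      have "norm (sq_norm M (\<lambda>x. w x - S n x) - 0) < e" if "n \<ge> N" for n
        using sq[OF _ N that] \<open>e > 0\<close> by simp
      then show "\<exists>no. \<forall>n\<ge>no. norm (sq_norm M (\<lambda>x. w x - S n x) - 0) < e" by blast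
    qed
  qed
qed

section \<open>Fourier coefficients in the eigenbasis\<close>

locale dirichlet_system =
  fixes \<Omega> :: "'a::euclidean_space set" and lam :: "nat \<Rightarrow> real" and \<phi> :: "nat \<Rightarrow> 'a \<Rightarrow> real"
  assumes open_domain: "open \<Omega>" and bounded_domain: "bounded \<Omega>"
    and eigensystem: "dirichlet_eigensystem \<Omega> lam \<phi>"
begin

abbreviation "M \<equiv> lebesgue_on \<Omega>"

definition coeff :: "('a \<Rightarrow> real) \<Rightarrow> nat \<Rightarrow> real" where
  "coeff u n = L2_inner \<Omega> u (\<phi> n)"

lemma domain_sets [simp]: "\<Omega> \<in> sets lebesgue"
  using open_domain by (simp add: borel_open)

lemma finite_measure_domain: "finite_measure M"
proof
  have "\<Omega> \<in> lmeasurable" using bounded_domain by (simp add: bounded_set_imp_lmeasurable)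
  then show "emeasure M (space M) \<noteq> \<infinity>"
    by (auto simp: emeasure_restrict_space fmeasurable_def space_restrict_space)
qed

sublocale finite_measure M
  by (rule finite_measure_domain)

lemma lam_pos: "0 < lam n"
  and mono_lam: "mono lam"
  and eigenfunction: "dirichlet_laplacian \<Omega> (\<phi> n) (\<lambda>x. lam n * \<phi> n x)"
  and orthonormal: "L2_inner \<Omega> (\<phi> m) (\<phi> n) = (if m = n then 1 else 0)"
  and expansion: "u \<in> L2_space \<Omega> \<Longrightarrow> L2_expansion \<Omega> \<phi> (coeff u) u"
  using eigensystem by (simp_all add: dirichlet_eigensystem_def coeff_def[abs_def])

lemma eigenfunction_H10: "\<phi> n \<in> H10_space \<Omega>"
  using eigenfunction by (simp add: dirichlet_laplacian_def)

lemma eigenfunction_L2: "sq_integrable M (\<phi> n)"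
  using eigenfunction_H10[of n] by (simp add: H10_space_def H1_space_def L2_space_iff)

lemma coeff_add:
  "sq_integrable M u \<Longrightarrow> sq_integrable M v \<Longrightarrow> coeff (\<lambda>x. u x + v x) n = coeff u n + coeff v n"
  using integrable_inner[OF _ eigenfunction_L2, of u n] integrable_inner[OF _ eigenfunction_L2, of v n]
  by (simp add: coeff_def L2_inner_def distrib_right)

lemma coeff_diff:
  "sq_integrable M u \<Longrightarrow> sq_integrable M v \<Longrightarrow> coeff (\<lambda>x. u x - v x) n = coeff u n - coeff v n"
  using integrable_inner[OF _ eigenfunction_L2, of u n] integrable_inner[OF _ eigenfunction_L2, of v n]
  by (simp add: coeff_def L2_inner_def left_diff_distrib)

lemma coeff_cmult: "coeff (\<lambda>x. c * u x) n = c * coeff u n"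
  by (simp add: coeff_def L2_inner_def mult.assoc)

lemma coeff_cong_AE:
  assumes "AE x in M. u x = v x" "u \<in> borel_measurable M" "v \<in> borel_measurable M"
  shows "coeff u n = coeff v n"
proof -
  have [measurable]: "\<phi> n \<in> borel_measurable M" by (rule sq_integrable_measurable[OF eigenfunction_L2])
  show ?thesis using assms unfolding coeff_def L2_inner_def
    by (intro integral_cong_AE) auto
qed

definition partial :: "(nat \<Rightarrow> real) \<Rightarrow> nat \<Rightarrow> 'a \<Rightarrow> real" where
  "partial a m x = (\<Sum>k<m. a k * \<phi> k x)"

lemma partial_Suc: "partial a (Suc m) = (\<lambda>x. partial a m x + a m * \<phi> m x)"
  by (simp add: partial_def fun_eq_iff)

lemma partial_L2: "sq_integrable M (partial a m)"
  unfolding partial_def[abs_def] using eigenfunction_L2 by (intro sq_integrable_sum) auto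

lemma coeff_partial: "coeff (partial a m) n = (if n < m then a n else 0)"
proof (induction m)
  case 0
  show ?case by (simp add: coeff_def L2_inner_def partial_def)
next
  case (Suc m)
  have "coeff (partial a (Suc m)) n = coeff (partial a m) n + a m * coeff (\<phi> m) n"
    unfolding partial_Suc using partial_L2 eigenfunction_L2 by (simp add: coeff_add coeff_cmult sq_integrable_cmult)
  with Suc show ?case by (auto simp: coeff_def orthonormal less_Suc_eq)
qed

text \<open>The coefficients \<open>a\<close> are arbitrary rather than those of \<open>u\<close>:
  besides Parseval, this evaluates the distance of two partial sums and the damped sums that nearly
  attain the \<open>K\<close>-functional.\<close>

lemma sq_norm_diff_partial:
  assumes u: "sq_integrable M u"
  shows "sq_norm M (\<lambda>x. u x - partial a m x) = sq_norm M u - (\<Sum>k<m. (coeff u k)\<^sup>2) + (\<Sum>k<m. (coeff u k - a k)\<^sup>2)"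
proof (induction m)
  case 0
  show ?case by (simp add: partial_def)
next
  case (Suc m)
  have d: "sq_integrable M (\<lambda>x. u x - partial a m x)" using u partial_L2 by auto
  have eq: "(\<lambda>x. u x - partial a (Suc m) x) = (\<lambda>x. (u x - partial a m x) - a m * \<phi> m x)"
    by (simp add: partial_Suc algebra_simps)
  have "(LINT x|M. (u x - partial a m x) * (a m * \<phi> m x)) = a m * coeff (\<lambda>x. u x - partial a m x) m"
    by (simp add: coeff_def L2_inner_def mult.left_commute)
  also have "\<dots> = a m * coeff u m"
    by (simp add: coeff_diff[OF u partial_L2] coeff_partial)
  finally have cross: "(LINT x|M. (u x - partial a m x) \<bullet> (a m * \<phi> m x)) = a m * coeff u m"
    by simp
  have one: "sq_norm M (\<phi> m) = 1"
    using orthonormal[of m m] by (simp add: sq_norm_def L2_inner_def power2_eq_square)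
  show ?case
    unfolding eq sq_norm_diff[OF d sq_integrable_cmult[OF eigenfunction_L2]] cross Suc.IH
    by (simp add: one power2_eq_square algebra_simps)
qed

lemma Parseval:
  assumes u: "sq_integrable M u"
  shows "(\<lambda>n. (coeff u n)\<^sup>2) sums sq_norm M u"
proof -
  have "(\<lambda>m. sqrt (sq_norm M (\<lambda>x. u x - partial (coeff u) m x))) \<longlonglongrightarrow> 0"
    using expansion[of u] u by (simp add: L2_expansion_def L2_norm_eq partial_def L2_space_iff)
  from tendsto_power[OF this, of 2]
  have "(\<lambda>m. sq_norm M (\<lambda>x. u x - partial (coeff u) m x)) \<longlonglongrightarrow> 0" by simp
  from tendsto_diff[OF tendsto_const[of "sq_norm M u"] this] show ?thesis
    by (simp add: sums_def sq_norm_diff_partial[OF u])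
qed

lemma summable_coeff_sq: "sq_integrable M u \<Longrightarrow> summable (\<lambda>n. (coeff u n)\<^sup>2)"
  using Parseval sums_summable by blast

text \<open>Polarisation of \<open>Parseval\<close>.\<close>

lemma Parseval_inner:
  assumes u: "sq_integrable M u" and v: "sq_integrable M v"
  shows "(\<lambda>n. coeff u n * coeff v n) sums (LINT x|M. u x * v x)"
proof -
  have "(\<lambda>n. ((coeff (\<lambda>x. u x + v x) n)\<^sup>2 - (coeff u n)\<^sup>2 - (coeff v n)\<^sup>2) / 2) sums
     ((sq_norm M (\<lambda>x. u x + v x) - sq_norm M u - sq_norm M v) / 2)"
    using u v by (intro sums_divide sums_diff Parseval) auto
  then show ?thesis
    by (simp add: coeff_add[OF u v] sq_norm_add[OF u v] power2_sum)
qed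

text \<open>For \<open>m > n\<close> the remainder \<open>w - partial c m\<close> has
  \<open>n\<close>-th coefficient \<open>coeff w n - c n\<close>, and Parseval bounds its square by
  a quantity that tends to 0.\<close>

lemma expansion_coeff:
  assumes "L2_expansion \<Omega> \<phi> c w"
  shows "coeff w n = c n"
proof -
  have w: "sq_integrable M w" using assms by (simp add: L2_expansion_def L2_space_iff)
  have lim: "(\<lambda>m. sqrt (sq_norm M (\<lambda>x. w x - partial c m x))) \<longlonglongrightarrow> 0"
    using assms by (simp add: L2_expansion_def L2_norm_eq partial_def)
  have "(coeff w n - c n)\<^sup>2 \<le> 0"
  proof (rule LIMSEQ_le_const[OF tendsto_power[OF lim, of 2, simplified]], intro exI allI impI)
    fix m assume "m \<ge> Suc n"
    have d: "sq_integrable M (\<lambda>x. w x - partial c m x)" using w partial_L2 by auto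
    have "(coeff w n - c n)\<^sup>2 = (coeff (\<lambda>x. w x - partial c m x) n)\<^sup>2"
      using \<open>m \<ge> Suc n\<close> by (simp add: coeff_diff[OF w partial_L2] coeff_partial)
    also have "\<dots> \<le> (\<Sum>k. (coeff (\<lambda>x. w x - partial c m x) k)\<^sup>2)"
      using sum_le_suminf[OF summable_coeff_sq[OF d], of "{n}"] by simp
    also have "\<dots> = sq_norm M (\<lambda>x. w x - partial c m x)"
      using Parseval[OF d] by (simp add: sums_iff)
    finally show "(coeff w n - c n)\<^sup>2 \<le> sq_norm M (\<lambda>x. w x - partial c m x)" .
  qed
  then show ?thesis by simp
qed

lemma Riesz_Fischer:
  assumes "summable (\<lambda>n. (c n)\<^sup>2)"
  shows "\<exists>w. L2_expansion \<Omega> \<phi> c w"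
proof -
  \<comment> \<open>An instance of \<open>sq_norm_diff_partial\<close> with the longer partial sum
    in the place of \<open>u\<close>.\<close>
  have dist: "sq_norm M (\<lambda>x. partial c i x - partial c j x) = (\<Sum>k=j..<i. (c k)\<^sup>2)" if "j \<le> i" for i j
  proof -
    have "(\<Sum>k<i. (coeff (partial c i) k)\<^sup>2) = (\<Sum>k<i. (c k)\<^sup>2)" by (simp add: coeff_partial)
    moreover have "sq_norm M (partial c i) = (\<Sum>k<i. (c k)\<^sup>2)"
    proof -
      have "(\<lambda>n. (coeff (partial c i) n)\<^sup>2) sums (\<Sum>k<i. (coeff (partial c i) k)\<^sup>2)"
        by (rule sums_finite) (auto simp: coeff_partial)
      then show ?thesis using Parseval[OF partial_L2[of c i]]
        by (simp add: sums_iff coeff_partial)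
    qed
    moreover have "(\<Sum>k<j. (coeff (partial c i) k)\<^sup>2) = (\<Sum>k<j. (c k)\<^sup>2)"
      "(\<Sum>k<j. (coeff (partial c i) k - c k)\<^sup>2) = 0"
      using that by (auto simp: coeff_partial intro!: sum.cong sum.neutral)
    moreover have "(\<Sum>k<i. (c k)\<^sup>2) = (\<Sum>k<j. (c k)\<^sup>2) + (\<Sum>k=j..<i. (c k)\<^sup>2)"
      using that by (simp add: sum.atLeastLessThan_concat lessThan_atLeast0)
    ultimately show ?thesis using sq_norm_diff_partial[OF partial_L2[of c i], of c j] by simp
  qed
  obtain w where w: "sq_integrable M w" "(\<lambda>n. sq_norm M (\<lambda>x. w x - partial c n x)) \<longlonglongrightarrow> 0"
  proof (rule sq_norm_complete[of "partial c"])
    show "sq_integrable M (partial c n)" for n by (rule partial_L2)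
    fix e :: real assume "e > 0"
    then obtain N where N: "\<And>m n. m \<ge> N \<Longrightarrow> norm (\<Sum>k=m..<n. (c k)\<^sup>2) < e"
      using assms unfolding summable_Cauchy by blast
    have "sq_norm M (\<lambda>x. partial c i x - partial c j x) < e" if "i \<ge> N" "j \<ge> N" for i j
    proof (cases "j \<le> i")
      case True
      then show ?thesis using dist[OF True] N[OF that(2), of i] by simp
    next
      case False
      have "sq_norm M (\<lambda>x. partial c i x - partial c j x) = sq_norm M (\<lambda>x. partial c j x - partial c i x)"
        by (simp add: sq_norm_def power2_commute)
      then show ?thesis using dist[of i j] False N[OF that(1), of j] by simp
    qed
    then show "\<exists>N. \<forall>i\<ge>N. \<forall>j\<ge>N. sq_norm M (\<lambda>x. partial c i x - partial c j x) < e" by blast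
  qed
  have "(\<lambda>n. sqrt (sq_norm M (\<lambda>x. w x - partial c n x))) \<longlonglongrightarrow> 0"
    using tendsto_real_sqrt[OF w(2)] by simp
  then show ?thesis using w(1) by (auto simp: L2_expansion_def L2_space_iff L2_norm_eq partial_def)
qed

lemma eq_zero_AE_if_coeff_zero:
  assumes "sq_integrable M u" "\<And>n. coeff u n = 0"
  shows "AE x in M. u x = 0"
  using Parseval[OF assms(1)] assms(2) sq_norm_eq_0D[OF assms(1)] by (simp add: sums_iff)

section \<open>Spectral spaces and the fractional energy\<close>

lemma spectral_space_iff:
  "u \<in> spectral_space \<Omega> lam \<phi> r \<longleftrightarrow> sq_integrable M u \<and> summable (\<lambda>n. lam n powr r * (coeff u n)\<^sup>2)"
  by (simp add: spectral_space_def L2_space_iff coeff_def)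

text \<open>Riesz-Fischer provides a witness, so the choice in \<open>frac_laplacian\<close> is
  legitimate. Order \<open>2 * r\<close> of \<open>u\<close> is what makes the multiplied
  coefficients square summable.\<close>

lemma frac_laplacian_expansion:
  assumes "u \<in> spectral_space \<Omega> lam \<phi> (2 * r)"
  shows "L2_expansion \<Omega> \<phi> (\<lambda>n. lam n powr r * coeff u n) (frac_laplacian \<Omega> lam \<phi> r u)"
proof -
  have "lam n powr (2 * r) = (lam n powr r)\<^sup>2" for n
    using powr_powr[of "lam n" r 2] lam_pos[of n] by (simp add: powr_numeral mult.commute)
  then have "summable (\<lambda>n. (lam n powr r * coeff u n)\<^sup>2)"
    using assms by (simp add: spectral_space_iff power_mult_distrib)
  from Riesz_Fischer[OF this] show ?thesis
    unfolding frac_laplacian_def coeff_def by (rule someI_ex)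
qed

text \<open>Passing to coefficients removes the chosen representatives of the fractional Laplacian
  from the weak equation.\<close>

lemma energy_form_sums:
  assumes "u \<in> spectral_space \<Omega> lam \<phi> s" "v \<in> spectral_space \<Omega> lam \<phi> s"
  shows "(\<lambda>n. lam n powr s * (coeff u n * coeff v n)) sums
    (LINT x|M. frac_laplacian \<Omega> lam \<phi> (s / 2) u x * frac_laplacian \<Omega> lam \<phi> (s / 2) v x)"
proof -
  have "L2_expansion \<Omega> \<phi> (\<lambda>n. lam n powr (s / 2) * coeff w n) (frac_laplacian \<Omega> lam \<phi> (s / 2) w)"
    if "w \<in> spectral_space \<Omega> lam \<phi> s" for w
    using frac_laplacian_expansion[of w "s / 2"] that by simp
  note exps = this[OF assms(1)] this[OF assms(2)]
  have L2: "sq_integrable M w" if "L2_expansion \<Omega> \<phi> c w" for c w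
    using that by (simp add: L2_expansion_def L2_space_iff)
  have *: "lam n powr (s / 2) * a * (lam n powr (s / 2) * b) = lam n powr s * (a * b)" for n a b
    by (simp add: powr_add[symmetric] mult.assoc[symmetric] mult.left_commute)
  show ?thesis
    using Parseval_inner[OF L2[OF exps(1)] L2[OF exps(2)]]
    by (simp add: expansion_coeff[OF exps(1)] expansion_coeff[OF exps(2)] *)
qed

end

section \<open>Test functions\<close>

lemma Ck_imp_continuous: "Ck k h \<Longrightarrow> continuous_on UNIV h"
  by (cases k) (auto simp: differentiable_imp_continuous_within continuous_at_imp_continuous_on)

lemma Ck_SucD: "Ck (Suc k) h \<Longrightarrow> Ck k h"
proof (induction k arbitrary: h)
  case 0
  then show ?case using Ck_imp_continuous[of "Suc 0" h] by simp
next
  case (Suc k)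
  then show ?case by (auto simp del: Ck.simps(2) simp: Ck.simps(2)[of "Suc k" h] Ck.simps(2)[of k h])
qed

lemma Ck_const: "Ck k (\<lambda>x. c)"
  by (induction k arbitrary: c) auto

lemma frechet_derivative_add:
  fixes f g :: "'a::real_normed_vector \<Rightarrow> 'b::real_normed_vector"
  assumes "f differentiable (at x)" "g differentiable (at x)"
  shows "frechet_derivative (\<lambda>x. f x + g x) (at x) = (\<lambda>h. frechet_derivative f (at x) h + frechet_derivative g (at x) h)"
  using assms by (intro frechet_derivative_at[symmetric] derivative_intros) (auto simp: frechet_derivative_works)

lemma frechet_derivative_mult:
  fixes f g :: "'a::real_normed_vector \<Rightarrow> real"
  assumes "f differentiable (at x)" "g differentiable (at x)"
  shows "frechet_derivative (\<lambda>x. f x * g x) (at x) = (\<lambda>h. f x * frechet_derivative g (at x) h + frechet_derivative f (at x) h * g x)"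
  using assms by (intro frechet_derivative_at[symmetric] derivative_intros) (auto simp: frechet_derivative_works)

lemma Ck_add: "Ck k f \<Longrightarrow> Ck k g \<Longrightarrow> Ck k (\<lambda>x. f x + g x)"
  by (induction k arbitrary: f g) (auto intro: continuous_on_add simp: frechet_derivative_add)

lemma Ck_mult: "Ck k f \<Longrightarrow> Ck k g \<Longrightarrow> Ck k (\<lambda>x. f x * g x)"
proof (induction k arbitrary: f g)
  case 0
  then show ?case by (auto intro: continuous_on_mult)
next
  case (Suc k)
  then show ?case
    using Ck_SucD[of k f] Ck_SucD[of k g]
    by (auto simp: frechet_derivative_mult intro!: Ck_add Suc.IH)
qed

lemma Ck_power: "Ck k f \<Longrightarrow> Ck k (\<lambda>x. f x ^ n)"
  by (induction n) (auto intro: Ck_const Ck_mult)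

lemma Ck_sum: "(\<And>i. i \<in> I \<Longrightarrow> Ck k (f i)) \<Longrightarrow> Ck k (\<lambda>x. \<Sum>i\<in>I. f i x)"
  by (induction I rule: infinite_finite_induct) (auto intro: Ck_const Ck_add)

lemma test_functionsI:
  assumes "\<And>k. Ck k \<psi>" "compact K" "K \<subseteq> \<Omega>" "\<And>x. x \<notin> K \<Longrightarrow> \<psi> x = 0"
  shows "\<psi> \<in> test_functions \<Omega>"
proof -
  have sub: "closure {x. \<psi> x \<noteq> 0} \<subseteq> K"
    using assms by (intro closure_minimal) (auto intro: compact_imp_closed)
  then have "compact (closure {x. \<psi> x \<noteq> 0})"
    using assms(2) compact_Int_closed[of K "closure {x. \<psi> x \<noteq> 0}"] by (simp add: inf.absorb2)
  then show ?thesis using assms sub by (auto simp: test_functions_def)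
qed

lemma test_functionsE:
  assumes "\<psi> \<in> test_functions \<Omega>"
  obtains K where "compact K" "K \<subseteq> \<Omega>" "\<And>x. x \<notin> K \<Longrightarrow> \<psi> x = 0"
  using assms closure_subset[of "{x. \<psi> x \<noteq> 0}"]
  by (intro that[of "closure {x. \<psi> x \<noteq> 0}"]) (auto simp: test_functions_def simp del: compact_closure)

lemma test_function_Ck: "\<psi> \<in> test_functions \<Omega> \<Longrightarrow> Ck k \<psi>"
  by (simp add: test_functions_def)

lemma test_function_differentiable: "\<psi> \<in> test_functions \<Omega> \<Longrightarrow> \<psi> differentiable (at x)"
  using test_function_Ck[of \<psi> \<Omega> "Suc 0"] by simp

lemma test_function_has_derivative:
  "\<psi> \<in> test_functions \<Omega> \<Longrightarrow> (\<psi> has_derivative frechet_derivative \<psi> (at x)) (at x)"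
  using test_function_differentiable frechet_derivative_works by blast

lemma test_function_continuous: "\<psi> \<in> test_functions \<Omega> \<Longrightarrow> continuous_on UNIV \<psi>"
  using test_function_Ck Ck_imp_continuous by blast

lemma test_function_measurable: "\<psi> \<in> test_functions \<Omega> \<Longrightarrow> \<psi> \<in> borel_measurable borel"
  using test_function_continuous borel_measurable_continuous_onI by blast

lemma test_function_outside: "\<psi> \<in> test_functions \<Omega> \<Longrightarrow> x \<notin> \<Omega> \<Longrightarrow> \<psi> x = 0"
  by (metis subsetD test_functionsE)

lemma test_function_bounded:
  assumes "\<psi> \<in> test_functions \<Omega>"
  obtains B where "0 < B" "\<And>x. \<bar>\<psi> x\<bar> \<le> B"
proof -
  obtain K where K: "compact K" "\<And>x. x \<notin> K \<Longrightarrow> \<psi> x = 0" by (rule test_functionsE[OF assms]) blast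
  have "compact (\<psi> ` K)"
    using K test_function_continuous[OF assms] continuous_on_subset by (blast intro: compact_continuous_image)
  then obtain B where "B > 0" "\<And>x. x \<in> K \<Longrightarrow> \<bar>\<psi> x\<bar> \<le> B"
    using compact_imp_bounded bounded_pos[of "\<psi> ` K"] by auto
  then show thesis using K that[of B] by (metis abs_zero less_eq_real_def)
qed

lemma test_functions_zero: "(\<lambda>x. 0) \<in> test_functions \<Omega>"
  by (rule test_functionsI[of _ "{}"]) (auto intro: Ck_const)

lemma test_functions_add:
  assumes "\<psi> \<in> test_functions \<Omega>" "\<eta> \<in> test_functions \<Omega>"
  shows "(\<lambda>x. \<psi> x + \<eta> x) \<in> test_functions \<Omega>"
proof -
  obtain K where K: "compact K" "K \<subseteq> \<Omega>" "\<And>x. x \<notin> K \<Longrightarrow> \<psi> x = 0" by (rule test_functionsE[OF assms(1)]) blast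
  obtain K' where K': "compact K'" "K' \<subseteq> \<Omega>" "\<And>x. x \<notin> K' \<Longrightarrow> \<eta> x = 0" by (rule test_functionsE[OF assms(2)]) blast
  show ?thesis
    by (rule test_functionsI[of _ "K \<union> K'"]) (use K K' assms in \<open>auto intro: Ck_add test_function_Ck\<close>)
qed

lemma test_functions_mult:
  assumes "\<psi> \<in> test_functions \<Omega>" "\<eta> \<in> test_functions \<Omega>"
  shows "(\<lambda>x. \<psi> x * \<eta> x) \<in> test_functions \<Omega>"
proof -
  obtain K where K: "compact K" "K \<subseteq> \<Omega>" "\<And>x. x \<notin> K \<Longrightarrow> \<psi> x = 0" by (rule test_functionsE[OF assms(1)]) blast
  show ?thesis
    by (rule test_functionsI[of _ K]) (use K assms in \<open>auto intro: Ck_mult test_function_Ck\<close>)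
qed

lemma test_functions_cmult:
  assumes "\<psi> \<in> test_functions \<Omega>"
  shows "(\<lambda>x. c * \<psi> x) \<in> test_functions \<Omega>"
proof -
  obtain K where K: "compact K" "K \<subseteq> \<Omega>" "\<And>x. x \<notin> K \<Longrightarrow> \<psi> x = 0" by (rule test_functionsE[OF assms]) blast
  show ?thesis
    by (rule test_functionsI[of _ K]) (use K assms in \<open>auto intro: Ck_mult Ck_const test_function_Ck\<close>)
qed

text \<open>Only sums and products of smooth functions occur, so a chain rule of higher order is
  avoided. The condition \<open>P 0 = 0\<close> preserves the compact support.\<close>

lemma test_functions_polynomial:
  assumes "\<psi> \<in> test_functions \<Omega>" "real_polynomial_function P" "P 0 = 0"
  shows "(\<lambda>x. P (\<psi> x)) \<in> test_functions \<Omega>"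
proof -
  obtain K where K: "compact K" "K \<subseteq> \<Omega>" "\<And>x. x \<notin> K \<Longrightarrow> \<psi> x = 0" by (rule test_functionsE[OF assms(1)]) blast
  obtain a n where P: "P = (\<lambda>x. \<Sum>i\<le>n. a i * x ^ i)" using assms(2) real_polynomial_function_iff_sum by blast
  have "Ck k (\<lambda>x. P (\<psi> x))" for k
    unfolding P using assms(1) by (intro Ck_sum Ck_mult Ck_const Ck_power test_function_Ck)
  then show ?thesis
    by (rule test_functionsI[of _ K]) (use K assms in auto)
qed

lemma test_functions_derivative:
  assumes "\<psi> \<in> test_functions \<Omega>" "i \<in> Basis"
  shows "(\<lambda>x. frechet_derivative \<psi> (at x) i) \<in> test_functions \<Omega>"
proof -
  obtain K where K: "compact K" "K \<subseteq> \<Omega>" "\<And>x. x \<notin> K \<Longrightarrow> \<psi> x = 0" by (rule test_functionsE[OF assms(1)]) blast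
  show ?thesis
  proof (rule test_functionsI[of _ K])
    show "Ck k (\<lambda>x. frechet_derivative \<psi> (at x) i)" for k
      using test_function_Ck[OF assms(1), of "Suc k"] assms(2) by simp
    fix x assume "x \<notin> K"
    moreover have "open (- K)" using K(1) compact_imp_closed by auto
    moreover have "((\<lambda>x. 0) has_derivative (\<lambda>h. 0)) (at x)" by simp
    ultimately have "(\<psi> has_derivative (\<lambda>h. 0)) (at x)"
      using has_derivative_transform_within_open[of "\<lambda>x. 0" "\<lambda>h. 0" x UNIV "- K" \<psi>] K(3) by auto
    then show "frechet_derivative \<psi> (at x) i = 0" by (simp add: frechet_derivative_at[symmetric])
  qed (use K in auto)
qed

section \<open>Gradients of test functions\<close>

definition gradient :: "('a::euclidean_space \<Rightarrow> real) \<Rightarrow> 'a \<Rightarrow> 'a" where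
  "gradient \<psi> x = (\<Sum>i\<in>Basis. frechet_derivative \<psi> (at x) i *\<^sub>R i)"

lemma gradient_inner_Basis: "i \<in> Basis \<Longrightarrow> gradient \<psi> x \<bullet> i = frechet_derivative \<psi> (at x) i"
  by (simp add: gradient_def inner_sum_left inner_Basis if_distrib cong: if_cong)

lemma gradient_inner:
  assumes "\<psi> \<in> test_functions \<Omega>"
  shows "gradient \<psi> x \<bullet> y = frechet_derivative \<psi> (at x) y"
proof -
  interpret linear "frechet_derivative \<psi> (at x)"
    using test_function_differentiable[OF assms] by (rule linear_frechet_derivative)
  have "frechet_derivative \<psi> (at x) y = frechet_derivative \<psi> (at x) (\<Sum>i\<in>Basis. (y \<bullet> i) *\<^sub>R i)"
    by (simp add: euclidean_representation)
  also have "\<dots> = (\<Sum>i\<in>Basis. (y \<bullet> i) * frechet_derivative \<psi> (at x) i)"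
    by (simp add: sum scaleR)
  also have "\<dots> = gradient \<psi> x \<bullet> y"
    
    unfolding gradient_def inner_sum_left by (intro sum.cong) (auto simp: inner_commute[of y])
  finally show ?thesis by simp
qed

lemma gradient_continuous:
  assumes "\<psi> \<in> test_functions \<Omega>" shows "continuous_on UNIV (gradient \<psi>)"
  unfolding gradient_def[abs_def]
  by (intro continuous_intros test_function_continuous[OF test_functions_derivative[OF assms]])

lemma gradient_measurable: "\<psi> \<in> test_functions \<Omega> \<Longrightarrow> gradient \<psi> \<in> borel_measurable borel"
  using gradient_continuous borel_measurable_continuous_onI by blast

lemma gradient_outside:
  assumes "\<psi> \<in> test_functions \<Omega>" "x \<notin> \<Omega>" shows "gradient \<psi> x = 0"
  using test_function_outside[OF test_functions_derivative[OF assms(1)] assms(2)]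
  by (simp add: gradient_def)

lemma gradient_bounded:
  assumes "\<psi> \<in> test_functions \<Omega>"
  obtains B where "0 < B" "\<And>x. norm (gradient \<psi> x) \<le> B"
proof -
  have "\<exists>B. \<forall>x. \<bar>frechet_derivative \<psi> (at x) i\<bar> \<le> B" if "i \<in> Basis" for i
    using test_function_bounded[OF test_functions_derivative[OF assms that]] by metis
  then obtain B where B: "\<And>i x. i \<in> Basis \<Longrightarrow> \<bar>frechet_derivative \<psi> (at x) i\<bar> \<le> B i" by metis
  have "norm (gradient \<psi> x) \<le> (\<Sum>i\<in>Basis. \<bar>B i\<bar>)" for x
    unfolding gradient_def
    by (rule sum_norm_le) (use B in \<open>auto intro: order_trans[OF _ abs_ge_self]\<close>)
  then have "norm (gradient \<psi> x) \<le> (\<Sum>i\<in>Basis. \<bar>B i\<bar>) + 1" for x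
    by (metis add.commute add_increasing zero_le_one)
  then show thesis using that[of "(\<Sum>i\<in>Basis. \<bar>B i\<bar>) + 1"]
    by (smt (verit, best) sum_nonneg abs_ge_zero)
qed

lemma gradient_compose:
  assumes \<psi>: "\<psi> \<in> test_functions \<Omega>" and P: "(P has_field_derivative P') (at (\<psi> x))"
  shows "gradient (\<lambda>x. P (\<psi> x)) x = P' *\<^sub>R gradient \<psi> x"
proof -
  have "((\<lambda>x. P (\<psi> x)) has_derivative (\<lambda>h. P' * frechet_derivative \<psi> (at x) h)) (at x)"
    using has_derivative_compose[OF test_function_has_derivative[OF \<psi>] has_field_derivative_imp_has_derivative[OF P]]
    by (simp add: mult.commute)
  from frechet_derivative_at[OF this, symmetric] show ?thesis
    by (simp add: gradient_def scaleR_sum_right)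
qed

lemma gradient_add:
  assumes "\<psi> \<in> test_functions \<Omega>" "\<eta> \<in> test_functions \<Omega>"
  shows "gradient (\<lambda>x. \<psi> x + \<eta> x) x = gradient \<psi> x + gradient \<eta> x"
  using assms by (simp add: gradient_def frechet_derivative_add test_function_differentiable scaleR_add_left sum.distrib)

section \<open>Translation invariance and integration by parts\<close>

lemma integral_lborel_translate:
  fixes h :: "'a::euclidean_space \<Rightarrow> real"
  assumes [measurable]: "h \<in> borel_measurable borel"
  shows "(LINT x|lborel. h (x + c)) = (LINT x|lborel. h x)"
proof -
  have "(LINT x|lborel. h x) = (LINT x|distr lborel borel ((+) c). h x)" by (simp add: lborel_distr_plus)
  also have "\<dots> = (LINT x|lborel. h (c + x))" by (rule integral_distr) auto
  finally show ?thesis by (simp add: add.commute)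
qed

lemma integrable_lborel_translate:
  fixes h :: "'a::euclidean_space \<Rightarrow> real"
  assumes [measurable]: "h \<in> borel_measurable borel" and "integrable lborel h"
  shows "integrable lborel (\<lambda>x. h (x + c))"
proof -
  have "integrable (distr lborel borel ((+) c)) h" using assms(2) by (simp add: lborel_distr_plus)
  then have "integrable lborel (\<lambda>x. h (c + x))" by (subst (asm) integrable_distr_eq) auto
  then show ?thesis by (simp add: add.commute)
qed

lemma nn_integral_lborel_translate:
  fixes h :: "'a::euclidean_space \<Rightarrow> ennreal"
  assumes [measurable]: "h \<in> borel_measurable borel"
  shows "(\<integral>\<^sup>+ x. h (x + c) \<partial>lborel) = (\<integral>\<^sup>+ x. h x \<partial>lborel)"
proof -
  have "(\<integral>\<^sup>+ x. h x \<partial>lborel) = (\<integral>\<^sup>+ x. h x \<partial>distr lborel borel ((+) c))" by (simp add: lborel_distr_plus)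
  also have "\<dots> = (\<integral>\<^sup>+ x. h (c + x) \<partial>lborel)" by (rule nn_integral_distr) auto
  finally show ?thesis by (simp add: add.commute)
qed

text \<open>The passage from the domain to the whole space, where Lebesgue measure is translation
  invariant.\<close>

lemma lebesgue_on_lborel:
  fixes h :: "'a::euclidean_space \<Rightarrow> 'b::{banach,second_countable_topology}"
  assumes "\<Omega> \<in> sets lebesgue" "h \<in> borel_measurable borel" "\<And>x. x \<notin> \<Omega> \<Longrightarrow> h x = 0"
  shows integrable_lebesgue_on_lborel: "integrable (lebesgue_on \<Omega>) h \<longleftrightarrow> integrable lborel h"
    and integral_lebesgue_on_lborel: "(LINT x|lebesgue_on \<Omega>. h x) = (LINT x|lborel. h x)"
proof -
  have eq: "(\<lambda>x. indicat_real \<Omega> x *\<^sub>R h x) = h" using assms(3) by (auto simp: fun_eq_iff indicator_def)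
  show "integrable (lebesgue_on \<Omega>) h \<longleftrightarrow> integrable lborel h"
    using assms by (simp add: integrable_restrict_space eq integrable_completion)
  show "(LINT x|lebesgue_on \<Omega>. h x) = (LINT x|lborel. h x)"
    using assms by (simp add: integral_restrict_space eq integral_completion)
qed

lemma integrable_indicator_cball: "integrable lborel (indicat_real (cball (c::'a::euclidean_space) r))"
  by (rule integrable_real_indicator[OF _ emeasure_lborel_cball_finite[unfolded infinity_ennreal_def[symmetric]]]) simp

lemma integrable_lborel_bounded_support:
  fixes h :: "'a::euclidean_space \<Rightarrow> real"
  assumes "h \<in> borel_measurable borel" "bounded S" "\<And>x. x \<notin> S \<Longrightarrow> h x = 0" "\<And>x. \<bar>h x\<bar> \<le> B"
  shows "integrable lborel h"
proof -
  obtain R where R: "S \<subseteq> cball 0 R" using bounded_subset_ballD[OF assms(2), of 0] ball_subset_cball[of 0] by blast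
  have "integrable lborel (\<lambda>x. B * indicator (cball (0::'a) R) x)"
    by (intro integrable_mult_right integrable_indicator_cball)
  moreover have "norm (h x) \<le> norm (B * indicator (cball (0::'a) R) x)" for x
  proof (cases "x \<in> cball 0 R")
    case True
    then show ?thesis using assms(4)[of x] by simp
  next
    case False
    then have "h x = 0" using R assms(3) by blast
    then show ?thesis by simp
  qed
  ultimately show ?thesis
    using assms(1) by (intro Bochner_Integration.integrable_bound[of _ "\<lambda>x. B * indicator (cball (0::'a) R) x" h]) auto
qed

lemma test_function_integrable:
  assumes "bounded \<Omega>" "\<psi> \<in> test_functions \<Omega>" shows "integrable lborel \<psi>"
proof -
  obtain B where "\<And>x. \<bar>\<psi> x\<bar> \<le> B" using test_function_bounded[OF assms(2)] by metis
  then show ?thesis using assms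
    by (intro integrable_lborel_bounded_support[of \<psi> \<Omega> B])
      (auto intro: test_function_measurable test_function_outside)
qed

text \<open>The integral of every difference quotient vanishes by translation invariance; dominated
  convergence carries this over to the derivative.\<close>

lemma integral_derivative_test_function:
  fixes \<psi> :: "'a::euclidean_space \<Rightarrow> real"
  assumes "bounded \<Omega>" and \<psi>: "\<psi> \<in> test_functions \<Omega>" and i: "i \<in> Basis"
  shows "(LINT x|lborel. frechet_derivative \<psi> (at x) i) = 0"
proof -
  have [measurable]: "\<psi> \<in> borel_measurable borel" using \<psi> by (rule test_function_measurable)
  note d = test_functions_derivative[OF \<psi> i]
  have [measurable]: "(\<lambda>x. frechet_derivative \<psi> (at x) i) \<in> borel_measurable borel"
    using d by (rule test_function_measurable)
  obtain B where B: "0 < B" "\<And>x. \<bar>frechet_derivative \<psi> (at x) i\<bar> \<le> B" using test_function_bounded[OF d] by metis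
  obtain R where R: "\<Omega> \<subseteq> cball 0 R" using bounded_subset_ballD[OF assms(1), of 0] ball_subset_cball[of 0] by blast
  define D where "D n x = real (Suc n) * (\<psi> (x + (1 / real (Suc n)) *\<^sub>R i) - \<psi> x)" for n x
  have line: "((\<lambda>t. \<psi> (x + t *\<^sub>R i)) has_field_derivative frechet_derivative \<psi> (at (x + t *\<^sub>R i)) i) (at t)" for x t
  proof -
    have "((\<lambda>t. x + t *\<^sub>R i) has_derivative (\<lambda>h. h *\<^sub>R i)) (at t)" by (auto intro!: derivative_eq_intros)
    from has_derivative_compose[OF this test_function_has_derivative[OF \<psi>]]
    have "((\<lambda>t. \<psi> (x + t *\<^sub>R i)) has_derivative (\<lambda>h. frechet_derivative \<psi> (at (x + t *\<^sub>R i)) (h *\<^sub>R i))) (at t)" .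
    moreover have "frechet_derivative \<psi> (at y) (h *\<^sub>R i) = frechet_derivative \<psi> (at y) i * h" for y h
      using gradient_inner[OF \<psi>, of y "h *\<^sub>R i"] gradient_inner[OF \<psi>, of y i] by (simp add: mult.commute)
    ultimately show ?thesis by (simp add: has_field_derivative_def)
  qed
  have lim: "(\<lambda>n. D n x) \<longlonglongrightarrow> frechet_derivative \<psi> (at x) i" for x
  proof -
    have "((\<lambda>h. (\<psi> (x + h *\<^sub>R i) - \<psi> x) / h) \<longlongrightarrow> frechet_derivative \<psi> (at x) i) (at 0)"
      using line[of x 0] by (simp add: DERIV_def)
    moreover have "filterlim (\<lambda>n. 1 / real (Suc n)) (at 0) sequentially"
      unfolding filterlim_at using LIMSEQ_inverse_real_of_nat
      by (simp add: inverse_eq_divide del: of_nat_Suc)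
    from filterlim_compose[OF calculation this] show ?thesis
      by (simp add: D_def mult.commute del: of_nat_Suc)
  qed
  \<comment> \<open>The mean value theorem bounds the quotient by \<open>B\<close>; since the step
    is at most 1, the quotient vanishes outside the ball of radius \<open>R + 1\<close>.\<close>
  have bound: "\<bar>D n x\<bar> \<le> B * indicator (cball 0 (R + 1)) x" for n x
  proof (cases "x \<in> cball 0 (R + 1)")
    case True
    define h where "h = 1 / real (Suc n)"
    have "h > 0" by (simp add: h_def)
    obtain z where "\<psi> (x + h *\<^sub>R i) - \<psi> (x + 0 *\<^sub>R i) = (h - 0) * frechet_derivative \<psi> (at (x + z *\<^sub>R i)) i"
      using MVT2[OF \<open>0 < h\<close> line[of x]] by blast
    then have "\<bar>\<psi> (x + h *\<^sub>R i) - \<psi> x\<bar> \<le> h * B"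
      using B \<open>h > 0\<close> by (simp add: abs_mult)
    then have "\<bar>D n x\<bar> \<le> real (Suc n) * (h * B)"
      unfolding D_def h_def[symmetric] abs_mult by (intro mult_mono) auto
    also have "\<dots> = B" by (simp add: h_def)
    finally show ?thesis using True by simp
  next
    case False
    have "x + (1 / real (Suc n)) *\<^sub>R i \<notin> \<Omega>" "x \<notin> \<Omega>"
    proof -
      have "norm ((1 / real (Suc n)) *\<^sub>R i) \<le> 1" using i by simp
      moreover have "norm x > R + 1" using False by simp
      moreover have "norm x \<le> norm (x + (1 / real (Suc n)) *\<^sub>R i) + norm ((1 / real (Suc n)) *\<^sub>R i)"
        using norm_triangle_ineq4[of "x + (1 / real (Suc n)) *\<^sub>R i" "(1 / real (Suc n)) *\<^sub>R i"] by simp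
      ultimately have "norm (x + (1 / real (Suc n)) *\<^sub>R i) > R" "norm x > R" by linarith+
      then show "x + (1 / real (Suc n)) *\<^sub>R i \<notin> \<Omega>" "x \<notin> \<Omega>" using R by (auto simp: subset_iff not_le)
    qed
    then show ?thesis using test_function_outside[OF \<psi>] B by (simp add: D_def)
  qed
  have "(\<lambda>n. LINT x|lborel. D n x) \<longlonglongrightarrow> (LINT x|lborel. frechet_derivative \<psi> (at x) i)"
  proof (rule integral_dominated_convergence)
    show "integrable lborel (\<lambda>x. B * indicator (cball (0::'a) (R + 1)) x)"
      by (intro integrable_mult_right integrable_indicator_cball)
    show "D n \<in> borel_measurable lborel" for n unfolding D_def by measurable
      show "AE x in lborel. (\<lambda>n. D n x) \<longlonglongrightarrow> frechet_derivative \<psi> (at x) i" using lim by simp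
    show "AE x in lborel. norm (D n x) \<le> B * indicator (cball 0 (R + 1)) x" for n
      using bound by simp
  qed measurable
  moreover have "(LINT x|lborel. D n x) = 0" for n
  proof -
    have int: "integrable lborel \<psi>" using assms by (intro test_function_integrable)
    show ?thesis
      unfolding D_def using integrable_lborel_translate[OF _ int] int
      by (simp add: integral_lborel_translate)
  qed
  ultimately show ?thesis by (simp add: LIMSEQ_const_iff)
qed

text \<open>A product of two test functions is a test function, so the integral of its derivative is
  0; the product rule turns this into integration by parts.\<close>

lemma has_L2_weak_gradient_test_function:
  fixes \<psi> :: "'a::euclidean_space \<Rightarrow> real"
  assumes \<Omega>: "bounded \<Omega>" "\<Omega> \<in> sets lebesgue" and \<psi>: "\<psi> \<in> test_functions \<Omega>"
  shows "has_L2_weak_gradient \<Omega> \<psi> (gradient \<psi>)"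
  unfolding has_L2_weak_gradient_def
proof (intro conjI ballI)
  have [measurable]: "gradient \<psi> \<in> borel_measurable borel" using \<psi> by (rule gradient_measurable)
  then show "gradient \<psi> \<in> borel_measurable (lebesgue_on \<Omega>)"
    by (intro measurable_restrict_space1 measurable_completion) simp
  obtain B where B: "0 < B" "\<And>x. norm (gradient \<psi> x) \<le> B" using gradient_bounded[OF \<psi>] by metis
  have "integrable lborel (\<lambda>x. (norm (gradient \<psi> x))\<^sup>2)"
    by (rule integrable_lborel_bounded_support[of _ \<Omega> "B\<^sup>2"])
      (use B \<Omega> in \<open>auto simp: gradient_outside[OF \<psi>] intro: power_mono\<close>)
  then show "integrable (lebesgue_on \<Omega>) (\<lambda>x. (norm (gradient \<psi> x))\<^sup>2)"
    using \<Omega> gradient_outside[OF \<psi>] by (subst integrable_lebesgue_on_lborel) auto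
next
  fix \<eta> i assume \<eta>: "\<eta> \<in> test_functions \<Omega>" and i: "i \<in> (Basis :: 'a set)"
  note d\<psi> = test_functions_derivative[OF \<psi> i] and d\<eta> = test_functions_derivative[OF \<eta> i]
  note m1 = test_functions_mult[OF \<psi> d\<eta>] and m2 = test_functions_mult[OF d\<psi> \<eta>]
  have 1: "(LINT x|lebesgue_on \<Omega>. \<psi> x * frechet_derivative \<eta> (at x) i) = (LINT x|lborel. \<psi> x * frechet_derivative \<eta> (at x) i)"
    by (rule integral_lebesgue_on_lborel[OF \<Omega>(2) test_function_measurable[OF m1]]) (rule test_function_outside[OF m1])
  have 2: "(LINT x|lebesgue_on \<Omega>. (gradient \<psi> x \<bullet> i) * \<eta> x) = (LINT x|lborel. frechet_derivative \<psi> (at x) i * \<eta> x)"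
    unfolding gradient_inner_Basis[OF i]
    by (rule integral_lebesgue_on_lborel[OF \<Omega>(2) test_function_measurable[OF m2]]) (rule test_function_outside[OF m2])
  have "0 = (LINT x|lborel. frechet_derivative (\<lambda>x. \<psi> x * \<eta> x) (at x) i)"
    using integral_derivative_test_function[OF \<Omega>(1) test_functions_mult[OF \<psi> \<eta>] i] by simp
  also have "\<dots> = (LINT x|lborel. \<psi> x * frechet_derivative \<eta> (at x) i + frechet_derivative \<psi> (at x) i * \<eta> x)"
    using \<psi> \<eta> by (simp add: frechet_derivative_mult test_function_differentiable)
  also have "\<dots> = (LINT x|lborel. \<psi> x * frechet_derivative \<eta> (at x) i) + (LINT x|lborel. frechet_derivative \<psi> (at x) i * \<eta> x)"
    using test_function_integrable[OF \<Omega>(1) m1] test_function_integrable[OF \<Omega>(1) m2] by simp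
  finally show "(LINT x|lebesgue_on \<Omega>. \<psi> x * frechet_derivative \<eta> (at x) i) = - (LINT x|lebesgue_on \<Omega>. (gradient \<psi> x \<bullet> i) * \<eta> x)"
    unfolding 1 2 by simp
qed

section \<open>The space \<open>H\<^sup>1\<^sub>0\<close> and its \<open>K\<close>-functional\<close>

text \<open>Removes a slack \<open>e\<close>: an estimate valid for every \<open>e > 0\<close>
  survives the limit at 0 from the right.\<close>

lemma at_right_lowerbound:
  fixes f :: "real \<Rightarrow> real"
  assumes "(f \<longlongrightarrow> l) (at_right 0)" "\<And>e. e > 0 \<Longrightarrow> c \<le> f e"
  shows "c \<le> l"
proof (rule tendsto_lowerbound[OF assms(1)])
  show "eventually (\<lambda>e. c \<le> f e) (at_right 0)"
    using assms(2) by (auto simp: eventually_at_filter)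
qed simp

lemma sq_norm_add_le:
  assumes "sq_integrable M f" "sq_integrable M g"
  shows "sq_norm M (\<lambda>x. f x + g x) \<le> 2 * sq_norm M f + 2 * sq_norm M g"
  using sq_norm_add[OF assms] sq_norm_diff[OF assms] sq_norm_nonneg[of M "\<lambda>x. f x - g x"] by linarith

lemma has_L2_weak_gradient_sq: "has_L2_weak_gradient \<Omega> u G \<Longrightarrow> sq_integrable (lebesgue_on \<Omega>) G"
  by (simp add: has_L2_weak_gradient_def sq_integrable_def)

lemma weak_gradient_works: "has_L2_weak_gradient \<Omega> u G \<Longrightarrow> has_L2_weak_gradient \<Omega> u (weak_gradient \<Omega> u)"
  unfolding weak_gradient_def by (rule someI[of "has_L2_weak_gradient \<Omega> u"])

lemma H1_norm_eq: "H1_norm \<Omega> u = sqrt (sq_norm (lebesgue_on \<Omega>) u + sq_norm (lebesgue_on \<Omega>) (weak_gradient \<Omega> u))"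
  by (simp add: H1_norm_def sq_norm_def)

context dirichlet_system
begin

lemma borel_measurable_domain: "h \<in> borel_measurable borel \<Longrightarrow> h \<in> borel_measurable M"
  by (intro measurable_restrict_space1 measurable_completion) simp

lemma test_function_sq_integrable:
  assumes "\<psi> \<in> test_functions \<Omega>" shows "sq_integrable M \<psi>"
proof -
  obtain B where "\<And>x. \<bar>\<psi> x\<bar> \<le> B" using test_function_bounded[OF assms] by blast
  then show ?thesis
    by (intro sq_integrable_bounded[of _ B] borel_measurable_domain test_function_measurable[OF assms]) auto
qed

lemma gradient_sq_integrable:
  assumes "\<psi> \<in> test_functions \<Omega>" shows "sq_integrable M (gradient \<psi>)"
  by (rule has_L2_weak_gradient_sq[OF has_L2_weak_gradient_test_function[OF bounded_domain domain_sets assms]])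

text \<open>No mollification: each eigenfunction lies in \<open>H10_space\<close>, hence is an L2
  limit of test functions, so \<open>h\<close> is orthogonal to a complete system.\<close>

lemma eq_zero_AE_if_orthogonal_test_functions:
  assumes h: "sq_integrable M h" and orth: "\<And>\<psi>. \<psi> \<in> test_functions \<Omega> \<Longrightarrow> (LINT x|M. h x * \<psi> x) = 0"
  shows "AE x in M. h x = 0"
proof (rule eq_zero_AE_if_coeff_zero[OF h])
  fix n
  have "\<bar>coeff h n\<bar> \<le> sqrt (sq_norm M h) * e" if e: "e > 0" for e
  proof -
    obtain \<psi> where \<psi>: "\<psi> \<in> test_functions \<Omega>" "H1_norm \<Omega> (\<lambda>x. \<phi> n x - \<psi> x) < e"
      using eigenfunction_H10[of n] e by (auto simp: H10_space_def)
    have d: "sq_integrable M (\<lambda>x. \<phi> n x - \<psi> x)"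
      using eigenfunction_L2 test_function_sq_integrable[OF \<psi>(1)] by auto
    have "coeff h n = (LINT x|M. h x * (\<phi> n x - \<psi> x)) + (LINT x|M. h x * \<psi> x)"
      unfolding coeff_def L2_inner_def
      using integrable_inner[OF h d] integrable_inner[OF h test_function_sq_integrable[OF \<psi>(1)]]
      by (subst Bochner_Integration.integral_add[symmetric]) (auto simp: algebra_simps)
    then have "(coeff h n)\<^sup>2 \<le> sq_norm M h * sq_norm M (\<lambda>x. \<phi> n x - \<psi> x)"
      using Cauchy_Schwarz_integral[OF h d] orth[OF \<psi>(1)] by simp
    then have "\<bar>coeff h n\<bar> \<le> sqrt (sq_norm M h) * sqrt (sq_norm M (\<lambda>x. \<phi> n x - \<psi> x))"
      by (metis real_sqrt_abs real_sqrt_le_mono real_sqrt_mult)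
    also have "sqrt (sq_norm M (\<lambda>x. \<phi> n x - \<psi> x)) \<le> e"
    proof -
      have "sqrt (sq_norm M (\<lambda>x. \<phi> n x - \<psi> x)) \<le> H1_norm \<Omega> (\<lambda>x. \<phi> n x - \<psi> x)"
        unfolding H1_norm_eq by (intro real_sqrt_le_mono) simp
      with \<psi>(2) show ?thesis by simp
    qed
    finally show ?thesis by (simp add: mult_left_mono)
  qed
  moreover have "((\<lambda>e. sqrt (sq_norm M h) * e) \<longlongrightarrow> sqrt (sq_norm M h) * 0) (at_right 0)"
    by (intro tendsto_intros)
  ultimately have "\<bar>coeff h n\<bar> \<le> sqrt (sq_norm M h) * 0"
    by (rule at_right_lowerbound[rotated])
  then show "coeff h n = 0" by simp
qed

section \<open>Linearity and uniqueness of weak gradients\<close>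

lemma has_L2_weak_gradient_add:
  assumes u: "sq_integrable M u" "has_L2_weak_gradient \<Omega> u G" and v: "sq_integrable M v" "has_L2_weak_gradient \<Omega> v H"
  shows "has_L2_weak_gradient \<Omega> (\<lambda>x. u x + v x) (\<lambda>x. G x + H x)"
  unfolding has_L2_weak_gradient_def
proof (intro conjI ballI)
  have GH: "sq_integrable M G" "sq_integrable M H" using assms by (auto intro: has_L2_weak_gradient_sq)
  from sq_integrable_add[OF this] show "(\<lambda>x. G x + H x) \<in> borel_measurable M" "integrable M (\<lambda>x. (norm (G x + H x))\<^sup>2)"
    by (simp_all add: sq_integrable_def)
  fix \<psi> i assume \<psi>: "\<psi> \<in> test_functions \<Omega>" and i: "i \<in> (Basis :: 'a set)"
  have sqi: "sq_integrable M (\<lambda>x. \<psi> x *\<^sub>R i)"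
    using test_function_sq_integrable[OF \<psi>] i by (auto simp: sq_integrable_def)
  note d = test_function_sq_integrable[OF test_functions_derivative[OF \<psi> i]]
  have I: "integrable M (\<lambda>x. (G x \<bullet> i) * \<psi> x)" "integrable M (\<lambda>x. (H x \<bullet> i) * \<psi> x)"
    "integrable M (\<lambda>x. u x * frechet_derivative \<psi> (at x) i)" "integrable M (\<lambda>x. v x * frechet_derivative \<psi> (at x) i)"
    using integrable_inner[OF GH(1) sqi] integrable_inner[OF GH(2) sqi] integrable_inner[OF u(1) d] integrable_inner[OF v(1) d]
    by (simp_all add: mult.commute)
  show "(LINT x|M. (u x + v x) * frechet_derivative \<psi> (at x) i) = - (LINT x|M. ((G x + H x) \<bullet> i) * \<psi> x)"
    using assms \<psi> i I by (simp add: has_L2_weak_gradient_def distrib_right inner_add_left)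
qed

lemma has_L2_weak_gradient_cmult:
  assumes "has_L2_weak_gradient \<Omega> u G"
  shows "has_L2_weak_gradient \<Omega> (\<lambda>x. c * u x) (\<lambda>x. c *\<^sub>R G x)"
  using sq_integrable_scaleR[OF has_L2_weak_gradient_sq[OF assms], of c] assms
  by (simp add: has_L2_weak_gradient_def mult.assoc sq_integrable_def)

lemma has_L2_weak_gradient_diff:
  assumes u: "sq_integrable M u" "has_L2_weak_gradient \<Omega> u G" and v: "sq_integrable M v" "has_L2_weak_gradient \<Omega> v H"
  shows "has_L2_weak_gradient \<Omega> (\<lambda>x. u x - v x) (\<lambda>x. G x - H x)"
  using has_L2_weak_gradient_add[OF u sq_integrable_cmult[OF v(1)] has_L2_weak_gradient_cmult[OF v(2)], of "-1"]
  by simp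

lemma weak_gradient_unique:
  assumes u: "sq_integrable M u" "has_L2_weak_gradient \<Omega> u G" "has_L2_weak_gradient \<Omega> u H"
  shows "AE x in M. G x = H x"
proof -
  have zero: "has_L2_weak_gradient \<Omega> (\<lambda>x. 0) (\<lambda>x. G x - H x)"
    using has_L2_weak_gradient_diff[OF u(1,2) u(1,3)] by simp
  have "AE x in M. (G x - H x) \<bullet> i = 0" if i: "i \<in> Basis" for i
  proof (rule eq_zero_AE_if_orthogonal_test_functions)
    have sq: "sq_integrable M (\<lambda>x. G x - H x)" using zero by (rule has_L2_weak_gradient_sq)
    show "sq_integrable M (\<lambda>x. (G x - H x) \<bullet> i)"
    proof (rule sq_integrable_bound[OF sq])
      show "(\<lambda>x. (G x - H x) \<bullet> i) \<in> borel_measurable M"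
        using sq_integrable_measurable[OF sq] by measurable
      show "AE x in M. norm ((G x - H x) \<bullet> i) \<le> norm (G x - H x)"
        using Basis_le_norm[OF i] by simp
    qed
    show "(LINT x|M. ((G x - H x) \<bullet> i) * \<psi> x) = 0" if "\<psi> \<in> test_functions \<Omega>" for \<psi>
      using zero that i by (simp add: has_L2_weak_gradient_def)
  qed
  then have "AE x in M. \<forall>i\<in>Basis. (G x - H x) \<bullet> i = 0"
    by (intro eventually_ball_finite) auto
  then show ?thesis
    by eventually_elim (metis eq_iff_diff_eq_0 euclidean_all_zero_iff)
qed

lemma weak_gradient_AE:
  assumes "sq_integrable M u" "has_L2_weak_gradient \<Omega> u G"
  shows "AE x in M. weak_gradient \<Omega> u x = G x"
  using weak_gradient_unique[OF assms(1) weak_gradient_works[OF assms(2)] assms(2)] .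

lemma sq_norm_weak_gradient:
  assumes "sq_integrable M u" "has_L2_weak_gradient \<Omega> u G"
  shows "sq_norm M (weak_gradient \<Omega> u) = sq_norm M G"
  using weak_gradient_AE[OF assms] has_L2_weak_gradient_sq[OF assms(2)]
    has_L2_weak_gradient_sq[OF weak_gradient_works[OF assms(2)]]
  by (intro sq_norm_cong_AE) (auto intro: sq_integrable_measurable)

lemma weak_gradient_test_function:
  assumes "\<psi> \<in> test_functions \<Omega>"
  shows "has_L2_weak_gradient \<Omega> \<psi> (gradient \<psi>)"
    "AE x in M. weak_gradient \<Omega> \<psi> x = gradient \<psi> x"
    "sq_norm M (weak_gradient \<Omega> \<psi>) = sq_norm M (gradient \<psi>)"
proof -
  show g: "has_L2_weak_gradient \<Omega> \<psi> (gradient \<psi>)"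
    by (rule has_L2_weak_gradient_test_function[OF bounded_domain domain_sets assms])
  show "AE x in M. weak_gradient \<Omega> \<psi> x = gradient \<psi> x"
    "sq_norm M (weak_gradient \<Omega> \<psi>) = sq_norm M (gradient \<psi>)"
    using weak_gradient_AE[OF test_function_sq_integrable[OF assms] g]
      sq_norm_weak_gradient[OF test_function_sq_integrable[OF assms] g] by auto
qed

text \<open>The distance in \<open>H10_space\<close> contains the weak gradient chosen for
  \<open>u - \<psi>\<close>, independently of the one chosen for \<open>u\<close>. Uniqueness almost
  everywhere replaces it by the difference of \<open>weak_gradient \<Omega> u\<close> and the
  classical gradient of \<open>\<psi>\<close>.\<close>

lemma H10_space_iff:
  "u \<in> H10_space \<Omega> \<longleftrightarrow> sq_integrable M u \<and> has_L2_weak_gradient \<Omega> u (weak_gradient \<Omega> u) \<and>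
    (\<forall>e>0. \<exists>\<psi>\<in>test_functions \<Omega>. sq_norm M (\<lambda>x. u x - \<psi> x) + sq_norm M (\<lambda>x. weak_gradient \<Omega> u x - gradient \<psi> x) < e)"
proof (cases "u \<in> H1_space \<Omega>")
  case True
  then have u: "sq_integrable M u" "has_L2_weak_gradient \<Omega> u (weak_gradient \<Omega> u)"
    using weak_gradient_works by (auto simp: H1_space_def L2_space_iff)
  have eq: "H1_norm \<Omega> (\<lambda>x. u x - \<psi> x) = sqrt (sq_norm M (\<lambda>x. u x - \<psi> x) + sq_norm M (\<lambda>x. weak_gradient \<Omega> u x - gradient \<psi> x))"
    if "\<psi> \<in> test_functions \<Omega>" for \<psi>
    unfolding H1_norm_eq
    using sq_norm_weak_gradient[OF _ has_L2_weak_gradient_diff[OF u test_function_sq_integrable[OF that] weak_gradient_test_function(1)[OF that]]]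
      u(1) test_function_sq_integrable[OF that] by auto
  have "(\<forall>e>0. \<exists>\<psi>\<in>test_functions \<Omega>. sqrt (N \<psi>) < e) \<longleftrightarrow> (\<forall>e>0. \<exists>\<psi>\<in>test_functions \<Omega>. N \<psi> < e)" for N :: "_ \<Rightarrow> real"
  proof safe
    fix e :: real assume "e > 0" "\<forall>e>0. \<exists>\<psi>\<in>test_functions \<Omega>. sqrt (N \<psi>) < e"
    then obtain \<psi> where "\<psi> \<in> test_functions \<Omega>" "sqrt (N \<psi>) < sqrt e" by (meson real_sqrt_gt_zero)
    then show "\<exists>\<psi>\<in>test_functions \<Omega>. N \<psi> < e" by auto
  next
    fix e :: real assume "e > 0" "\<forall>e>0. \<exists>\<psi>\<in>test_functions \<Omega>. N \<psi> < e"
    then obtain \<psi> where "\<psi> \<in> test_functions \<Omega>" "N \<psi> < e\<^sup>2" by (meson zero_less_power)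
    then have "sqrt (N \<psi>) < e" using \<open>e > 0\<close> by (metis abs_of_pos real_sqrt_abs real_sqrt_less_mono)
    then show "\<exists>\<psi>\<in>test_functions \<Omega>. sqrt (N \<psi>) < e" using \<open>\<psi> \<in> _\<close> by blast
  qed
  then show ?thesis using True u eq by (simp add: H10_space_def)
next
  case False
  then show ?thesis by (auto simp: H10_space_def H1_space_def L2_space_iff)
qed

lemma H10_spaceD:
  assumes "u \<in> H10_space \<Omega>"
  shows H10_L2: "sq_integrable M u"
    and H10_weak_gradient: "has_L2_weak_gradient \<Omega> u (weak_gradient \<Omega> u)"
    and H10_weak_gradient_sq: "sq_integrable M (weak_gradient \<Omega> u)"
  using assms has_L2_weak_gradient_sq by (auto simp: H10_space_iff)

lemma H10_approx:
  assumes "u \<in> H10_space \<Omega>" "e > 0"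
  obtains \<psi> where "\<psi> \<in> test_functions \<Omega>" "sq_norm M (\<lambda>x. u x - \<psi> x) < e"
    "sq_norm M (\<lambda>x. weak_gradient \<Omega> u x - gradient \<psi> x) < e"
proof -
  obtain \<psi> where "\<psi> \<in> test_functions \<Omega>"
    "sq_norm M (\<lambda>x. u x - \<psi> x) + sq_norm M (\<lambda>x. weak_gradient \<Omega> u x - gradient \<psi> x) < e"
    using assms by (auto simp: H10_space_iff)
  then show thesis using that[of \<psi>] sq_norm_nonneg[of M "\<lambda>x. u x - \<psi> x"]
      sq_norm_nonneg[of M "\<lambda>x. weak_gradient \<Omega> u x - gradient \<psi> x"] by linarith
qed

lemma H10_I:
  assumes u: "sq_integrable M u" "has_L2_weak_gradient \<Omega> u G"
    and approx: "\<And>e. e > 0 \<Longrightarrow> \<exists>\<psi>\<in>test_functions \<Omega>. sq_norm M (\<lambda>x. u x - \<psi> x) < e \<and> sq_norm M (\<lambda>x. G x - gradient \<psi> x) < e"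
  shows "u \<in> H10_space \<Omega>"
  unfolding H10_space_iff
proof (intro conjI allI impI)
  show g: "has_L2_weak_gradient \<Omega> u (weak_gradient \<Omega> u)" using u(2) by (rule weak_gradient_works)
  fix e :: real assume "e > 0"
  then obtain \<psi> where \<psi>: "\<psi> \<in> test_functions \<Omega>" "sq_norm M (\<lambda>x. u x - \<psi> x) < e / 2" "sq_norm M (\<lambda>x. G x - gradient \<psi> x) < e / 2"
    using approx[of "e / 2"] by auto
  have "sq_norm M (\<lambda>x. weak_gradient \<Omega> u x - gradient \<psi> x) = sq_norm M (\<lambda>x. G x - gradient \<psi> x)"
    using weak_gradient_AE[OF u] sq_integrable_diff[OF has_L2_weak_gradient_sq[OF g] gradient_sq_integrable[OF \<psi>(1)]]
      sq_integrable_diff[OF has_L2_weak_gradient_sq[OF u(2)] gradient_sq_integrable[OF \<psi>(1)]]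
    by (intro sq_norm_cong_AE) (auto intro: sq_integrable_measurable)
  then show "\<exists>\<psi>\<in>test_functions \<Omega>. sq_norm M (\<lambda>x. u x - \<psi> x) + sq_norm M (\<lambda>x. weak_gradient \<Omega> u x - gradient \<psi> x) < e"
    using \<psi> by (intro bexI[of _ \<psi>]) auto
qed (rule u(1))

lemma test_function_H10:
  assumes "\<psi> \<in> test_functions \<Omega>" shows "\<psi> \<in> H10_space \<Omega>"
  by (rule H10_I[OF test_function_sq_integrable[OF assms] weak_gradient_test_function(1)[OF assms]])
    (use assms in \<open>auto simp: sq_norm_def intro!: bexI[of _ \<psi>]\<close>)

lemma H10_cmult:
  assumes u: "u \<in> H10_space \<Omega>" shows "(\<lambda>x. c * u x) \<in> H10_space \<Omega>"
proof (rule H10_I)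
  show "sq_integrable M (\<lambda>x. c * u x)" "has_L2_weak_gradient \<Omega> (\<lambda>x. c * u x) (\<lambda>x. c *\<^sub>R weak_gradient \<Omega> u x)"
    using H10_spaceD[OF u] by (auto intro: has_L2_weak_gradient_cmult)
  fix e :: real assume e: "e > 0"
  have c: "c\<^sup>2 + 1 > 0" by (simp add: add_nonneg_pos)
  obtain \<psi> where \<psi>: "\<psi> \<in> test_functions \<Omega>" "sq_norm M (\<lambda>x. u x - \<psi> x) < e / (c\<^sup>2 + 1)"
    "sq_norm M (\<lambda>x. weak_gradient \<Omega> u x - gradient \<psi> x) < e / (c\<^sup>2 + 1)"
    using H10_approx[OF u, of "e / (c\<^sup>2 + 1)"] e c by auto
  have less: "c\<^sup>2 * a < e" if "a < e / (c\<^sup>2 + 1)" "0 \<le> a" for a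
  proof -
    have "c\<^sup>2 * a \<le> (c\<^sup>2 + 1) * a" using that by (simp add: distrib_right)
    also have "\<dots> < e" using that c by (simp add: field_simps)
    finally show ?thesis .
  qed
  have grad: "gradient (\<lambda>x. c * \<psi> x) x = c *\<^sub>R gradient \<psi> x" for x
    by (rule gradient_compose[OF \<psi>(1), of "\<lambda>y. c * y"]) (auto intro!: derivative_eq_intros)
  show "\<exists>\<psi>\<in>test_functions \<Omega>. sq_norm M (\<lambda>x. c * u x - \<psi> x) < e \<and> sq_norm M (\<lambda>x. c *\<^sub>R weak_gradient \<Omega> u x - gradient \<psi> x) < e"
  proof (intro bexI conjI)
    show "sq_norm M (\<lambda>x. c * u x - c * \<psi> x) < e"
      using sq_norm_cmult[of M c "\<lambda>x. u x - \<psi> x"] less[OF \<psi>(2)] by (simp add: right_diff_distrib)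
    show "sq_norm M (\<lambda>x. c *\<^sub>R weak_gradient \<Omega> u x - gradient (\<lambda>x. c * \<psi> x) x) < e"
      using sq_norm_scaleR[of M c "\<lambda>x. weak_gradient \<Omega> u x - gradient \<psi> x"] less[OF \<psi>(3)]
      by (simp add: grad scaleR_diff_right)
  qed (rule test_functions_cmult[OF \<psi>(1)])
qed

lemma H10_add:
  assumes u: "u \<in> H10_space \<Omega>" and v: "v \<in> H10_space \<Omega>" shows "(\<lambda>x. u x + v x) \<in> H10_space \<Omega>"
proof (rule H10_I)
  show "sq_integrable M (\<lambda>x. u x + v x)" 
    "has_L2_weak_gradient \<Omega> (\<lambda>x. u x + v x) (\<lambda>x. weak_gradient \<Omega> u x + weak_gradient \<Omega> v x)"
    using H10_spaceD[OF u] H10_spaceD[OF v] by (auto intro: has_L2_weak_gradient_add)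
  fix e :: real assume e: "e > 0"
  obtain \<psi> where \<psi>: "\<psi> \<in> test_functions \<Omega>" "sq_norm M (\<lambda>x. u x - \<psi> x) < e / 4"
    "sq_norm M (\<lambda>x. weak_gradient \<Omega> u x - gradient \<psi> x) < e / 4"
    using H10_approx[OF u, of "e / 4"] e by auto
  obtain \<eta> where \<eta>: "\<eta> \<in> test_functions \<Omega>" "sq_norm M (\<lambda>x. v x - \<eta> x) < e / 4"
    "sq_norm M (\<lambda>x. weak_gradient \<Omega> v x - gradient \<eta> x) < e / 4"
    using H10_approx[OF v, of "e / 4"] e by auto
  show "\<exists>\<psi>\<in>test_functions \<Omega>. sq_norm M (\<lambda>x. u x + v x - \<psi> x) < e \<and>
     sq_norm M (\<lambda>x. weak_gradient \<Omega> u x + weak_gradient \<Omega> v x - gradient \<psi> x) < e"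
  proof (intro bexI conjI)
    show "sq_norm M (\<lambda>x. u x + v x - (\<psi> x + \<eta> x)) < e"
      using sq_norm_add_le[OF sq_integrable_diff[OF H10_L2[OF u] test_function_sq_integrable[OF \<psi>(1)]]
          sq_integrable_diff[OF H10_L2[OF v] test_function_sq_integrable[OF \<eta>(1)]]] \<psi>(2) \<eta>(2)
      by (simp add: algebra_simps)
    show "sq_norm M (\<lambda>x. weak_gradient \<Omega> u x + weak_gradient \<Omega> v x - gradient (\<lambda>x. \<psi> x + \<eta> x) x) < e"
      using sq_norm_add_le[OF sq_integrable_diff[OF H10_weak_gradient_sq[OF u] gradient_sq_integrable[OF \<psi>(1)]]
          sq_integrable_diff[OF H10_weak_gradient_sq[OF v] gradient_sq_integrable[OF \<eta>(1)]]] \<psi>(3) \<eta>(3)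
      unfolding gradient_add[OF \<psi>(1) \<eta>(1)] by (simp add: algebra_simps)
  qed (rule test_functions_add[OF \<psi>(1) \<eta>(1)])
qed

lemma partial_H10: "partial a m \<in> H10_space \<Omega>"
proof (induction m)
  case 0
  show ?case using test_function_H10[OF test_functions_zero] by (simp add: partial_def)
next
  case (Suc m)
  then show ?case unfolding partial_Suc by (intro H10_add H10_cmult eigenfunction_H10)
qed

section \<open>The Dirichlet form in the eigenbasis\<close>

abbreviation "eigengradient n \<equiv> weak_gradient \<Omega> (\<phi> n)"

lemma eigengradient_inner:
  assumes "v \<in> H10_space \<Omega>"
  shows "(LINT x|M. eigengradient n x \<bullet> weak_gradient \<Omega> v x) = lam n * coeff v n"
  using eigenfunction[of n] assms by (simp add: dirichlet_laplacian_def L2_inner_def coeff_def mult_ac)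

lemma eigengradient_sq: "sq_integrable M (eigengradient n)"
  by (rule H10_weak_gradient_sq[OF eigenfunction_H10])

lemma coeff_eigenfunction: "coeff (\<phi> m) n = (if m = n then 1 else 0)"
  by (simp add: coeff_def orthonormal)

definition gpartial :: "(nat \<Rightarrow> real) \<Rightarrow> nat \<Rightarrow> 'a \<Rightarrow> 'a" where
  "gpartial a m x = (\<Sum>k<m. a k *\<^sub>R eigengradient k x)"

lemma gpartial_sq: "sq_integrable M (gpartial a m)"
  unfolding gpartial_def[abs_def] using eigengradient_sq by (intro sq_integrable_sum) auto

lemma gpartial_Suc: "gpartial a (Suc m) = (\<lambda>x. gpartial a m x + a m *\<^sub>R eigengradient m x)"
  by (simp add: gpartial_def fun_eq_iff)

lemma gpartial_inner:
  "(LINT x|M. gpartial a m x \<bullet> eigengradient n x) = (if n < m then lam n * a n else 0)"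
proof (induction m)
  case 0
  show ?case by (simp add: gpartial_def)
next
  case (Suc m)
  have "(LINT x|M. gpartial a (Suc m) x \<bullet> eigengradient n x) =
     (LINT x|M. gpartial a m x \<bullet> eigengradient n x) + a m * (LINT x|M. eigengradient m x \<bullet> eigengradient n x)"
    using integrable_inner[OF gpartial_sq[of a m] eigengradient_sq[of n]] integrable_inner[OF eigengradient_sq[of m] eigengradient_sq[of n]]
    by (simp add: gpartial_Suc inner_add_left)
  then show ?case
    using Suc by (auto simp: eigengradient_inner[OF eigenfunction_H10] coeff_eigenfunction less_Suc_eq)
qed

text \<open>The eigengradients are orthogonal with squared norms \<open>lam m\<close>. Since
  \<open>W\<close> is any field with prescribed inner products, one identity gives both Bessel's
  inequality, with \<open>W\<close> a weak gradient, and the Dirichlet energy of a partial sum, with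
  \<open>W = 0\<close>.\<close>

lemma sq_norm_diff_gpartial:
  assumes W: "sq_integrable M W" and c: "\<And>n. (LINT x|M. W x \<bullet> eigengradient n x) = lam n * c n"
  shows "sq_norm M (\<lambda>x. W x - gpartial a m x) = sq_norm M W - (\<Sum>k<m. lam k * (c k)\<^sup>2) + (\<Sum>k<m. lam k * (c k - a k)\<^sup>2)"
proof (induction m)
  case 0
  show ?case by (simp add: gpartial_def)
next
  case (Suc m)
  have d: "sq_integrable M (\<lambda>x. W x - gpartial a m x)" using W gpartial_sq by auto
  have eq: "(\<lambda>x. W x - gpartial a (Suc m) x) = (\<lambda>x. (W x - gpartial a m x) - a m *\<^sub>R eigengradient m x)"
    by (simp add: gpartial_Suc algebra_simps)
  have cross: "(LINT x|M. (W x - gpartial a m x) \<bullet> (a m *\<^sub>R eigengradient m x)) = a m * (lam m * c m)"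
    using integrable_inner[OF W eigengradient_sq[of m]] integrable_inner[OF gpartial_sq[of a m] eigengradient_sq[of m]]
    by (simp add: inner_diff_left c gpartial_inner)
  have one: "sq_norm M (eigengradient m) = lam m"
    using eigengradient_inner[OF eigenfunction_H10, of m m]
    by (simp add: sq_norm_def power2_norm_eq_inner coeff_eigenfunction)
  show ?case
    unfolding eq sq_norm_diff[OF d sq_integrable_scaleR[OF eigengradient_sq]] cross Suc.IH
    by (simp add: one power2_eq_square algebra_simps)
qed

lemma gradient_Bessel:
  assumes "u \<in> H10_space \<Omega>"
  shows "(\<Sum>k<m. lam k * (coeff u k)\<^sup>2) \<le> sq_norm M (weak_gradient \<Omega> u)"
  using sq_norm_diff_gpartial[OF H10_weak_gradient_sq[OF assms], of "coeff u" "coeff u" m]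
    eigengradient_inner[OF assms] sq_norm_nonneg[of M "\<lambda>x. weak_gradient \<Omega> u x - gpartial (coeff u) m x"]
  by (simp add: inner_commute)

lemma H10_summable:
  assumes "u \<in> H10_space \<Omega>"
  shows "summable (\<lambda>k. lam k * (coeff u k)\<^sup>2)" "(\<Sum>k. lam k * (coeff u k)\<^sup>2) \<le> sq_norm M (weak_gradient \<Omega> u)"
proof -
  show s: "summable (\<lambda>k. lam k * (coeff u k)\<^sup>2)"
    by (rule summableI_nonneg_bounded[OF _ gradient_Bessel[OF assms]]) (simp add: less_imp_le[OF lam_pos])
  show "(\<Sum>k. lam k * (coeff u k)\<^sup>2) \<le> sq_norm M (weak_gradient \<Omega> u)"
    by (rule suminf_le_const[OF s gradient_Bessel[OF assms]])
qed

lemma partial_weak_gradient: "has_L2_weak_gradient \<Omega> (partial a m) (gpartial a m)"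
proof (induction m)
  case 0
  have "gradient (\<lambda>x::'a. 0::real) = (\<lambda>x. 0)" by (simp add: gradient_def fun_eq_iff)
  then show ?case using weak_gradient_test_function(1)[OF test_functions_zero] by (simp add: partial_def[abs_def] gpartial_def[abs_def])
next
  case (Suc m)
  then show ?case unfolding partial_Suc gpartial_Suc
    by (intro has_L2_weak_gradient_add partial_L2 sq_integrable_cmult eigenfunction_L2
        has_L2_weak_gradient_cmult H10_weak_gradient eigenfunction_H10)
qed

lemma sq_norm_partial_gradient: "sq_norm M (weak_gradient \<Omega> (partial a m)) = (\<Sum>k<m. lam k * (a k)\<^sup>2)"
proof -
  have "sq_norm M (\<lambda>x. - gpartial a m x) = (\<Sum>k<m. lam k * (a k)\<^sup>2)"
    using sq_norm_diff_gpartial[of "\<lambda>x. 0" "\<lambda>_. 0" a m] by (simp add: sq_norm_def)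
  then show ?thesis
    using sq_norm_weak_gradient[OF partial_L2 partial_weak_gradient] by (simp add: sq_norm_def)
qed

text \<open>The square of the \<open>K\<close>-functional of the couple \<open>(L\<^sup>2, H\<^sup>1\<^sub>0)\<close> at \<open>u\<close>.\<close>

definition Kfun :: "real \<Rightarrow> ('a \<Rightarrow> real) \<Rightarrow> real" where
  "Kfun t u = (\<Sum>n. t * lam n / (1 + t * lam n) * (coeff u n)\<^sup>2)"

lemma Kfun_summable:
  assumes "sq_integrable M u" "t > 0"
  shows "summable (\<lambda>n. t * lam n / (1 + t * lam n) * (coeff u n)\<^sup>2)"
proof (rule summable_comparison_test'[OF summable_coeff_sq[OF assms(1)]])
  fix n
  have "0 < t * lam n" using assms lam_pos by simp
  then have "0 \<le> t * lam n / (1 + t * lam n)" "t * lam n / (1 + t * lam n) \<le> 1" by auto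
  then show "norm (t * lam n / (1 + t * lam n) * (coeff u n)\<^sup>2) \<le> (coeff u n)\<^sup>2"
    using mult_right_mono[of _ 1 "(coeff u n)\<^sup>2"] by (metis abs_of_nonneg mult_1 mult_nonneg_nonneg real_norm_def zero_le_power2)
qed

text \<open>Coefficientwise, with \<open>q = t * lam n\<close>: the difference of
  \<open>(1 + q) * ((a - b)^2 + q * b^2)\<close> and \<open>q * a^2\<close> is the square of
  \<open>a - (1 + q) * b\<close>. The bound by the gradient of \<open>z\<close> is Bessel's
  inequality.\<close>

lemma Kfun_le:
  assumes w: "sq_integrable M w" and z: "z \<in> H10_space \<Omega>" and t: "t > 0"
  shows "Kfun t w \<le> sq_norm M (\<lambda>x. w x - z x) + t * sq_norm M (weak_gradient \<Omega> z)"
proof -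
  have d: "sq_integrable M (\<lambda>x. w x - z x)" using w H10_L2[OF z] by auto
  have le: "t * lam n / (1 + t * lam n) * (coeff w n)\<^sup>2 \<le> (coeff w n - coeff z n)\<^sup>2 + t * (lam n * (coeff z n)\<^sup>2)" for n
  proof -
    have ineq: "q / (1 + q) * a\<^sup>2 \<le> (a - b)\<^sup>2 + q * b\<^sup>2" if q: "q > 0" for q a b :: real
    proof -
      have "(1 + q) * ((a - b)\<^sup>2 + q * b\<^sup>2) - q * a\<^sup>2 = (a - (1 + q) * b)\<^sup>2" by algebra
      then have "q * a\<^sup>2 \<le> (1 + q) * ((a - b)\<^sup>2 + q * b\<^sup>2)" by (metis diff_ge_0_iff_ge zero_le_power2)
      then show ?thesis using q by (simp add: field_simps)
    qed
    have "t * lam n > 0" using t lam_pos by simp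
    from ineq[OF this] show ?thesis by (simp add: mult.assoc)
  qed
  have s1: "(\<lambda>n. (coeff w n - coeff z n)\<^sup>2) sums sq_norm M (\<lambda>x. w x - z x)"
    using Parseval[OF d] by (simp add: coeff_diff[OF w H10_L2[OF z]])
  have s2: "(\<lambda>n. t * (lam n * (coeff z n)\<^sup>2)) sums (t * (\<Sum>n. lam n * (coeff z n)\<^sup>2))"
    by (intro sums_mult summable_sums H10_summable[OF z])
  have "Kfun t w \<le> sq_norm M (\<lambda>x. w x - z x) + t * (\<Sum>n. lam n * (coeff z n)\<^sup>2)"
    unfolding Kfun_def
    by (rule sums_le[OF le summable_sums[OF Kfun_summable[OF w t]] sums_add[OF s1 s2]])
  also have "\<dots> \<le> sq_norm M (\<lambda>x. w x - z x) + t * sq_norm M (weak_gradient \<Omega> z)"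
    using H10_summable(2)[OF z] t by (intro add_mono mult_left_mono) auto
  finally show ?thesis .
qed

text \<open>The converse of \<open>Kfun_le\<close>: finitely many of the minimising coefficients
  give a function in \<open>H10_space\<close>, which is then replaced by a nearby test
  function.\<close>

lemma Kfun_approx:
  assumes u: "sq_integrable M u" and t: "t > 0" and e: "e > 0"
  obtains \<psi> where "\<psi> \<in> test_functions \<Omega>"
    "sq_norm M (\<lambda>x. u x - \<psi> x) + t * sq_norm M (gradient \<psi>) \<le> Kfun t u + e"
proof -
  define c where "c = coeff u"
  \<comment> \<open>The minimiser of \<open>(c k - a)^2 + t * lam k * a^2\<close> over real
    \<open>a\<close>.\<close>
  define a where "a k = c k / (1 + t * lam k)" for k
  have val: "sq_norm M (\<lambda>x. u x - partial a m x) + t * sq_norm M (weak_gradient \<Omega> (partial a m)) =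
     sq_norm M u - (\<Sum>k<m. (c k)\<^sup>2) + (\<Sum>k<m. t * lam k / (1 + t * lam k) * (c k)\<^sup>2)" for m
  proof -
    have "(c k - a k)\<^sup>2 + t * (lam k * (a k)\<^sup>2) = t * lam k / (1 + t * lam k) * (c k)\<^sup>2" for k
    proof -
      define q where "q = t * lam k"
      have q: "1 + q \<noteq> 0" using t lam_pos[of k] by (smt (verit) q_def mult_pos_pos)
      have ck: "c k = (1 + q) * a k" using q by (simp add: a_def q_def)
      have "(c k - a k)\<^sup>2 + q * (a k)\<^sup>2 = q / (1 + q) * (c k)\<^sup>2"
        using q unfolding ck by (simp add: field_simps power2_eq_square)
      then show ?thesis by (simp add: q_def mult.assoc)
    qed
    then show ?thesis
      unfolding sq_norm_diff_partial[OF u] sq_norm_partial_gradient c_def[symmetric]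
      by (simp add: sum_distrib_left add.assoc sum.distrib[symmetric])
  qed
  \<comment> \<open>The coefficients of \<open>u\<close> from index \<open>m\<close> on are not
    approximated at all; by Parseval their contribution tends to 0.\<close>
  have "(\<lambda>m. sq_norm M u - (\<Sum>k<m. (c k)\<^sup>2) + (\<Sum>k<m. t * lam k / (1 + t * lam k) * (c k)\<^sup>2))
     \<longlonglongrightarrow> sq_norm M u - sq_norm M u + Kfun t u"
    using Parseval[OF u] summable_sums[OF Kfun_summable[OF u t]] unfolding sums_def Kfun_def c_def
    by (intro tendsto_intros)
  then have "eventually (\<lambda>m. sq_norm M u - (\<Sum>k<m. (c k)\<^sup>2) + (\<Sum>k<m. t * lam k / (1 + t * lam k) * (c k)\<^sup>2) < Kfun t u + e / 2) sequentially"
    by (rule order_tendstoD) (use e in simp)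
  then obtain m where m: "sq_norm M u - (\<Sum>k<m. (c k)\<^sup>2) + (\<Sum>k<m. t * lam k / (1 + t * lam k) * (c k)\<^sup>2) < Kfun t u + e / 2"
    by (auto simp: eventually_sequentially)
  define v where "v = partial a m"
  define A B where "A = sqrt (sq_norm M (\<lambda>x. u x - v x))" and "B = sqrt (sq_norm M (weak_gradient \<Omega> v))"
  have vH: "v \<in> H10_space \<Omega>" unfolding v_def by (rule partial_H10)
  have AB: "A\<^sup>2 + t * B\<^sup>2 < Kfun t u + e / 2" using m val[of m] by (simp add: A_def B_def v_def)
  \<comment> \<open>\<open>d\<close> is the error allowed in each of the two norms when passing to a
    test function; by continuity at 0 the remaining \<open>e / 2\<close> pays for it.\<close>
  have "((\<lambda>d. (A + d)\<^sup>2 + t * (B + d)\<^sup>2) \<longlongrightarrow> (A + 0)\<^sup>2 + t * (B + 0)\<^sup>2) (at_right 0)"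
    by (intro tendsto_intros)
  then have "eventually (\<lambda>d. (A + d)\<^sup>2 + t * (B + d)\<^sup>2 < Kfun t u + e) (at_right 0)"
    by (rule order_tendstoD) (use AB e in simp)
  then obtain d where d: "d > 0" "(A + d)\<^sup>2 + t * (B + d)\<^sup>2 < Kfun t u + e"
    unfolding eventually_at_right_field using dense by (metis less_numeral_extra(1))
  obtain \<psi> where \<psi>: "\<psi> \<in> test_functions \<Omega>" "sq_norm M (\<lambda>x. v x - \<psi> x) < d\<^sup>2"
    "sq_norm M (\<lambda>x. weak_gradient \<Omega> v x - gradient \<psi> x) < d\<^sup>2"
    using H10_approx[OF vH, of "d\<^sup>2"] d by auto
  have small: "sqrt (sq_norm M (\<lambda>x. v x - \<psi> x)) \<le> d" "sqrt (sq_norm M (\<lambda>x. weak_gradient \<Omega> v x - gradient \<psi> x)) \<le> d"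
    using \<psi>(2,3) d(1) by (auto intro!: real_le_lsqrt)
  have 1: "sq_norm M (\<lambda>x. u x - \<psi> x) \<le> (A + d)\<^sup>2"
  proof -
    have "sqrt (sq_norm M (\<lambda>x. (u x - v x) + (v x - \<psi> x))) \<le> A + sqrt (sq_norm M (\<lambda>x. v x - \<psi> x))"
      unfolding A_def using u H10_L2[OF vH] test_function_sq_integrable[OF \<psi>(1)]
      by (intro sqrt_sq_norm_triangle) auto
    also have "\<dots> \<le> A + d" using small by simp
    finally show ?thesis by (simp add: sqrt_le_D)
  qed
  have 2: "sq_norm M (gradient \<psi>) \<le> (B + d)\<^sup>2"
  proof -
    have "sqrt (sq_norm M (\<lambda>x. weak_gradient \<Omega> v x - (weak_gradient \<Omega> v x - gradient \<psi> x))) \<le> B + sqrt (sq_norm M (\<lambda>x. weak_gradient \<Omega> v x - gradient \<psi> x))"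
      unfolding B_def using H10_weak_gradient_sq[OF vH] gradient_sq_integrable[OF \<psi>(1)]
      by (intro sqrt_sq_norm_triangle_diff) auto
    also have "\<dots> \<le> B + d" using small by simp
    finally show ?thesis by (simp add: sqrt_le_D)
  qed
  show thesis
    using that[OF \<psi>(1)] 1 mult_left_mono[OF 2, of t] t d(2) by linarith
qed

end

section \<open>Lipschitz functions operate on the spectral spaces\<close>

lemma real_polynomial_antiderivative:
  assumes "real_polynomial_function q"
  obtains P where "real_polynomial_function P" "P 0 = 0" "\<And>x. (P has_field_derivative q x) (at x)"
proof -
  obtain a n where q: "q = (\<lambda>x. \<Sum>i\<le>n. a i * x ^ i)" using assms real_polynomial_function_iff_sum by blast
  define P where "P x = (\<Sum>i\<le>n. a i / real (Suc i) * x ^ Suc i)" for x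
  show thesis
  proof
    have "real_polynomial_function (\<lambda>x::real. a i / real (Suc i) * x ^ Suc i)" for i
      by (intro real_polynomial_function.intros(2,4) real_polynomial_function_power real_polynomial_function.intros(1)) (rule bounded_linear_ident)
    then show "real_polynomial_function P" unfolding P_def by (intro real_polynomial_function_sum) auto
    show "P 0 = 0" by (simp add: P_def)
    show "(P has_field_derivative q x) (at x)" for x
    proof -
      have "((\<lambda>x. a i / real (Suc i) * x ^ Suc i) has_field_derivative a i * x ^ i) (at x)" for i
        by (rule derivative_eq_intros refl | simp)+
      then show ?thesis unfolding P_def[abs_def] q by (intro DERIV_sum)
    qed
  qed
qed

text \<open>Steklov averaging makes the Lipschitz function continuously differentiable without increasing
  its Lipschitz constant; its derivative is then approximated by a polynomial.\<close>

lemma lipschitz_polynomial_approx: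
  fixes \<Phi> :: "real \<Rightarrow> real"
  assumes lip: "\<And>x y. \<bar>\<Phi> x - \<Phi> y\<bar> \<le> L * \<bar>x - y\<bar>" and "\<Phi> 0 = 0" and "R > 0" "e > 0"
  obtains P P' where "real_polynomial_function P" "P 0 = 0" "\<And>x. (P has_field_derivative P' x) (at x)"
    "\<And>x. \<bar>x\<bar> \<le> R \<Longrightarrow> \<bar>P x - \<Phi> x\<bar> \<le> e" "\<And>x. \<bar>x\<bar> \<le> R \<Longrightarrow> \<bar>P' x\<bar> \<le> L + e"
proof -
  have L: "L \<ge> 0" using lip[of 1 0] by simp
  have cont: "continuous_on UNIV \<Phi>"
    by (rule lipschitz_on_continuous_on[of L]) (use lip L in \<open>auto simp: lipschitz_on_def dist_real_def\<close>)
  \<comment> \<open>At most 1, so that \<open>x + h\<close> and \<open>x - h\<close> stay where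
    \<open>A\<close> is an antiderivative; the other bound lets the smoothing errors at
    \<open>x\<close> and at 0 cost at most \<open>e / 2\<close> together.\<close>
  define h where "h = min 1 (e / (4 * (L + 1)))"
  have h: "0 < h" "h \<le> 1" "2 * (L * h) \<le> e / 2"
  proof -
    show "0 < h" "h \<le> 1" using L \<open>e > 0\<close> by (auto simp: h_def)
    have "L * h \<le> (L + 1) * (e / (4 * (L + 1)))"
      using L \<open>e > 0\<close> by (intro mult_mono) (auto simp: h_def)
    also have "\<dots> = e / 4" using L by (simp add: divide_simps)
    finally show "2 * (L * h) \<le> e / 2" by simp
  qed
  obtain A where A0: "\<And>x. x \<in> {-R-2..R+2} \<Longrightarrow> (A has_vector_derivative \<Phi> x) (at x within {-R-2..R+2})"
    using antiderivative_continuous[of "-R-2" "R+2" \<Phi>] continuous_on_subset[OF cont] by auto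
  have A: "(A has_field_derivative \<Phi> x) (at x)" if "\<bar>x\<bar> < R + 2" for x
    using A0[of x] that at_within_Icc_at[of "-R-2" x "R+2"]
    by (auto simp: has_real_derivative_iff_has_vector_derivative abs_less_iff)
  define S where "S x = (A (x + h) - A (x - h)) / (2 * h)" for x
  define g where "g x = (\<Phi> (x + h) - \<Phi> (x - h)) / (2 * h)" for x
  have S': "(S has_field_derivative g x) (at x)" if "\<bar>x\<bar> \<le> R" for x
  proof -
    have "((\<lambda>x. A (x + h)) has_field_derivative \<Phi> (x + h)) (at x)"
      using A[of "x + h"] that h DERIV_shift[of A "\<Phi> (x + h)" x h] by (simp add: abs_le_iff abs_less_iff)
    moreover have "((\<lambda>x. A (x - h)) has_field_derivative \<Phi> (x - h)) (at x)"
      using A[of "x - h"] that h DERIV_shift[of A "\<Phi> (x - h)" x "- h"] by (simp add: abs_le_iff abs_less_iff)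
    ultimately show ?thesis unfolding S_def[abs_def] g_def by (intro DERIV_cdivide DERIV_diff)
  qed
  \<comment> \<open>\<open>S x\<close> is the mean of \<open>\<Phi>\<close> over the interval from
    \<open>x - h\<close> to \<open>x + h\<close>, hence a value of \<open>\<Phi>\<close> at an
    intermediate point.\<close>
  have S_near: "\<bar>S x - \<Phi> x\<bar> \<le> L * h" if x: "\<bar>x\<bar> \<le> R" for x
  proof -
    have "\<And>y. x - h \<le> y \<Longrightarrow> y \<le> x + h \<Longrightarrow> (A has_field_derivative \<Phi> y) (at y)"
      using A x h by (simp add: abs_le_iff abs_less_iff)
    then obtain z where z: "x - h < z" "z < x + h" "A (x + h) - A (x - h) = (x + h - (x - h)) * \<Phi> z"
      using MVT2[of "x - h" "x + h" A \<Phi>] h by auto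
    then have "S x = \<Phi> z" using h by (simp add: S_def)
    then have "\<bar>S x - \<Phi> x\<bar> \<le> L * \<bar>z - x\<bar>" using lip by simp
    also have "\<dots> \<le> L * h" using z L by (intro mult_left_mono) auto
    finally show ?thesis .
  qed
  have g_bound: "\<bar>g x\<bar> \<le> L" for x
    using lip[of "x + h" "x - h"] h(1) by (simp add: g_def field_simps)
  \<comment> \<open>The error in the derivative: itself at most \<open>e\<close>, and integrated
    from 0 to \<open>x\<close> at most \<open>d * R\<close>, the other half of
    \<open>e\<close>.\<close>
  define d where "d = min e (e / (2 * R))"
  have d: "d > 0" "d \<le> e" "d * R \<le> e / 2" using \<open>e > 0\<close> \<open>R > 0\<close> by (auto simp: d_def min_def field_simps)
  have "continuous_on UNIV g"
    unfolding g_def using h by (intro continuous_intros continuous_on_compose2[OF cont]) auto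
  then have "continuous_on {-R..R} g" by (rule continuous_on_subset) simp
  then obtain q where q: "real_polynomial_function q" "\<And>x. x \<in> {-R..R} \<Longrightarrow> \<bar>g x - q x\<bar> < d"
    using Stone_Weierstrass_real_polynomial_function[of "{-R..R}" g d] d by auto
  obtain P where P: "real_polynomial_function P" "P 0 = 0" "\<And>x. (P has_field_derivative q x) (at x)"
    using real_polynomial_antiderivative[OF q(1)] by blast
  show thesis
  proof
    show "real_polynomial_function P" "P 0 = 0" "\<And>x. (P has_field_derivative q x) (at x)" by (fact P)+
    show "\<bar>q x\<bar> \<le> L + e" if "\<bar>x\<bar> \<le> R" for x
      using q(2)[of x] g_bound[of x] that d by (auto simp: abs_le_iff abs_less_iff)
    show "\<bar>P x - \<Phi> x\<bar> \<le> e" if x: "\<bar>x\<bar> \<le> R" for x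
    proof -
      \<comment> \<open>\<open>P 0 = 0\<close> while \<open>S 0\<close> need not vanish, so the
        increments from 0 are compared.\<close>
      have "norm ((P x - S x) - (P 0 - S 0)) \<le> d * norm (x - 0)"
      proof (rule field_differentiable_bound[of "{-R..R}" "\<lambda>x. P x - S x" "\<lambda>x. q x - g x"])
        fix z assume z: "z \<in> {-R..R}"
        then have "((\<lambda>x. P x - S x) has_field_derivative q z - g z) (at z)"
          by (intro DERIV_diff P S') (auto simp: abs_le_iff)
        then show "((\<lambda>x. P x - S x) has_field_derivative q z - g z) (at z within {-R..R})"
          by (rule has_field_derivative_at_within)
        show "norm (q z - g z) \<le> d" using q(2)[OF z] by (simp add: abs_minus_commute)
      qed (use x \<open>R > 0\<close> in \<open>auto simp: abs_le_iff\<close>)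
      also have "d * norm (x - 0) \<le> d * R" using x d(1) by simp
      finally have "\<bar>P x - S x + S 0\<bar> \<le> e / 2" using d P(2) by simp
      moreover have "\<bar>S 0\<bar> \<le> L * h" using S_near[of 0] assms by simp
      ultimately show ?thesis using S_near[OF x] h(3) by linarith
    qed
  qed
qed

context dirichlet_system
begin

lemma lipschitz_compose_sq_integrable:
  assumes u: "sq_integrable M u" and lip: "\<And>x y. \<bar>\<Phi> x - \<Phi> y\<bar> \<le> L * \<bar>x - y :: real\<bar>" and \<Phi>0: "\<Phi> 0 = 0"
  shows "sq_integrable M (\<lambda>x. \<Phi> (u x))"
proof (rule sq_integrable_bound[OF sq_integrable_cmult[OF u, of L]])
  have L: "L \<ge> 0" using lip[of 1 0] by simp
  have "continuous_on UNIV \<Phi>"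
    by (rule lipschitz_on_continuous_on[of L]) (use lip L in \<open>auto simp: lipschitz_on_def dist_real_def\<close>)
  then have [measurable]: "\<Phi> \<in> borel_measurable borel" by (rule borel_measurable_continuous_onI)
  show "(\<lambda>x. \<Phi> (u x)) \<in> borel_measurable M" using sq_integrable_measurable[OF u] by measurable
  show "AE x in M. norm (\<Phi> (u x)) \<le> norm (L * u x)"
    using lip[of _ 0] \<Phi>0 L by (simp add: abs_mult)
qed

text \<open>\<open>\<Phi>\<close> composed with a near minimiser \<open>\<psi>\<close> for
  \<open>u\<close> would be a competitor for \<open>\<Phi> u\<close> with both terms multiplied by
  at most \<open>L\<^sup>2\<close>. It is not smooth, so a polynomial takes the place of
  \<open>\<Phi>\<close>; uniform errors are harmless because the domain has finite measure.\<close>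

lemma Kfun_contraction:
  assumes u: "sq_integrable M u" and lip: "\<And>x y. \<bar>\<Phi> x - \<Phi> y\<bar> \<le> L * \<bar>x - y :: real\<bar>" and \<Phi>0: "\<Phi> 0 = 0"
    and t: "t > 0"
  shows "Kfun t (\<lambda>x. \<Phi> (u x)) \<le> L\<^sup>2 * Kfun t u"
proof -
  have L: "L \<ge> 0" using lip[of 1 0] by simp
  have \<Phi>u: "sq_integrable M (\<lambda>x. \<Phi> (u x))" by (rule lipschitz_compose_sq_integrable[OF u lip \<Phi>0])
  define \<mu> where "\<mu> = sqrt (measure M (space M))"
  have "Kfun t (\<lambda>x. \<Phi> (u x)) \<le> L\<^sup>2 * (Kfun t u + e)" if e: "e > 0" for e
  proof -
    obtain \<psi> where \<psi>: "\<psi> \<in> test_functions \<Omega>"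
      "sq_norm M (\<lambda>x. u x - \<psi> x) + t * sq_norm M (gradient \<psi>) \<le> Kfun t u + e"
      using Kfun_approx[OF u t e] by blast
    define N1 N2 where "N1 = sq_norm M (\<lambda>x. u x - \<psi> x)" and "N2 = sq_norm M (gradient \<psi>)"
    obtain R where R: "R > 0" "\<And>x. \<bar>\<psi> x\<bar> \<le> R" using test_function_bounded[OF \<psi>(1)] by blast
    \<comment> \<open>\<open>\<psi>\<close>, and with it the range bound \<open>R\<close>, stays
      fixed while \<open>\<epsilon>\<close> tends to 0; only afterwards does
      \<open>e\<close>.\<close>
    have "Kfun t (\<lambda>x. \<Phi> (u x)) \<le> (L * sqrt N1 + \<epsilon> * \<mu>)\<^sup>2 + t * ((L + \<epsilon>)\<^sup>2 * N2)" if \<epsilon>: "\<epsilon> > 0" for \<epsilon>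
    proof -
      obtain P P' where P: "real_polynomial_function P" "P 0 = 0" "\<And>x. (P has_field_derivative P' x) (at x)"
        "\<And>x. \<bar>x\<bar> \<le> R \<Longrightarrow> \<bar>P x - \<Phi> x\<bar> \<le> \<epsilon>" "\<And>x. \<bar>x\<bar> \<le> R \<Longrightarrow> \<bar>P' x\<bar> \<le> L + \<epsilon>"
        using lipschitz_polynomial_approx[OF lip \<Phi>0 R(1) \<epsilon>] by blast
      have z: "(\<lambda>x. P (\<psi> x)) \<in> test_functions \<Omega>" by (rule test_functions_polynomial[OF \<psi>(1) P(1,2)])
      have usq: "sq_integrable M (\<lambda>x. u x - \<psi> x)" using u test_function_sq_integrable[OF \<psi>(1)] by auto
      have abs: "sq_integrable M (\<lambda>x. L * \<bar>u x - \<psi> x\<bar>)"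
        using usq by (intro sq_integrable_cmult) (auto simp: sq_integrable_def)
      have "sq_norm M (\<lambda>x. \<Phi> (u x) - P (\<psi> x)) \<le> sq_norm M (\<lambda>x. L * \<bar>u x - \<psi> x\<bar> + \<epsilon>)"
      proof (rule sq_norm_mono)
        show "sq_integrable M (\<lambda>x. L * \<bar>u x - \<psi> x\<bar> + \<epsilon>)" by (rule sq_integrable_add[OF abs sq_integrable_const])
        have "\<bar>\<Phi> (u x) - P (\<psi> x)\<bar> \<le> L * \<bar>u x - \<psi> x\<bar> + \<epsilon>" for x
          using lip[of "u x" "\<psi> x"] P(4)[OF R(2)[of x]] by linarith
        then show "AE x in M. norm (\<Phi> (u x) - P (\<psi> x)) \<le> norm (L * \<bar>u x - \<psi> x\<bar> + \<epsilon>)"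
          by (intro AE_I2) (metis abs_ge_self order_trans real_norm_def)
      qed
      also have "\<dots> \<le> (L * sqrt N1 + \<epsilon> * \<mu>)\<^sup>2"
      proof -
        have "sqrt (sq_norm M (\<lambda>x. L * \<bar>u x - \<psi> x\<bar> + \<epsilon>)) \<le> sqrt (sq_norm M (\<lambda>x. L * \<bar>u x - \<psi> x\<bar>)) + sqrt (sq_norm M (\<lambda>x. \<epsilon>))"
          by (rule sqrt_sq_norm_triangle[OF abs sq_integrable_const])
        also have "\<dots> = L * sqrt N1 + \<epsilon> * \<mu>"
          using L \<epsilon> by (simp add: N1_def \<mu>_def sq_norm_def real_sqrt_mult power_mult_distrib)
        finally show ?thesis by (rule sqrt_le_D)
      qed
      finally have 1: "sq_norm M (\<lambda>x. \<Phi> (u x) - P (\<psi> x)) \<le> (L * sqrt N1 + \<epsilon> * \<mu>)\<^sup>2" .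
      have grad: "gradient (\<lambda>x. P (\<psi> x)) x = P' (\<psi> x) *\<^sub>R gradient \<psi> x" for x
        by (rule gradient_compose[OF \<psi>(1) P(3)])
      have "sq_norm M (gradient (\<lambda>x. P (\<psi> x))) \<le> sq_norm M (\<lambda>x. (L + \<epsilon>) *\<^sub>R gradient \<psi> x)"
      proof (rule sq_norm_mono)
        show "sq_integrable M (\<lambda>x. (L + \<epsilon>) *\<^sub>R gradient \<psi> x)" using gradient_sq_integrable[OF \<psi>(1)] by auto
        show "AE x in M. norm (gradient (\<lambda>x. P (\<psi> x)) x) \<le> norm ((L + \<epsilon>) *\<^sub>R gradient \<psi> x)"
          using P(5)[OF R(2)] L \<epsilon> by (intro AE_I2) (simp add: grad mult_right_mono)
      qed
      then have 2: "sq_norm M (gradient (\<lambda>x. P (\<psi> x))) \<le> (L + \<epsilon>)\<^sup>2 * N2" by (simp add: N2_def)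
      show ?thesis
        using Kfun_le[OF \<Phi>u test_function_H10[OF z] t] 1 mult_left_mono[OF 2 less_imp_le[OF t]]
        unfolding weak_gradient_test_function(3)[OF z] by linarith
    qed
    moreover have "((\<lambda>\<epsilon>. (L * sqrt N1 + \<epsilon> * \<mu>)\<^sup>2 + t * ((L + \<epsilon>)\<^sup>2 * N2)) \<longlongrightarrow>
        (L * sqrt N1 + 0 * \<mu>)\<^sup>2 + t * ((L + 0)\<^sup>2 * N2)) (at_right 0)"
      by (intro tendsto_intros)
    ultimately have "Kfun t (\<lambda>x. \<Phi> (u x)) \<le> (L * sqrt N1 + 0 * \<mu>)\<^sup>2 + t * ((L + 0)\<^sup>2 * N2)"
      by (rule at_right_lowerbound[rotated])
    also have "\<dots> = L\<^sup>2 * (N1 + t * N2)"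
      by (simp add: N1_def power_mult_distrib algebra_simps)
    also have "\<dots> \<le> L\<^sup>2 * (Kfun t u + e)"
      using \<psi>(2) by (intro mult_left_mono) (auto simp: N1_def N2_def)
    finally show ?thesis .
  qed
  moreover have "((\<lambda>e. L\<^sup>2 * (Kfun t u + e)) \<longlongrightarrow> L\<^sup>2 * (Kfun t u + 0)) (at_right 0)"
    by (intro tendsto_intros)
  ultimately have "Kfun t (\<lambda>x. \<Phi> (u x)) \<le> L\<^sup>2 * (Kfun t u + 0)"
    by (rule at_right_lowerbound[rotated])
  then show ?thesis by simp
qed

end

section \<open>Fractional powers as integrals over \<open>t\<close>\<close>

definition frac_weight :: "real \<Rightarrow> real \<Rightarrow> real \<Rightarrow> real" where
  "frac_weight r l t = indicator {0<..} t * (t powr (-1 - r) * (t * l / (1 + t * l)))"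

lemma frac_weight_measurable [measurable]: "frac_weight r l \<in> borel_measurable borel"
  unfolding frac_weight_def[abs_def] by measurable

lemma frac_weight_nonneg: "l > 0 \<Longrightarrow> 0 \<le> frac_weight r l t"
  by (simp add: frac_weight_def indicator_def)

text \<open>Scaling \<open>t\<close> by \<open>l\<close> reduces everything to \<open>l = 1\<close>.
  There the weight is at most \<open>t powr (- r)\<close> near 0 and \<open>t powr (- 1 - r)\<close>
  at infinity, integrable by \<open>r < 1\<close> and \<open>0 < r\<close> respectively. It is
  positive on \<open>{1..2}\<close>, whence \<open>C > 0\<close>.\<close>

lemma nn_integral_frac_weight:
  assumes r: "0 < r" "r < 1"
  obtains C where "0 < C" "\<And>l. l > 0 \<Longrightarrow> (\<integral>\<^sup>+ t. ennreal (frac_weight r l t) \<partial>lborel) = ennreal (C * l powr r)"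
proof -
  define I where "I l = (\<integral>\<^sup>+ t. ennreal (frac_weight r l t) \<partial>lborel)" for l
  have bound: "frac_weight r 1 t \<le> t powr (-r) * indicator {0..1} t + t powr (-1-r) * indicator {1..} t" for t
  proof (cases "t > 0")
    case True
    have "t powr (-1 - r) * (t / (1 + t)) \<le> t powr (-1-r) * t"
      using True by (intro mult_left_mono) (auto simp: field_simps)
    also have "t powr (-1-r) * t = t powr (-r)" using True powr_mult_base[of t "-1-r"] by (simp add: mult.commute)
    finally have 1: "t powr (-1 - r) * (t / (1 + t)) \<le> t powr (-r)" .
    have "t powr (-1 - r) * (t / (1 + t)) \<le> t powr (-1-r) * 1"
      using True by (intro mult_left_mono) auto
    with 1 True show ?thesis by (cases "t \<le> 1") (auto simp: frac_weight_def indicator_def add_increasing2 add_increasing)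
  next
    case False
    then show ?thesis by (simp add: frac_weight_def)
  qed
  have i1: "(\<integral>\<^sup>+ t. ennreal (t powr (-r) * indicator {0..1} t) \<partial>lborel) = ennreal (1 / (1 - r))"
    using nn_integral_has_integral_lebesgue[OF _ has_integral_powr_from_0[of "-r" 1]] r
    by (simp add: mult.commute indicator_def if_distrib cong: if_cong)
  have i2: "(\<integral>\<^sup>+ t. ennreal (t powr (-1-r) * indicator {1..} t) \<partial>lborel) = ennreal (1 / r)"
    using nn_integral_has_integral_lebesgue[OF _ has_integral_powr_to_inf[of "-1-r" 1]] r
    by (simp add: mult.commute)
  have "I 1 \<le> (\<integral>\<^sup>+ t. ennreal (t powr (-r) * indicator {0..1} t) + ennreal (t powr (-1-r) * indicator {1..} t) \<partial>lborel)"
    unfolding I_def using bound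
    by (intro nn_integral_mono) (auto simp: ennreal_plus[symmetric] simp del: ennreal_plus intro!: ennreal_leI)
  also have "\<dots> = ennreal (1 / (1 - r)) + ennreal (1 / r)"
    unfolding i1[symmetric] i2[symmetric] by (rule nn_integral_add) measurable
  finally have fin: "I 1 < \<infinity>" by (auto simp: less_top[symmetric] top_unique)
  have "I 1 \<noteq> 0"
  proof
    assume "I 1 = 0"
    then have "AE t in lborel. frac_weight r 1 t \<le> 0"
      unfolding I_def by (subst (asm) nn_integral_0_iff_AE) (auto simp: ennreal_eq_0_iff)
    then have "AE t in lborel. t \<notin> {1..2::real}"
    proof eventually_elim
      case (elim t)
      have "0 < frac_weight r 1 t" if "t \<ge> 1"
        using that by (simp add: frac_weight_def)
      with elim show ?case by force
    qed
    then have "emeasure lborel {1..2::real} = 0"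
      by (subst (asm) AE_iff_measurable[of "{1..2}"]) auto
    then show False by simp
  qed
  obtain C where C: "I 1 = ennreal C" "C > 0"
    using fin \<open>I 1 \<noteq> 0\<close> by (cases "I 1") (auto simp: ennreal_eq_0_iff not_le)
  show thesis
  proof
    show "0 < C" by (rule C)
    fix l :: real assume l: "l > 0"
    \<comment> \<open>The Jacobian \<open>l\<close> of the substitution and the factor
      \<open>l powr (- 1 - r)\<close> from the weight combine to
      \<open>l powr (- r)\<close>.\<close>
    have "I 1 = ennreal l * (\<integral>\<^sup>+ t. ennreal (frac_weight r 1 (0 + l * t)) \<partial>lborel)"
      unfolding I_def using l nn_integral_real_affine[of "\<lambda>t. ennreal (frac_weight r 1 t)" l 0] by simp
    also have "(\<integral>\<^sup>+ t. ennreal (frac_weight r 1 (0 + l * t)) \<partial>lborel) = (\<integral>\<^sup>+ t. ennreal (l powr (-1-r) * frac_weight r l t) \<partial>lborel)"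
      using l by (intro nn_integral_cong arg_cong[of _ _ ennreal])
        (auto simp: frac_weight_def indicator_def zero_less_mult_iff powr_mult mult_ac)
    also have "(\<integral>\<^sup>+ t. ennreal (l powr (-1-r) * frac_weight r l t) \<partial>lborel) = ennreal (l powr (-1-r)) * I l"
      unfolding I_def by (subst nn_integral_cmult[symmetric]) (auto simp: ennreal_mult' frac_weight_nonneg)
    also have "ennreal l * (ennreal (l powr (-1-r)) * I l) = ennreal (l powr (-r)) * I l"
      using l powr_mult_base[of l "-1-r"] by (simp add: mult.assoc[symmetric] ennreal_mult[symmetric])
    finally have "ennreal (l powr r) * ennreal C = ennreal (l powr r) * (ennreal (l powr (-r)) * I l)"
      using C by simp
    also have "\<dots> = I l" using l by (simp add: mult.assoc[symmetric] ennreal_mult[symmetric] powr_add[symmetric])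
    finally show "(\<integral>\<^sup>+ t. ennreal (frac_weight r l t) \<partial>lborel) = ennreal (C * l powr r)"
      using C(2) by (simp add: I_def ennreal_mult[symmetric] mult.commute)
  qed
qed

text \<open>Multiply the inequality at \<open>t\<close> by \<open>t powr (- 1 - r)\<close>,
  integrate, and exchange integral and sum. The computation runs in \<open>ennreal\<close> because
  summability on the left is part of the conclusion.\<close>

lemma powr_sum_le_if_resolvent_sums_le:
  fixes a b lam :: "nat \<Rightarrow> real"
  assumes r: "0 < r" "r < 1" and lam: "\<And>n. lam n > 0" and nn: "\<And>n. a n \<ge> 0" "\<And>n. b n \<ge> 0" "D \<ge> 0"
    and sa: "\<And>t. t > 0 \<Longrightarrow> summable (\<lambda>n. t * lam n / (1 + t * lam n) * a n)"
    and sb: "\<And>t. t > 0 \<Longrightarrow> summable (\<lambda>n. t * lam n / (1 + t * lam n) * b n)"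
    and le: "\<And>t. t > 0 \<Longrightarrow> (\<Sum>n. t * lam n / (1 + t * lam n) * a n) \<le> D * (\<Sum>n. t * lam n / (1 + t * lam n) * b n)"
    and s: "summable (\<lambda>n. lam n powr r * b n)"
  shows "summable (\<lambda>n. lam n powr r * a n)" "(\<Sum>n. lam n powr r * a n) \<le> D * (\<Sum>n. lam n powr r * b n)"
proof -
  obtain C where C: "0 < C" "\<And>l. l > 0 \<Longrightarrow> (\<integral>\<^sup>+ t. ennreal (frac_weight r l t) \<partial>lborel) = ennreal (C * l powr r)"
    using nn_integral_frac_weight[OF r] by blast
  have int: "(\<integral>\<^sup>+ t. (\<Sum>n. ennreal (frac_weight r (lam n) t * d n)) \<partial>lborel) = ennreal C * (\<Sum>n. ennreal (lam n powr r * d n))"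
    if d: "\<And>n. d n \<ge> 0" for d
  proof -
    have "(\<integral>\<^sup>+ t. (\<Sum>n. ennreal (frac_weight r (lam n) t * d n)) \<partial>lborel) = (\<Sum>n. \<integral>\<^sup>+ t. ennreal (frac_weight r (lam n) t * d n) \<partial>lborel)"
      by (rule nn_integral_suminf) measurable
    also have "\<dots> = (\<Sum>n. ennreal C * ennreal (lam n powr r * d n))"
    proof (rule suminf_cong)
      fix n
      have "(\<integral>\<^sup>+ t. ennreal (frac_weight r (lam n) t * d n) \<partial>lborel) = (\<integral>\<^sup>+ t. ennreal (frac_weight r (lam n) t) \<partial>lborel) * ennreal (d n)"
        using d by (subst nn_integral_multc[symmetric]) (auto simp: ennreal_mult frac_weight_nonneg lam)
      then show "(\<integral>\<^sup>+ t. ennreal (frac_weight r (lam n) t * d n) \<partial>lborel) = ennreal C * ennreal (lam n powr r * d n)"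
        using C(1) C(2)[OF lam[of n]] d by (simp add: ennreal_mult mult.assoc)
    qed
    finally show ?thesis by simp
  qed
  have series: "(\<Sum>n. ennreal (frac_weight r (lam n) t * d n)) = ennreal (indicator {0<..} t * t powr (-1-r) * (\<Sum>n. t * lam n / (1 + t * lam n) * d n))"
    if "\<And>n. d n \<ge> 0" "t > 0 \<Longrightarrow> summable (\<lambda>n. t * lam n / (1 + t * lam n) * d n)" for d t
  proof (cases "t > 0")
    case True
    have eq: "frac_weight r (lam n) t * d n = t powr (-1-r) * (t * lam n / (1 + t * lam n) * d n)" for n
      using True by (simp add: frac_weight_def)
    have "0 \<le> t * lam n / (1 + t * lam n) * d n" for n using True lam[of n] that(1)[of n] by simp
    then have "(\<Sum>n. ennreal (t powr (-1-r) * (t * lam n / (1 + t * lam n) * d n))) = ennreal (\<Sum>n. t powr (-1-r) * (t * lam n / (1 + t * lam n) * d n))"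
      using that(2)[OF True] by (intro suminf_ennreal2 summable_mult mult_nonneg_nonneg[OF powr_ge_zero]) auto
    then show ?thesis using True unfolding eq suminf_mult[OF that(2)[OF True]] by simp
  next
    case False
    then show ?thesis by (simp add: frac_weight_def)
  qed
  have "ennreal C * (\<Sum>n. ennreal (lam n powr r * a n)) \<le> (\<integral>\<^sup>+ t. ennreal D * (\<Sum>n. ennreal (frac_weight r (lam n) t * b n)) \<partial>lborel)"
    unfolding int[OF nn(1), symmetric]
  proof (rule nn_integral_mono)
    fix t :: real
    show "(\<Sum>n. ennreal (frac_weight r (lam n) t * a n)) \<le> ennreal D * (\<Sum>n. ennreal (frac_weight r (lam n) t * b n))"
    proof -
      let ?S = "\<lambda>d. \<Sum>n. t * lam n / (1 + t * lam n) * d n"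
      have "ennreal (indicator {0<..} t * t powr (-1-r) * ?S a) \<le> ennreal D * ennreal (indicator {0<..} t * t powr (-1-r) * ?S b)"
      proof (cases "t > 0")
        case True
        have "t powr (-1-r) * ?S a \<le> t powr (-1-r) * (D * ?S b)"
          using le[OF True] by (intro mult_left_mono) auto
        then show ?thesis using True nn(3) by (simp add: ennreal_mult'[symmetric] mult.left_commute ennreal_leI)
      qed simp
      moreover have "(\<Sum>n. ennreal (frac_weight r (lam n) t * a n)) = ennreal (indicator {0<..} t * t powr (-1-r) * ?S a)"
        by (rule series[OF nn(1) sa])
      moreover have "(\<Sum>n. ennreal (frac_weight r (lam n) t * b n)) = ennreal (indicator {0<..} t * t powr (-1-r) * ?S b)"
        by (rule series[OF nn(2) sb])
      ultimately show ?thesis by (simp only:)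
    qed
  qed
  also have "\<dots> = ennreal D * (ennreal C * (\<Sum>n. ennreal (lam n powr r * b n)))"
    unfolding int[OF nn(2), symmetric] by (rule nn_integral_cmult) measurable
  also have "\<dots> = ennreal C * ennreal (D * (\<Sum>n. lam n powr r * b n))"
    using nn s lam by (subst suminf_ennreal2) (auto simp: ennreal_mult' suminf_nonneg mult_ac)
  finally have fin: "(\<Sum>n. ennreal (lam n powr r * a n)) \<le> ennreal (D * (\<Sum>n. lam n powr r * b n))"
    using C(1) by (subst (asm) ennreal_mult_le_mult_iff) auto
  show sum: "summable (\<lambda>n. lam n powr r * a n)"
    by (rule summable_suminf_not_top) (use fin nn in \<open>auto simp: top_unique\<close>)
  show "(\<Sum>n. lam n powr r * a n) \<le> D * (\<Sum>n. lam n powr r * b n)"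
    using fin nn by (subst (asm) suminf_ennreal2[OF _ sum]) (auto simp: suminf_nonneg[OF s])
qed

context dirichlet_system
begin

definition energy :: "real \<Rightarrow> ('a \<Rightarrow> real) \<Rightarrow> real" where
  "energy r u = (\<Sum>n. lam n powr r * (coeff u n)\<^sup>2)"

lemma energy_nonneg: "u \<in> spectral_space \<Omega> lam \<phi> r \<Longrightarrow> 0 \<le> energy r u"
  unfolding energy_def spectral_space_iff by (intro suminf_nonneg) auto

text \<open>Integrating \<open>Kfun_contraction\<close> over \<open>t\<close>; the restriction to
  orders strictly between 0 and 1 is that of the integral representation.\<close>

lemma
  assumes r: "0 < r" "r < 1" and u: "u \<in> spectral_space \<Omega> lam \<phi> r"
    and lip: "\<And>x y. \<bar>\<Phi> x - \<Phi> y\<bar> \<le> L * \<bar>x - y :: real\<bar>" and \<Phi>0: "\<Phi> 0 = 0"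
  shows lipschitz_compose_spectral_space: "(\<lambda>x. \<Phi> (u x)) \<in> spectral_space \<Omega> lam \<phi> r"
    and energy_lipschitz_compose: "energy r (\<lambda>x. \<Phi> (u x)) \<le> L\<^sup>2 * energy r u"
proof -
  have usq: "sq_integrable M u" using u by (simp add: spectral_space_iff)
  have \<Phi>u: "sq_integrable M (\<lambda>x. \<Phi> (u x))" by (rule lipschitz_compose_sq_integrable[OF usq lip \<Phi>0])
  have le: "(\<Sum>n. t * lam n / (1 + t * lam n) * (coeff (\<lambda>x. \<Phi> (u x)) n)\<^sup>2) \<le> L\<^sup>2 * (\<Sum>n. t * lam n / (1 + t * lam n) * (coeff u n)\<^sup>2)"
    if "t > 0" for t
    using Kfun_contraction[OF usq lip \<Phi>0 that] by (simp add: Kfun_def)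
  have s: "summable (\<lambda>n. lam n powr r * (coeff u n)\<^sup>2)" using u by (simp add: spectral_space_iff)
  note * = powr_sum_le_if_resolvent_sums_le[OF r lam_pos _ _ _ Kfun_summable[OF \<Phi>u] Kfun_summable[OF usq] le s]
  show "(\<lambda>x. \<Phi> (u x)) \<in> spectral_space \<Omega> lam \<phi> r" using *(1) \<Phi>u by (simp add: spectral_space_iff)
  show "energy r (\<lambda>x. \<Phi> (u x)) \<le> L\<^sup>2 * energy r u" using *(2) by (simp add: energy_def)
qed

text \<open>For \<open>q = t * lam n\<close> the quotient \<open>q / (1 + q)\<close> is at most 1
  and at most \<open>q\<close>, hence at most the power \<open>q powr s\<close> in between.\<close>

lemma Kfun_le_energy:
  assumes s: "0 \<le> s" "s \<le> 1" and u: "u \<in> spectral_space \<Omega> lam \<phi> s" and t: "t > 0"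
  shows "Kfun t u \<le> t powr s * energy s u"
proof -
  have usq: "sq_integrable M u" using u by (simp add: spectral_space_iff)
  have "t * lam n / (1 + t * lam n) * (coeff u n)\<^sup>2 \<le> t powr s * (lam n powr s * (coeff u n)\<^sup>2)" for n
  proof -
    define q where "q = t * lam n"
    have q: "q > 0" using t lam_pos by (simp add: q_def)
    have "q / (1 + q) \<le> q powr s"
    proof (cases "q \<le> 1")
      case True
      have "q / (1 + q) \<le> q powr 1" using q by (simp add: field_simps)
      also have "\<dots> \<le> q powr s" using True q s by (intro powr_mono') auto
      finally show ?thesis .
    next
      case False
      have "q / (1 + q) \<le> 1" using q by simp
      also have "1 \<le> q powr s" using False s by (intro ge_one_powr_ge_zero) auto
      finally show ?thesis .
    qed
    also have "q powr s = t powr s * lam n powr s" using t lam_pos[of n] by (simp add: q_def powr_mult)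
    finally have "q / (1 + q) * (coeff u n)\<^sup>2 \<le> t powr s * lam n powr s * (coeff u n)\<^sup>2"
      by (rule mult_right_mono) simp
    then show ?thesis by (simp add: q_def mult.assoc)
  qed
  moreover have "summable (\<lambda>n. lam n powr s * (coeff u n)\<^sup>2)" using u by (simp add: spectral_space_iff)
  ultimately have "Kfun t u \<le> (\<Sum>n. t powr s * (lam n powr s * (coeff u n)\<^sup>2))"
    unfolding Kfun_def by (intro suminf_le Kfun_summable[OF usq t] summable_mult)
  then show ?thesis
    unfolding energy_def using suminf_mult[OF \<open>summable _\<close>, of "t powr s"] by simp
qed

end

section \<open>A Faber-Krahn inequality\<close>

lemma sq_integrable_translate:
  fixes h :: "'a::euclidean_space \<Rightarrow> real"
  assumes "sq_integrable lborel h"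
  shows "sq_integrable lborel (\<lambda>x. h (x + y))" "sq_norm lborel (\<lambda>x. h (x + y)) = sq_norm lborel h"
proof -
  have [measurable]: "h \<in> borel_measurable borel" using sq_integrable_measurable[OF assms] by simp
  have "(\<lambda>x. h (x + y)) \<in> borel_measurable borel" by measurable
  then show "sq_integrable lborel (\<lambda>x. h (x + y))"
    using assms integrable_lborel_translate[of "\<lambda>x. (h x)\<^sup>2" y] by (simp add: sq_integrable_def)
  show "sq_norm lborel (\<lambda>x. h (x + y)) = sq_norm lborel h"
    using integral_lborel_translate[of "\<lambda>x. (h x)\<^sup>2" y] by (simp add: sq_norm_def)
qed

text \<open>The fundamental theorem of calculus along the segment from \<open>x\<close> to
  \<open>x + y\<close>, then Cauchy-Schwarz on the unit interval. The \<open>ennreal\<close> form is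
  ready for Tonelli.\<close>

lemma test_function_difference_sq_le:
  fixes \<psi> :: "'a::euclidean_space \<Rightarrow> real"
  assumes \<psi>: "\<psi> \<in> test_functions \<Omega>"
  shows "ennreal ((\<psi> (x + y) - \<psi> x)\<^sup>2) \<le> (\<integral>\<^sup>+ t. ennreal ((norm y)\<^sup>2 * (norm (gradient \<psi> (x + t *\<^sub>R y)))\<^sup>2) * indicator {0..1} t \<partial>lborel)"
proof -
  define D where "D t = gradient \<psi> (x + t *\<^sub>R y) \<bullet> y" for t
  have contD: "continuous_on UNIV D"
    unfolding D_def[abs_def]
    by (intro continuous_intros continuous_on_compose2[OF gradient_continuous[OF \<psi>]]) auto
  then have [measurable]: "D \<in> borel_measurable borel" by (rule borel_measurable_continuous_onI)
  have deriv: "((\<lambda>t. \<psi> (x + t *\<^sub>R y)) has_field_derivative D t) (at t)" for t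
  proof -
    have "((\<lambda>t. x + t *\<^sub>R y) has_derivative (\<lambda>h. h *\<^sub>R y)) (at t)" by (auto intro!: derivative_eq_intros)
    from has_derivative_compose[OF this test_function_has_derivative[OF \<psi>]]
    have "((\<lambda>t. \<psi> (x + t *\<^sub>R y)) has_derivative (\<lambda>h. frechet_derivative \<psi> (at (x + t *\<^sub>R y)) (h *\<^sub>R y))) (at t)" .
    moreover have "frechet_derivative \<psi> (at z) (h *\<^sub>R y) = gradient \<psi> z \<bullet> y * h" for z h
      using gradient_inner[OF \<psi>, of z "h *\<^sub>R y"] by (simp add: mult.commute)
    ultimately show ?thesis by (simp add: has_field_derivative_def D_def)
  qed
  have ftc: "(LINT t|lborel. D t * indicator {0..1} t) = \<psi> (x + y) - \<psi> x"
    using integral_FTC_Icc_real[of 0 1 "\<lambda>t. \<psi> (x + t *\<^sub>R y)" D] deriv contD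
    by (simp add: continuous_on_eq_continuous_at)
  obtain B where B: "\<And>z. norm (gradient \<psi> z) \<le> B" using gradient_bounded[OF \<psi>] by blast
  have Dbound: "\<bar>D t\<bar> \<le> norm (gradient \<psi> (x + t *\<^sub>R y)) * norm y" for t
    unfolding D_def by (rule Cauchy_Schwarz_ineq2)
  have bnd: "integrable lborel (indicat_real {0..1::real})" by (rule integrable_real_indicator) auto
  have ind2: "(norm (indicat_real {0..1} t))\<^sup>2 = indicat_real {0..1} t" for t :: real by (simp add: indicator_def)
  have sq1: "sq_integrable lborel (\<lambda>t::real. indicator {0..1} t :: real)"
    unfolding sq_integrable_def ind2 using bnd by simp
  have sqD: "sq_integrable lborel (\<lambda>t. D t * indicator {0..1} t)"
  proof (rule sq_integrable_bound[OF sq_integrable_cmult[OF sq1, of "B * norm y"]])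
    have "\<bar>D t\<bar> \<le> \<bar>B * norm y\<bar>" for t
      using order_trans[OF Dbound mult_right_mono[OF B norm_ge_zero]] abs_ge_self order_trans by blast
    then show "AE t in lborel. norm (D t * indicator {0..1} t) \<le> norm (B * norm y * indicator {0..1} t)"
      by (auto simp: indicator_def)
  qed measurable
  have one: "sq_norm lborel (\<lambda>t::real. indicator {0..1} t :: real) = 1"
    unfolding sq_norm_def ind2 by simp
  have "(\<psi> (x + y) - \<psi> x)\<^sup>2 = (LINT t|lborel. (D t * indicator {0..1} t) \<bullet> indicator {0..1} t)\<^sup>2"
    unfolding ftc[symmetric] by (simp add: mult.assoc flip: indicator_inter_arith)
  also have "\<dots> \<le> sq_norm lborel (\<lambda>t. D t * indicator {0..1} t)"
    using Cauchy_Schwarz_integral[OF sqD sq1] by (simp add: one)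
  finally have "ennreal ((\<psi> (x + y) - \<psi> x)\<^sup>2) \<le> ennreal (sq_norm lborel (\<lambda>t. D t * indicator {0..1} t))"
    by (rule ennreal_leI)
  also have "\<dots> = (\<integral>\<^sup>+ t. ennreal ((norm (D t * indicator {0..1} t))\<^sup>2) \<partial>lborel)"
    using sqD nn_integral_eq_integral[of lborel "\<lambda>t. (norm (D t * indicator {0..1} t))\<^sup>2"]
    by (simp add: sq_norm_def sq_integrable_def)
  also have "\<dots> \<le> (\<integral>\<^sup>+ t. ennreal ((norm y)\<^sup>2 * (norm (gradient \<psi> (x + t *\<^sub>R y)))\<^sup>2) * indicator {0..1} t \<partial>lborel)"
  proof (rule nn_integral_mono)
    fix t
    have "(D t)\<^sup>2 \<le> (norm y)\<^sup>2 * (norm (gradient \<psi> (x + t *\<^sub>R y)))\<^sup>2"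
      using power_mono[OF Dbound[of t], of 2] by (simp add: power_mult_distrib mult.commute)
    then show "ennreal ((norm (D t * indicator {0..1} t))\<^sup>2) \<le> ennreal ((norm y)\<^sup>2 * (norm (gradient \<psi> (x + t *\<^sub>R y)))\<^sup>2) * indicator {0..1} t"
      by (auto simp: indicator_def intro: ennreal_leI)
  qed
  finally show ?thesis .
qed

section \<open>Translates and the modulus of continuity\<close>

context dirichlet_system
begin

lemma sq_integrable_lborel:
  fixes h :: "'a \<Rightarrow> 'b::euclidean_space"
  assumes "h \<in> borel_measurable borel" "\<And>x. x \<notin> \<Omega> \<Longrightarrow> h x = 0"
  shows "sq_integrable M h \<longleftrightarrow> sq_integrable lborel h" "sq_norm M h = sq_norm lborel h"
proof -
  have [measurable]: "h \<in> borel_measurable borel" by fact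
  have "(\<lambda>x. (norm (h x))\<^sup>2) \<in> borel_measurable borel" by measurable
  note * = this lebesgue_on_lborel[OF domain_sets this]
  show "sq_integrable M h \<longleftrightarrow> sq_integrable lborel h" "sq_norm M h = sq_norm lborel h"
    using * assms borel_measurable_domain[OF assms(1)] by (simp_all add: sq_integrable_def sq_norm_def)
qed

text \<open>After Tonelli, translation invariance removes the shift by \<open>t *\<^sub>R y\<close>
  from the integral over \<open>x\<close>, so the average over \<open>t\<close> becomes
  trivial.\<close>

lemma test_function_translate:
  assumes \<psi>: "\<psi> \<in> test_functions \<Omega>"
  shows "sq_norm lborel (\<lambda>x. \<psi> (x + y) - \<psi> x) \<le> (norm y)\<^sup>2 * sq_norm M (gradient \<psi>)"
proof -
  have [measurable]: "\<psi> \<in> borel_measurable borel" using \<psi> by (rule test_function_measurable)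
  have [measurable]: "gradient \<psi> \<in> borel_measurable borel" using \<psi> by (rule gradient_measurable)
  have l\<psi>: "sq_integrable lborel \<psi>"
    using sq_integrable_lborel(1)[OF test_function_measurable[OF \<psi>] test_function_outside[OF \<psi>]] test_function_sq_integrable[OF \<psi>] by simp
  have lg: "sq_integrable lborel (gradient \<psi>)" "sq_norm lborel (gradient \<psi>) = sq_norm M (gradient \<psi>)"
    using sq_integrable_lborel[OF gradient_measurable[OF \<psi>] gradient_outside[OF \<psi>]] gradient_sq_integrable[OF \<psi>] by simp_all
  define G where "G x = ennreal ((norm y)\<^sup>2 * (norm (gradient \<psi> x))\<^sup>2)" for x
  have [measurable]: "G \<in> borel_measurable borel" unfolding G_def by measurable
  have pair: "pair_sigma_finite (lborel :: real measure) (lborel :: 'a measure)" ..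
  have intG: "(\<integral>\<^sup>+ x. G x \<partial>lborel) = ennreal ((norm y)\<^sup>2 * sq_norm M (gradient \<psi>))"
    using nn_integral_eq_integral[of lborel "\<lambda>x. (norm y)\<^sup>2 * (norm (gradient \<psi> x))\<^sup>2"] lg
    by (simp add: G_def sq_integrable_def sq_norm_def)
  have "ennreal (sq_norm lborel (\<lambda>x. \<psi> (x + y) - \<psi> x)) = (\<integral>\<^sup>+ x. ennreal ((\<psi> (x + y) - \<psi> x)\<^sup>2) \<partial>lborel)"
    using nn_integral_eq_integral[of lborel "\<lambda>x. (\<psi> (x + y) - \<psi> x)\<^sup>2"]
      sq_integrable_diff[OF sq_integrable_translate(1)[OF l\<psi>] l\<psi>]
    by (simp add: sq_norm_def sq_integrable_def)
  also have "\<dots> \<le> (\<integral>\<^sup>+ x. (\<integral>\<^sup>+ t. G (x + t *\<^sub>R y) * indicator {0..1} t \<partial>lborel) \<partial>lborel)"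
    unfolding G_def by (intro nn_integral_mono test_function_difference_sq_le[OF \<psi>])
  also have "\<dots> = (\<integral>\<^sup>+ t. (\<integral>\<^sup>+ x. G (x + t *\<^sub>R y) * indicator {0..1} t \<partial>lborel) \<partial>lborel)"
    by (rule pair_sigma_finite.Fubini'[OF pair]) measurable
  also have "\<dots> = (\<integral>\<^sup>+ t. (\<integral>\<^sup>+ x. G x \<partial>lborel) * indicator {0..1} t \<partial>(lborel :: real measure))"
    by (simp add: nn_integral_multc nn_integral_lborel_translate)
  also have "\<dots> = (\<integral>\<^sup>+ x. G x \<partial>lborel)" by (simp add: nn_integral_cmult)
  finally show ?thesis unfolding intG by (simp add: ennreal_le_iff)
qed

text \<open>Split off a test function: the remainder keeps its norm under translation, and the test
  function moves by at most \<open>norm y\<close> times the norm of its gradient, to which the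
  parameter \<open>(norm y)\<^sup>2\<close> is matched. The 8 comes from bounding
  \<open>(2 * a + b)^2\<close> by \<open>8 * (a^2 + b^2)\<close>.\<close>

lemma translate_le_Kfun:
  assumes w: "w \<in> borel_measurable borel" "\<And>x. x \<notin> \<Omega> \<Longrightarrow> w x = 0" "sq_integrable M w" and y: "y \<noteq> 0"
  shows "sq_norm lborel (\<lambda>x. w (x + y) - w x) \<le> 8 * Kfun ((norm y)\<^sup>2) w"
proof -
  have "sq_norm lborel (\<lambda>x. w (x + y) - w x) \<le> 8 * (Kfun ((norm y)\<^sup>2) w + e)" if e: "e > 0" for e
  proof -
    obtain \<psi> where \<psi>: "\<psi> \<in> test_functions \<Omega>"
      "sq_norm M (\<lambda>x. w x - \<psi> x) + (norm y)\<^sup>2 * sq_norm M (gradient \<psi>) \<le> Kfun ((norm y)\<^sup>2) w + e"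
      using Kfun_approx[OF w(3) _ e, of "(norm y)\<^sup>2"] y by auto
    have m: "(\<lambda>x. w x - \<psi> x) \<in> borel_measurable borel" and out: "\<And>x. x \<notin> \<Omega> \<Longrightarrow> w x - \<psi> x = 0"
      using w test_function_measurable[OF \<psi>(1)] test_function_outside[OF \<psi>(1)] by auto
    have d: "sq_integrable lborel (\<lambda>x. w x - \<psi> x)"
      using sq_integrable_lborel(1)[OF m out] sq_integrable_diff[OF w(3) test_function_sq_integrable[OF \<psi>(1)]] by simp
    have l\<psi>: "sq_integrable lborel \<psi>"
      using sq_integrable_lborel(1)[OF test_function_measurable[OF \<psi>(1)] test_function_outside[OF \<psi>(1)]] test_function_sq_integrable[OF \<psi>(1)] by simp
    define a where "a = sqrt (sq_norm M (\<lambda>x. w x - \<psi> x))"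
    define b where "b = norm y * sqrt (sq_norm M (gradient \<psi>))"
    have sq\<psi>: "sq_integrable lborel (\<lambda>x. \<psi> (x + y) - \<psi> x)"
      by (rule sq_integrable_diff[OF sq_integrable_translate(1)[OF l\<psi>] l\<psi>])
    have "sqrt (sq_norm lborel (\<lambda>x. w (x + y) - w x)) =
      sqrt (sq_norm lborel (\<lambda>x. ((w (x + y) - \<psi> (x + y)) + (\<psi> (x + y) - \<psi> x)) - (w x - \<psi> x)))"
      by simp
    also have "\<dots> \<le> sqrt (sq_norm lborel (\<lambda>x. (w (x + y) - \<psi> (x + y)) + (\<psi> (x + y) - \<psi> x))) + sqrt (sq_norm lborel (\<lambda>x. w x - \<psi> x))"
      by (intro sqrt_sq_norm_triangle_diff sq_integrable_add sq\<psi> d sq_integrable_translate(1)[OF d])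
    also have "\<dots> \<le> (sqrt (sq_norm lborel (\<lambda>x. w (x + y) - \<psi> (x + y))) + sqrt (sq_norm lborel (\<lambda>x. \<psi> (x + y) - \<psi> x))) + sqrt (sq_norm lborel (\<lambda>x. w x - \<psi> x))"
      by (intro add_right_mono sqrt_sq_norm_triangle sq\<psi> sq_integrable_translate(1)[OF d])
    also have "\<dots> \<le> (a + b) + a"
    proof -
      have "sqrt (sq_norm lborel (\<lambda>x. \<psi> (x + y) - \<psi> x)) \<le> b"
        using real_sqrt_le_mono[OF test_function_translate[OF \<psi>(1), of y]] by (simp add: b_def real_sqrt_mult)
      then show ?thesis
        using sq_integrable_translate(2)[OF d, of y] sq_integrable_lborel(2)[OF m out] by (simp add: a_def)
    qed
    finally have "sq_norm lborel (\<lambda>x. w (x + y) - w x) \<le> (2 * a + b)\<^sup>2"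
      by (intro sqrt_le_D) simp
    also have "\<dots> \<le> 8 * (a\<^sup>2 + b\<^sup>2)"
      using sum_squares_bound[of "2 * a" b] by (simp add: power2_sum power_mult_distrib) (smt (verit) zero_le_power2)
    also have "a\<^sup>2 + b\<^sup>2 = sq_norm M (\<lambda>x. w x - \<psi> x) + (norm y)\<^sup>2 * sq_norm M (gradient \<psi>)"
      by (simp add: a_def b_def power_mult_distrib)
    also have "8 * (sq_norm M (\<lambda>x. w x - \<psi> x) + (norm y)\<^sup>2 * sq_norm M (gradient \<psi>)) \<le> 8 * (Kfun ((norm y)\<^sup>2) w + e)"
      using \<psi>(2) by (intro mult_left_mono) auto
    finally show ?thesis .
  qed
  moreover have "((\<lambda>e. 8 * (Kfun ((norm y)\<^sup>2) w + e)) \<longlongrightarrow> 8 * (Kfun ((norm y)\<^sup>2) w + 0)) (at_right 0)"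
    by (intro tendsto_intros)
  ultimately have "sq_norm lborel (\<lambda>x. w (x + y) - w x) \<le> 8 * (Kfun ((norm y)\<^sup>2) w + 0)"
    by (rule at_right_lowerbound[rotated])
  then show ?thesis by simp
qed

text \<open>Functions in L2 are Lebesgue measurable on the domain, with irrelevant values outside.
  Translation arguments call for a Borel function on the whole space that vanishes off the
  domain.\<close>

lemma borel_representative:
  assumes "u \<in> borel_measurable M"
  obtains w where "w \<in> borel_measurable borel" "\<And>x. x \<notin> \<Omega> \<Longrightarrow> w x = (0::real)" "AE x in M. w x = u x"
proof -
  have "(\<lambda>x. if x \<in> \<Omega> then u x else 0) \<in> borel_measurable lebesgue"
    using assms by (simp add: borel_measurable_if)
  then obtain g where g: "g \<in> borel_measurable lborel" "AE x in lborel. (if x \<in> \<Omega> then u x else 0) = g x"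
    using completion_ex_borel_measurable_real by blast
  show thesis
  proof
    have [measurable]: "g \<in> borel_measurable borel" "\<Omega> \<in> sets borel" using g open_domain by auto
    show "(\<lambda>x. indicator \<Omega> x * g x) \<in> borel_measurable borel" by measurable
    have "AE x in lebesgue. (if x \<in> \<Omega> then u x else 0) = g x" using g(2) by (rule AE_completion)
    then show "AE x in M. indicator \<Omega> x * g x = u x"
      by (subst AE_restrict_space_iff) (auto elim!: eventually_mono split: if_splits)
  qed simp
qed

text \<open>If all correlations exceeded half of \<open>sq_norm lborel w\<close>, their integral
  over \<open>B\<close> would be at least \<open>2 * a * sq_norm lborel w\<close>. But over all
  shifts the correlations of \<open>\<bar>w\<bar>\<close> integrate to the squared L1 norm, which
  Cauchy-Schwarz on the support bounds by \<open>a * sq_norm lborel w\<close>.\<close>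

lemma exists_translate_small_correlation:
  fixes w :: "'a \<Rightarrow> real"
  assumes w: "sq_integrable lborel w" and a: "emeasure lborel {x. w x \<noteq> 0} = ennreal a" "a > 0"
    and S: "sq_norm lborel w > 0" and B: "B \<in> sets borel" "emeasure lborel B = ennreal (4 * a)"
  obtains y where "y \<in> B" "(LINT x|lborel. w x * w (x + y)) \<le> sq_norm lborel w / 2"
proof (rule ccontr)
  note obt = that
  assume "\<not> thesis"
  then have gt: "(LINT x|lborel. w x * w (x + y)) > sq_norm lborel w / 2" if "y \<in> B" for y
    using that obt by force
  define S where "S = sq_norm lborel w"
  have [measurable]: "w \<in> borel_measurable borel" using sq_integrable_measurable[OF w] by simp
  have [measurable]: "B \<in> sets borel" by fact
  have [measurable]: "{x. w x \<noteq> 0} \<in> sets borel" by measurable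
  have pair: "pair_sigma_finite (lborel :: 'a measure) (lborel :: 'a measure)" ..
  have "ennreal (S / 2) * ennreal (4 * a) = (\<integral>\<^sup>+ y. ennreal (S / 2) * indicator B y \<partial>lborel)"
    by (simp add: nn_integral_cmult B)
  also have "\<dots> \<le> (\<integral>\<^sup>+ y. (\<integral>\<^sup>+ x. ennreal \<bar>w x\<bar> * ennreal \<bar>w (x + y)\<bar> \<partial>lborel) \<partial>lborel)"
  proof (rule nn_integral_mono)
    fix y
    have int: "integrable lborel (\<lambda>x. w x * w (x + y))"
      using integrable_inner[OF w sq_integrable_translate(1)[OF w]] by simp
    have "ennreal (S / 2) \<le> (\<integral>\<^sup>+ x. ennreal \<bar>w x\<bar> * ennreal \<bar>w (x + y)\<bar> \<partial>lborel)" if "y \<in> B"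
    proof -
      have "S / 2 \<le> (LINT x|lborel. \<bar>w x * w (x + y)\<bar>)"
        using gt[OF that] order_trans[OF abs_ge_self integral_abs_bound[of lborel "\<lambda>x. w x * w (x + y)"]]
        unfolding S_def by linarith
      then have "ennreal (S / 2) \<le> (\<integral>\<^sup>+ x. ennreal \<bar>w x * w (x + y)\<bar> \<partial>lborel)"
        using int by (subst nn_integral_eq_integral) (auto intro: ennreal_leI)
      then show ?thesis by (simp add: abs_mult ennreal_mult)
    qed
    then show "ennreal (S / 2) * indicator B y \<le> (\<integral>\<^sup>+ x. ennreal \<bar>w x\<bar> * ennreal \<bar>w (x + y)\<bar> \<partial>lborel)"
      by (simp add: indicator_def)
  qed
  also have "\<dots> = (\<integral>\<^sup>+ x. (\<integral>\<^sup>+ y. ennreal \<bar>w x\<bar> * ennreal \<bar>w (x + y)\<bar> \<partial>lborel) \<partial>lborel)"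
    by (rule pair_sigma_finite.Fubini'[OF pair]) measurable
  also have "\<dots> = (\<integral>\<^sup>+ x. ennreal \<bar>w x\<bar> * (\<integral>\<^sup>+ y. ennreal \<bar>w y\<bar> \<partial>lborel) \<partial>lborel)"
    using nn_integral_lborel_translate[of "\<lambda>y. ennreal \<bar>w y\<bar>"] by (simp add: nn_integral_cmult add.commute)
  also have "\<dots> = (\<integral>\<^sup>+ x. ennreal \<bar>w x\<bar> \<partial>lborel)\<^sup>2"
    by (simp add: nn_integral_multc power2_eq_square)
  also have "(\<integral>\<^sup>+ x. ennreal \<bar>w x\<bar> \<partial>lborel) = (\<integral>\<^sup>+ x. ennreal \<bar>w x\<bar> * indicator {x. w x \<noteq> 0} x \<partial>lborel)"
    by (intro nn_integral_cong) (auto simp: indicator_def)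
  also have "\<dots>\<^sup>2 \<le> (\<integral>\<^sup>+ x. (ennreal \<bar>w x\<bar>)\<^sup>2 \<partial>lborel) * (\<integral>\<^sup>+ x. (indicator {x. w x \<noteq> 0} x)\<^sup>2 \<partial>lborel)"
    by (rule Cauchy_Schwarz_nn_integral) measurable
  also have "(\<integral>\<^sup>+ x. (ennreal \<bar>w x\<bar>)\<^sup>2 \<partial>lborel) = ennreal S"
    using nn_integral_eq_integral[of lborel "\<lambda>x. (w x)\<^sup>2"] w
    by (simp add: S_def sq_norm_def sq_integrable_def ennreal_power)
  also have "(\<integral>\<^sup>+ x. (indicator {x. w x \<noteq> 0} x)\<^sup>2 \<partial>lborel) = ennreal a"
    by (simp add: power2_eq_square a flip: indicator_inter_arith)
  finally have "ennreal (S / 2) * ennreal (4 * a) \<le> ennreal S * ennreal a" .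
  moreover have "ennreal (S / 2) * ennreal (4 * a) = ennreal (S / 2 * (4 * a))" "ennreal S * ennreal a = ennreal (S * a)"
    by (rule ennreal_mult[symmetric], use a S in \<open>simp_all add: S_def\<close>)+
  ultimately have "ennreal (S / 2 * (4 * a)) \<le> ennreal (S * a)" by (simp only:)
  then have "S / 2 * (4 * a) \<le> S * a" using a S by (subst (asm) ennreal_le_iff) (auto simp: S_def)
  then show False using a S by (simp add: S_def)
qed

text \<open>A ball of four times the volume of the support contains a shift \<open>y\<close> with
  correlation at most half; then the difference of \<open>w\<close> and its translate has squared
  norm at least that of \<open>w\<close>. The radius is proportional to
  \<open>a powr (1 / DIM('a))\<close> and enters through \<open>Kfun\<close> at
  \<open>(norm y)\<^sup>2\<close>, whence the exponent \<open>2 * s / DIM('a)\<close>.\<close>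

lemma Faber_Krahn:
  assumes s: "0 \<le> s" "s \<le> 1"
  obtains C where "C > 0" "\<And>w. w \<in> spectral_space \<Omega> lam \<phi> s \<Longrightarrow>
    sq_norm M w \<le> C * measure M {x \<in> space M. w x \<noteq> 0} powr (2 * s / DIM('a)) * energy s w"
proof
  define V where "V = unit_ball_vol (real DIM('a))"
  have V: "V > 0" by (simp add: V_def unit_ball_vol_pos)
  \<comment> \<open>8 comes from \<open>translate_le_Kfun\<close>, \<open>4 / V\<close> from the
    radius of a ball of volume \<open>4 * a\<close>.\<close>
  define C where "C = 8 * (4 / V) powr (2 * s / DIM('a))"
  show "C > 0" using V by (simp add: C_def)
  fix u assume u: "u \<in> spectral_space \<Omega> lam \<phi> s"
  then have usq: "sq_integrable M u" by (simp add: spectral_space_iff)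
  note um = sq_integrable_measurable[OF usq]
  obtain w where w: "w \<in> borel_measurable borel" "\<And>x. x \<notin> \<Omega> \<Longrightarrow> w x = (0::real)" "AE x in M. w x = u x"
    using borel_representative[OF um] by blast
  have wm: "w \<in> borel_measurable M" by (rule borel_measurable_domain[OF w(1)])
  have cw: "coeff w n = coeff u n" for n by (rule coeff_cong_AE[OF w(3) wm um])
  have wsq: "sq_integrable M w"
    by (rule sq_integrable_bound[OF usq wm]) (use w(3) in \<open>auto elim: eventually_mono\<close>)
  have ws: "w \<in> spectral_space \<Omega> lam \<phi> s" using u wsq by (simp add: spectral_space_iff cw)
  have en: "energy s w = energy s u" by (simp add: energy_def cw)
  have nw: "sq_norm M u = sq_norm lborel w"
    using sq_norm_cong_AE[OF um wm] w(3) sq_integrable_lborel(2)[OF w(1,2)] by (auto simp: eq_commute)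
  have wl: "sq_integrable lborel w" using wsq sq_integrable_lborel(1)[OF w(1,2)] by simp
  define a where "a = measure M {x \<in> space M. u x \<noteq> 0}"
  have [measurable]: "w \<in> borel_measurable borel" by (rule w)
  have Aset: "{x. w x \<noteq> 0} \<in> sets borel" by measurable
  have "emeasure M {x \<in> space M. u x \<noteq> 0} = emeasure M {x \<in> space M. w x \<noteq> 0}"
  proof (rule emeasure_eq_AE)
    show "AE x in M. x \<in> {x \<in> space M. u x \<noteq> 0} \<longleftrightarrow> x \<in> {x \<in> space M. w x \<noteq> 0}"
      using w(3) by (auto elim!: eventually_mono)
    show "{x \<in> space M. u x \<noteq> 0} \<in> sets M" using um by measurable
    show "{x \<in> space M. w x \<noteq> 0} \<in> sets M" using wm by measurable
  qed
  also have "{x \<in> space M. w x \<noteq> 0} = {x. w x \<noteq> 0}" using w(2) by (auto simp: space_restrict_space)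
  also have "emeasure M {x. w x \<noteq> 0} = emeasure lborel {x. w x \<noteq> 0}"
    using w(2) Aset by (subst emeasure_restrict_space) (auto simp: emeasure_completion)
  finally have a: "emeasure lborel {x. w x \<noteq> 0} = ennreal a"
    unfolding a_def by (simp add: emeasure_eq_measure)
  show "sq_norm M u \<le> C * measure M {x \<in> space M. u x \<noteq> 0} powr (2 * s / DIM('a)) * energy s u"
  proof (cases "sq_norm lborel w = 0")
    case True
    then show ?thesis using \<open>C > 0\<close> energy_nonneg[OF u] by (simp add: nw)
  next
    case False
    then have S: "sq_norm lborel w > 0" using sq_norm_nonneg[of lborel w] by linarith
    have a_pos: "a > 0"
    proof (rule ccontr)
      assume "\<not> a > 0"
      then have "a = 0" by (simp add: a_def measure_nonneg antisym_conv1 not_less)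
      then have "AE x in lborel. w x = 0" using a Aset by (intro AE_I[of _ _ "{x. w x \<noteq> 0}"]) auto
      then have "sq_norm lborel w = sq_norm lborel (\<lambda>x::'a. 0::real)" by (intro sq_norm_cong_AE) auto
      then show False using False by (simp add: sq_norm_def)
    qed
    define \<rho> where "\<rho> = (4 * a / V) powr (1 / DIM('a))"
    have \<rho>: "\<rho> > 0" using a_pos V by (simp add: \<rho>_def)
    have "\<rho> ^ DIM('a) = \<rho> powr real DIM('a)" using \<rho> by (simp add: powr_realpow)
    also have "\<dots> = 4 * a / V" using a_pos V by (simp add: \<rho>_def powr_powr)
    finally have "\<rho> ^ DIM('a) = 4 * a / V" .
    then have vol: "emeasure lborel (ball (0::'a) \<rho>) = ennreal (4 * a)"
      using \<rho> V by (simp add: emeasure_ball V_def[symmetric])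
    obtain y where y: "y \<in> ball 0 \<rho>" "(LINT x|lborel. w x * w (x + y)) \<le> sq_norm lborel w / 2"
      using exists_translate_small_correlation[OF wl a a_pos S _ vol] by auto
    \<comment> \<open>At \<open>y = 0\<close> the correlation would be the full squared norm;
      \<open>Kfun\<close> is to be used at a positive parameter.\<close>
    have "y \<noteq> 0"
    proof
      assume "y = 0"
      then have "(LINT x|lborel. w x * w (x + y)) = sq_norm lborel w" by (simp add: sq_norm_def power2_eq_square)
      then show False using y(2) S by simp
    qed
    have "sq_norm lborel w \<le> 2 * sq_norm lborel w - 2 * (LINT x|lborel. w x * w (x + y))" using y(2) by simp
    also have "\<dots> = sq_norm lborel (\<lambda>x. w (x + y) - w x)"
      using sq_norm_diff[OF sq_integrable_translate(1)[OF wl] wl, of y] sq_integrable_translate(2)[OF wl, of y]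
      by (simp add: mult.commute)
    also have "\<dots> \<le> 8 * Kfun ((norm y)\<^sup>2) w" by (rule translate_le_Kfun[OF w(1,2) wsq \<open>y \<noteq> 0\<close>])
    also have "\<dots> \<le> 8 * (((norm y)\<^sup>2) powr s * energy s w)"
      using Kfun_le_energy[OF s ws, of "(norm y)\<^sup>2"] \<open>y \<noteq> 0\<close> by simp
    also have "\<dots> \<le> 8 * ((\<rho>\<^sup>2) powr s * energy s w)"
      using y(1) energy_nonneg[OF ws] s by (intro mult_left_mono mult_right_mono powr_mono2 power_mono) auto
    also have "8 * (\<rho>\<^sup>2) powr s = C * a powr (2 * s / DIM('a))"
    proof -
      have "(\<rho>\<^sup>2) powr s = \<rho> powr (2 * s)" using \<rho> by (simp add: powr_powr flip: powr_numeral)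
      also have "\<dots> = (4 / V * a) powr (2 * s / DIM('a))" by (simp add: \<rho>_def powr_powr)
      also have "\<dots> = (4 / V) powr (2 * s / DIM('a)) * a powr (2 * s / DIM('a))"
        using V a_pos by (subst powr_mult) auto
      finally show ?thesis by (simp add: C_def)
    qed
    then have "8 * ((\<rho>\<^sup>2) powr s * energy s w) = C * a powr (2 * s / DIM('a)) * energy s w" by simp
    finally show ?thesis unfolding nw en a_def[symmetric] .
  qed
qed

end

section \<open>Boundedness\<close>

text \<open>On levels whose gaps halve on the way to \<open>d\<close>, the superlinear power of
  \<open>m k\<close> beats the growth of the inverse squared gaps, so \<open>m\<close> decays
  geometrically along them; monotonicity transfers this to \<open>m d\<close>.\<close>

lemma Stampacchia:
  fixes m :: "real \<Rightarrow> real"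
  assumes antimono: "\<And>h k. 0 \<le> k \<Longrightarrow> k \<le> h \<Longrightarrow> m h \<le> m k" and nonneg: "\<And>k. 0 \<le> m k"
    and \<gamma>: "\<gamma> > 1" and "C > 0"
    and decay: "\<And>h k. 0 \<le> k \<Longrightarrow> k < h \<Longrightarrow> (h - k)\<^sup>2 * m h \<le> C * m k powr \<gamma>"
  obtains d where "d > 0" "m d = 0"
proof (cases "m 0 = 0")
  case True
  then have "m 1 = 0" using antimono[of 0 1] nonneg[of 1] by simp
  then show thesis using that[of 1] by simp
next
  case False
  then have m0: "m 0 > 0" using nonneg[of 0] by linarith
  \<comment> \<open>Chosen with \<open>\<theta> powr (\<gamma> - 1) = 1 / 4\<close>, so that the
    gain over the linear power cancels the quartering of the squared gap from level to
    level.\<close>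
  define \<theta> where "\<theta> = 4 powr (- (1 / (\<gamma> - 1)))"
  have \<theta>: "0 < \<theta>" "\<theta> < 1"
  proof -
    show "0 < \<theta>" by (simp add: \<theta>_def)
    have "4 powr (- (1 / (\<gamma> - 1))) < 4 powr (0 :: real)" using \<gamma> by (intro powr_less_mono) auto
    then show "\<theta> < 1" by (simp add: \<theta>_def)
  qed
  have \<theta>\<gamma>: "\<theta> powr \<gamma> = \<theta> / 4"
  proof -
    have "\<theta> powr (\<gamma> - 1) = 4 powr (- 1)" using \<gamma> by (simp add: \<theta>_def powr_powr)
    then have "\<theta> powr (\<gamma> - 1) = 1 / 4" by (simp add: powr_minus_divide)
    then show ?thesis using \<theta> powr_add[of \<theta> 1 "\<gamma> - 1"] by simp
  qed
  \<comment> \<open>Solves \<open>\<theta> * d\<^sup>2 = 4 * C * m 0 powr (\<gamma> - 1)\<close>,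
    which is what closes the induction from one level to the next.\<close>
  define d where "d = sqrt (4 * C * m 0 powr (\<gamma> - 1) / \<theta>)"
  have d: "d > 0" using \<open>C > 0\<close> m0 \<theta> by (simp add: d_def)
  have d2: "\<theta> * d\<^sup>2 = 4 * C * m 0 powr (\<gamma> - 1)" using \<open>C > 0\<close> \<theta> by (simp add: d_def)
  define k where "k n = d * (1 - (1/2) ^ n)" for n :: nat
  have k: "0 \<le> k n" "k n < k (Suc n)" "k n \<le> d" "k (Suc n) - k n = d * (1/2) ^ Suc n" for n
  proof -
    have *: "(1/2 :: real) ^ n \<le> 1" by (simp add: power_le_one)
    have "d * (1 - (1/2) ^ n) \<le> d * 1" using d by (intro mult_left_mono) auto
    then show "0 \<le> k n" "k n < k (Suc n)" "k n \<le> d" "k (Suc n) - k n = d * (1/2) ^ Suc n"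
      using d * by (auto simp: k_def algebra_simps)
  qed
  have geom: "m (k n) \<le> m 0 * \<theta> ^ n" for n
  proof (induction n)
    case 0
    then show ?case by (simp add: k_def)
  next
    case (Suc n)
    have pos: "(k (Suc n) - k n)\<^sup>2 > 0" using k(2)[of n] by simp
    have "(k (Suc n) - k n)\<^sup>2 * m (k (Suc n)) \<le> C * m (k n) powr \<gamma>"
      using decay k by blast
    also have "\<dots> \<le> C * (m 0 * \<theta> ^ n) powr \<gamma>"
      using Suc nonneg \<open>C > 0\<close> \<gamma> by (intro mult_left_mono powr_mono2) auto
    also have "(m 0 * \<theta> ^ n) powr \<gamma> = m 0 powr \<gamma> * (\<theta> / 4) ^ n"
    proof -
      have "(\<theta> ^ n) powr \<gamma> = (\<theta> powr \<gamma>) ^ n"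
        using \<theta> by (simp add: powr_powr mult.commute flip: powr_realpow)
      then show ?thesis using m0 \<theta> by (simp add: powr_mult \<theta>\<gamma>)
    qed
    also have "m 0 powr \<gamma> = m 0 * m 0 powr (\<gamma> - 1)" using m0 powr_add[of "m 0" 1 "\<gamma> - 1"] by simp
    also have "C * (m 0 * m 0 powr (\<gamma> - 1) * (\<theta> / 4) ^ n) = (k (Suc n) - k n)\<^sup>2 * (m 0 * \<theta> ^ Suc n)"
    proof -
      have "(k (Suc n) - k n)\<^sup>2 = d\<^sup>2 * (1 / 4) ^ Suc n"
        unfolding k(4) by (simp add: power_mult_distrib power2_eq_square flip: power_mult_distrib)
      moreover have "C * m 0 powr (\<gamma> - 1) = \<theta> * d\<^sup>2 / 4" using d2 by simp
      then have "C * (m 0 * m 0 powr (\<gamma> - 1) * (\<theta> / 4) ^ n) = \<theta> * d\<^sup>2 / 4 * m 0 * (\<theta> / 4) ^ n"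
        by (simp add: mult_ac)
      ultimately show ?thesis by (simp add: power_divide)
    qed
    finally show ?case using pos by (simp add: mult_le_cancel_left)
  qed
  have "(\<lambda>n. m 0 * \<theta> ^ n) \<longlonglongrightarrow> m 0 * 0"
    using \<theta> by (intro tendsto_mult tendsto_const LIMSEQ_power_zero) auto
  moreover have "m d \<le> m 0 * \<theta> ^ n" for n
    using antimono[OF k(1,3)[of n]] geom[of n] by linarith
  ultimately have "m d \<le> m 0 * 0" by (intro LIMSEQ_le_const) auto
  then show thesis using that[of d] d nonneg[of d] by simp
qed

section \<open>Truncation and the energy of the excess\<close>

definition truncate :: "real \<Rightarrow> real \<Rightarrow> real" where
  "truncate k t = max (- k) (min k t)"

lemma truncate_lipschitz: "\<bar>truncate k x - truncate k y\<bar> \<le> 1 * \<bar>x - y\<bar>"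
  unfolding truncate_def max_def min_def by (smt (verit))

lemma excess_lipschitz: "\<bar>(x - truncate k x) - (y - truncate k y)\<bar> \<le> 1 * \<bar>x - y\<bar>"
  unfolding truncate_def max_def min_def by (smt (verit))

text \<open>For nonnegative \<open>k\<close> the map folds the line at \<open>- k\<close> and
  \<open>k\<close>; its slopes are 1 and -1.\<close>

lemma reflection_lipschitz: "\<bar>(x - 2 * (x - truncate k x)) - (y - 2 * (y - truncate k y))\<bar> \<le> 1 * \<bar>x - y\<bar>"
  unfolding truncate_def max_def min_def by (smt (verit))

lemma truncate_zero: "0 \<le> k \<Longrightarrow> truncate k 0 = 0"
  by (simp add: truncate_def)

lemma abs_excess: "0 \<le> k \<Longrightarrow> \<bar>t - truncate k t\<bar> = max 0 (\<bar>t\<bar> - k)"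
  unfolding truncate_def max_def min_def by (smt (verit))

lemma excess_eq_0_iff: "0 \<le> k \<Longrightarrow> t - truncate k t = 0 \<longleftrightarrow> \<bar>t\<bar> \<le> k"
  unfolding truncate_def max_def min_def by (smt (verit))

context dirichlet_system
begin

definition energy_form :: "real \<Rightarrow> ('a \<Rightarrow> real) \<Rightarrow> ('a \<Rightarrow> real) \<Rightarrow> real" where
  "energy_form r u v = (\<Sum>n. lam n powr r * (coeff u n * coeff v n))"

lemma energy_form_summable:
  assumes "u \<in> spectral_space \<Omega> lam \<phi> s" "v \<in> spectral_space \<Omega> lam \<phi> s"
  shows "summable (\<lambda>n. lam n powr s * (coeff u n * coeff v n))"
  using energy_form_sums[OF assms] by (rule sums_summable)

text \<open>The reflection \<open>t \<mapsto> 2 * truncate k t - t\<close> is a contraction; expanding its energy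
  compares the excess of \<open>u\<close> over the level \<open>k\<close> with \<open>u\<close>.\<close>

lemma energy_excess:
  assumes s: "0 < s" "s < 1" and u: "u \<in> spectral_space \<Omega> lam \<phi> s" and k: "0 \<le> k"
  defines "w \<equiv> \<lambda>x. u x - truncate k (u x)"
  shows "w \<in> spectral_space \<Omega> lam \<phi> s" "energy s w \<le> energy_form s u w"
proof -
  show w: "w \<in> spectral_space \<Omega> lam \<phi> s"
    unfolding w_def by (rule lipschitz_compose_spectral_space[OF s u excess_lipschitz]) (simp add: truncate_zero k)
  have usq: "sq_integrable M u" and wsq: "sq_integrable M w" using u w by (simp_all add: spectral_space_iff)
  have le: "energy s (\<lambda>x. u x - 2 * w x) \<le> energy s u"
    using energy_lipschitz_compose[OF s u reflection_lipschitz[of _ k]] by (simp add: truncate_zero k w_def)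
  have c: "coeff (\<lambda>x. u x - 2 * w x) n = coeff u n - 2 * coeff w n" for n
    using coeff_diff[OF usq sq_integrable_cmult[OF wsq]] by (simp add: coeff_cmult)
  have sums: "(\<lambda>n. lam n powr s * (coeff u n)\<^sup>2) sums energy s u" "(\<lambda>n. lam n powr s * (coeff w n)\<^sup>2) sums energy s w"
    "(\<lambda>n. lam n powr s * (coeff u n * coeff w n)) sums energy_form s u w"
    using u w energy_form_summable[OF u w] by (simp_all add: energy_def energy_form_def spectral_space_iff summable_sums)
  have "(\<lambda>n. lam n powr s * (coeff u n)\<^sup>2 - 4 * (lam n powr s * (coeff u n * coeff w n)) + 4 * (lam n powr s * (coeff w n)\<^sup>2))
    sums (energy s u - 4 * energy_form s u w + 4 * energy s w)"
    by (intro sums_add sums_diff sums_mult sums)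
  also have "(\<lambda>n. lam n powr s * (coeff u n)\<^sup>2 - 4 * (lam n powr s * (coeff u n * coeff w n)) + 4 * (lam n powr s * (coeff w n)\<^sup>2))
    = (\<lambda>n. lam n powr s * (coeff (\<lambda>x. u x - 2 * w x) n)\<^sup>2)"
    unfolding c by (simp add: power2_eq_square algebra_simps)
  finally have "energy s (\<lambda>x. u x - 2 * w x) = energy s u - 4 * energy_form s u w + 4 * energy s w"
    unfolding energy_def by (simp add: sums_iff)
  with le show "energy s w \<le> energy_form s u w" by simp
qed

text \<open>Let \<open>S\<close> and \<open>Q\<close> be the squared norms of the excess and of
  \<open>g\<close> on the set where the excess is not 0. Cauchy-Schwarz bounds the energy of the
  excess by \<open>sqrt (Q * S)\<close>, Faber-Krahn gives \<open>S \<le> D * sqrt (Q * S)\<close>,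
  and cancelling yields \<open>S \<le> D\<^sup>2 * Q\<close>. Both \<open>D\<close> and the bound on
  \<open>Q\<close> are powers of \<open>m k\<close> up to constants, as \<open>Stampacchia\<close>
  requires.\<close>

lemma bounded_if_excess_dominated:
  assumes s: "0 < s" "s < 1" and u: "u \<in> spectral_space \<Omega> lam \<phi> s"
    and g: "sq_integrable M g" "integrable M (\<lambda>x. \<bar>g x\<bar> powr p)" and p: "p \<ge> 2" "p > DIM('a) / (2 * s)"
    and dom: "\<And>k. 0 \<le> k \<Longrightarrow> energy_form s u (\<lambda>x. u x - truncate k (u x)) \<le> (LINT x|M. g x * (u x - truncate k (u x)))"
  obtains d where "d > 0" "AE x in M. \<bar>u x\<bar> \<le> d"
proof -
  define N where "N = real DIM('a)"
  have N: "N > 0" by (simp add: N_def)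
  obtain C where C: "C > 0" "\<And>w. w \<in> spectral_space \<Omega> lam \<phi> s \<Longrightarrow>
    sq_norm M w \<le> C * measure M {x \<in> space M. w x \<noteq> 0} powr (2 * s / N) * energy s w"
    using Faber_Krahn[OF less_imp_le[OF s(1)] less_imp_le[OF s(2)]] unfolding N_def by blast
  have usq: "sq_integrable M u" using u by (simp add: spectral_space_iff)
  have um [measurable]: "u \<in> borel_measurable M" by (rule sq_integrable_measurable[OF usq])
  have gm [measurable]: "g \<in> borel_measurable M" by (rule sq_integrable_measurable[OF g(1)])
  define A where "A k = {x \<in> space M. \<bar>u x\<bar> > k}" for k
  have [measurable]: "A k \<in> sets M" for k unfolding A_def by measurable
  have [simp]: "A k \<inter> \<Omega> = A k" for k by (auto simp: A_def space_restrict_space)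
  define m where "m k = measure M (A k)" for k
  define G where "G = (LINT x|M. \<bar>g x\<bar> powr p)"
  have G: "G \<ge> 0" by (simp add: G_def)
  \<comment> \<open>Twice the Faber-Krahn exponent plus the exponent \<open>1 - 2 / p\<close> from
    the bound on \<open>g\<close>; it exceeds 1 precisely when
    \<open>p > N / (2 * s)\<close>.\<close>
  define \<gamma> where "\<gamma> = 4 * s / N + 1 - 2 / p"
  have "\<gamma> > 1"
  proof -
    have "N < p * (2 * s)" using p s by (simp add: N_def divide_less_eq)
    then have "2 / p < 4 * s / N" using N p by (simp add: field_simps)
    then show ?thesis by (simp add: \<gamma>_def)
  qed
  have G2: "sq_norm M (\<lambda>x. g x * indicator (A k) x) \<le> m k powr (1 - 2 / p) * (1 + G)" if "m k > 0" for k
  proof -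
    \<comment> \<open>Splitting \<open>g\<close> at height \<open>\<kappa>\<close> replaces
      Hoelder's inequality. At this height both parts scale like
      \<open>m k powr (1 - 2 / p)\<close>; the part above uses \<open>p \<ge> 2\<close>.\<close>
    define \<kappa> where "\<kappa> = m k powr (- (1 / p))"
    have \<kappa>: "\<kappa> > 0" using that by (simp add: \<kappa>_def)
    have pt: "(norm (g x * indicator (A k) x))\<^sup>2 \<le> \<kappa>\<^sup>2 * indicator (A k) x + \<kappa> powr (2 - p) * \<bar>g x\<bar> powr p" for x
    proof (cases "\<bar>g x\<bar> \<le> \<kappa>")
      case True
      then have "(g x)\<^sup>2 \<le> \<kappa>\<^sup>2" using power_mono[OF True, of 2] by simp
      then show ?thesis by (auto simp: indicator_def add_increasing2)
    next
      case False
      then have gx: "\<bar>g x\<bar> > 0" using \<kappa> by simp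
      have "(g x)\<^sup>2 = \<bar>g x\<bar> powr (2 - p) * \<bar>g x\<bar> powr p"
        using gx by (simp add: powr_add[symmetric])
      also have "\<dots> \<le> \<kappa> powr (2 - p) * \<bar>g x\<bar> powr p"
        using False \<kappa> p by (intro mult_right_mono powr_mono2') auto
      finally show ?thesis by (auto simp: indicator_def intro: order_trans)
    qed
    have "sq_norm M (\<lambda>x. g x * indicator (A k) x) \<le> (LINT x|M. \<kappa>\<^sup>2 * indicator (A k) x + \<kappa> powr (2 - p) * \<bar>g x\<bar> powr p)"
      unfolding sq_norm_def
    proof (rule integral_mono)
      show "integrable M (\<lambda>x. (norm (g x * indicator (A k) x))\<^sup>2)"
        using sq_integrable_bound[OF g(1), of "\<lambda>x. g x * indicator (A k) x"]
        by (simp add: sq_integrable_def indicator_def)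
      show "integrable M (\<lambda>x. \<kappa>\<^sup>2 * indicator (A k) x + \<kappa> powr (2 - p) * \<bar>g x\<bar> powr p)"
        using g(2) by (auto intro!: integrable_real_indicator simp: less_top[symmetric])
    qed (rule pt)
    also have "\<dots> = \<kappa>\<^sup>2 * m k + \<kappa> powr (2 - p) * G"
      using g(2) by (subst Bochner_Integration.integral_add) (auto simp: m_def G_def less_top[symmetric])
    also have "\<kappa>\<^sup>2 * m k = m k powr (1 - 2 / p)"
    proof -
      have "\<kappa>\<^sup>2 = m k powr (- 2 / p)" using that by (simp add: \<kappa>_def powr_powr flip: powr_numeral)
      then show ?thesis using that powr_add[of "m k" "- 2 / p" 1] by simp
    qed
    also have "\<kappa> powr (2 - p) = m k powr (1 - 2 / p)"
      using that p by (simp add: \<kappa>_def powr_powr diff_divide_distrib)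
    finally show ?thesis by (simp add: algebra_simps)
  qed
  have decay: "(h - k)\<^sup>2 * m h \<le> C\<^sup>2 * (1 + G) * m k powr \<gamma>" if k: "0 \<le> k" "k < h" for h k
  proof -
    define w where "w x = u x - truncate k (u x)" for x
    have ws: "w \<in> spectral_space \<Omega> lam \<phi> s" and le: "energy s w \<le> (LINT x|M. g x * w x)"
      using energy_excess[OF s u k(1)] dom[OF k(1)] by (auto simp: w_def[abs_def])
    have wsq: "sq_integrable M w" using ws by (simp add: spectral_space_iff)
    have wm [measurable]: "w \<in> borel_measurable M" by (rule sq_integrable_measurable[OF wsq])
    have w0: "w x = 0 \<longleftrightarrow> \<bar>u x\<bar> \<le> k" for x unfolding w_def by (rule excess_eq_0_iff[OF k(1)])
    have Aw: "{x \<in> space M. w x \<noteq> 0} = A k" by (auto simp: w0 A_def)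
    have gA: "sq_integrable M (\<lambda>x. g x * indicator (A k) x)"
      by (rule sq_integrable_bound[OF g(1)]) (auto simp: indicator_def)
    define S where "S = sq_norm M w"
    define Q where "Q = sq_norm M (\<lambda>x. g x * indicator (A k) x)"
    define D where "D = C * m k powr (2 * s / N)"
    have D: "D \<ge> 0" using C(1) by (simp add: D_def)
    have "(LINT x|M. g x * w x) = (LINT x|M. (g x * indicator (A k) x) \<bullet> w x)"
      by (intro Bochner_Integration.integral_cong) (auto simp: indicator_def A_def w0 not_less)
    also have "\<dots> \<le> sqrt (Q * S)"
      unfolding Q_def S_def by (rule real_le_rsqrt[OF Cauchy_Schwarz_integral[OF gA wsq]])
    finally have "energy s w \<le> sqrt (Q * S)" using le by simp
    then have "D * energy s w \<le> D * sqrt (Q * S)" using D by (rule mult_left_mono)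
    moreover have "S \<le> D * energy s w" using C(2)[OF ws] unfolding S_def D_def m_def Aw .
    ultimately have "S \<le> D * sqrt (Q * S)" by linarith
    then have "S\<^sup>2 \<le> (D * sqrt (Q * S))\<^sup>2" by (intro power_mono) (simp_all add: S_def)
    also have "\<dots> = D\<^sup>2 * Q * S" by (simp add: power_mult_distrib Q_def S_def)
    finally have "S * S \<le> D\<^sup>2 * Q * S" by (simp add: power2_eq_square)
    then have S: "S \<le> D\<^sup>2 * Q"
    proof (cases "S = 0")
      case True
      then show ?thesis by (simp add: Q_def)
    next
      case False
      then have "S > 0" using sq_norm_nonneg[of M w] unfolding S_def by linarith
      with \<open>S * S \<le> _\<close> show ?thesis by simp
    qed
    have "S \<le> C\<^sup>2 * (1 + G) * m k powr \<gamma>"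
    proof (cases "m k > 0")
      case True
      have D2: "D\<^sup>2 = C\<^sup>2 * m k powr (4 * s / N)"
        using True by (simp add: D_def power_mult_distrib powr_powr flip: powr_numeral)
      have pw: "m k powr (4 * s / N) * m k powr (1 - 2 / p) = m k powr \<gamma>"
        by (simp add: \<gamma>_def powr_add[symmetric] add_diff_eq)
      note S
      also have "D\<^sup>2 * Q \<le> D\<^sup>2 * (m k powr (1 - 2 / p) * (1 + G))"
        unfolding Q_def by (intro mult_left_mono G2 True) simp
      also have "\<dots> = C\<^sup>2 * (1 + G) * (m k powr (4 * s / N) * m k powr (1 - 2 / p))"
        by (simp add: D2 mult_ac)
      finally show ?thesis unfolding pw .
    next
      case False
      then have "m k = 0" by (simp add: m_def measure_nonneg antisym_conv1 not_less zero_less_measure_iff)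
      \<comment> \<open>Here \<open>0 powr x = 0\<close> makes \<open>D\<close>, hence
        \<open>S\<close>, vanish.\<close>
      then show ?thesis using S by (simp add: D_def)
    qed
    \<comment> \<open>Chebyshev: on \<open>A h\<close> the excess over \<open>k\<close> is at least
      \<open>h - k\<close>.\<close>
    moreover have "(h - k)\<^sup>2 * m h \<le> S"
    proof -
      have "(h - k)\<^sup>2 * m h = (h - k)\<^sup>2 * sq_norm M (\<lambda>x. indicator (A h) x :: real)"
      proof -
        have "(norm (indicator (A h) x :: real))\<^sup>2 = indicator (A h) x" for x by (simp add: indicator_def)
        then show ?thesis by (simp add: sq_norm_def m_def)
      qed
      also have "\<dots> = sq_norm M (\<lambda>x. (h - k) * indicator (A h) x)" by simp
      also have "\<dots> \<le> S"
        unfolding S_def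
      proof (rule sq_norm_mono[OF wsq], intro AE_I2)
        fix x
        have "\<bar>w x\<bar> = max 0 (\<bar>u x\<bar> - k)" unfolding w_def by (rule abs_excess[OF k(1)])
        then show "norm ((h - k) * indicator (A h) x) \<le> norm (w x)"
          using k by (auto simp: indicator_def A_def)
      qed
      finally show ?thesis .
    qed
    ultimately show ?thesis by linarith
  qed
  obtain d where d: "d > 0" "m d = 0"
  proof (rule Stampacchia[OF _ _ \<open>\<gamma> > 1\<close> _ decay])
    show "m h \<le> m k" if "0 \<le> k" "k \<le> h" for h k
      unfolding m_def
    proof (rule finite_measure_mono)
      show "A h \<subseteq> A k" using that by (auto simp: A_def)
    qed measurable
    show "0 < C\<^sup>2 * (1 + G)" using C G by simp
  qed (auto simp: m_def)
  have "emeasure M (A d) = 0" using d(2) by (simp add: m_def emeasure_eq_measure)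
  then have "AE x in M. x \<notin> A d" by (intro AE_not_in) (simp add: null_sets_def)
  then have "AE x in M. \<bar>u x\<bar> \<le> d" using AE_space by eventually_elim (auto simp: A_def)
  with d(1) show thesis by (rule that)
qed

text \<open>If \<open>DIM('a) / (2 * s) < 2\<close>, membership in L2 supplies the exponent 2.
  Otherwise the dimension is at least \<open>4 * s\<close>, hence above \<open>2 * s\<close>, and
  the condition on \<open>p\<close> applies; for infinite \<open>p\<close>, a bounded function on a
  set of finite measure is integrable to every power.\<close>

lemma Lp_space_exponent:
  assumes g: "g \<in> L2_space \<Omega> \<inter> Lp_space \<Omega> p" and s: "0 < s"
    and p: "real DIM('a) > 2 * s \<longrightarrow> p > ereal (real DIM('a) / (2 * s))"
  obtains q where "q \<ge> 2" "q > DIM('a) / (2 * s)" "integrable M (\<lambda>x. \<bar>g x\<bar> powr q)"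
proof (cases "DIM('a) / (2 * s) < 2")
  case True
  have "integrable M (\<lambda>x. \<bar>g x\<bar> powr 2)" using g by (simp add: L2_space_def)
  then show thesis using that[of 2] True by simp
next
  case False
  then have gt: "real DIM('a) > 2 * s" using s by (simp add: field_simps)
  with p have p: "p > ereal (real DIM('a) / (2 * s))" by simp
  show thesis
  proof (cases p)
    case (real r)
    then show thesis using p g False that[of r] by (auto simp: Lp_space_def)
  next
    case PInf
    then obtain B where B: "AE x in M. \<bar>g x\<bar> \<le> B" using g by (auto simp: Lp_space_def)
    define q where "q = DIM('a) / (2 * s) + 1"
    have q: "q \<ge> 2" using False by (simp add: q_def)
    have gm [measurable]: "g \<in> borel_measurable M" using g by (simp add: L2_space_def)
    have "integrable M (\<lambda>x. \<bar>g x\<bar> powr q)"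
    proof (rule integrable_const_bound[where B="\<bar>B\<bar> powr q"])
      show "AE x in M. norm (\<bar>g x\<bar> powr q) \<le> \<bar>B\<bar> powr q"
        using B
      proof eventually_elim
        case (elim x)
        have "\<bar>g x\<bar> powr q \<le> \<bar>B\<bar> powr q" using elim q by (intro powr_mono2) auto
        then show ?case by simp
      qed
    qed measurable
    then show thesis using that[of q] q by (simp add: q_def)
  next
    case MInf
    then show thesis using p by simp
  qed
qed

end

section \<open>Regularity\<close>

text \<open>For negative \<open>t\<close> the interval is empty and the integral 0, which extends
  monotonicity to the whole line. Monotone functions are Borel, and this supplies the measurability
  of the primitive.\<close>

lemma mono_primitive:
  fixes f0 :: "real \<Rightarrow> real"
  assumes "continuous_on UNIV f0" "mono f0" "f0 0 = 0"
  shows "mono (\<lambda>t. integral {0..t} f0)" "0 \<le> integral {0..t} f0"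
proof -
  have int: "f0 integrable_on {0..t}" for t
    by (rule integrable_continuous_interval) (rule continuous_on_subset[OF assms(1) subset_UNIV])
  have nn: "0 \<le> f0 x" if "0 \<le> x" for x using monoD[OF assms(2) that] assms(3) by simp
  show "mono (\<lambda>t. integral {0..t} f0)"
    by (intro monoI integral_subset_le int) (auto intro: nn)
  show "0 \<le> integral {0..t} f0"
    by (intro integral_nonneg int) (auto intro: nn)
qed

section \<open>Reduction to a nonlinearity independent of \<open>x\<close>\<close>

context dirichlet_system
begin

text \<open>The domain carries a function of norm 1, so it is not a null set. This allows points to
  be picked from sets of full measure.\<close>

lemma AE_not_False: "\<not> (AE x in M. False)"
proof
  assume "AE x in M. False"
  then have "AE x in M. \<phi> 0 x = 0" by eventually_elim simp
  then have "sq_norm M (\<phi> 0) = sq_norm M (\<lambda>x::'a. 0::real)"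
    by (intro sq_norm_cong_AE sq_integrable_measurable eigenfunction_L2) auto
  then show False
    using orthonormal[of 0 0] by (simp add: sq_norm_def L2_inner_def power2_eq_square)
qed

lemma AE_witness:
  assumes "AE x in M. P x" obtains x where "P x"
proof (rule ccontr)
  note witness = that
  assume "\<not> thesis"
  from assms have "AE x in M. False"
  proof eventually_elim
    case (elim x)
    with witness \<open>\<not> thesis\<close> show ?case by blast
  qed
  with AE_not_False show False by blast
qed

text \<open>Holds by completeness of Lebesgue measure. It makes \<open>f x (u x)\<close> measurable,
  although \<open>f\<close> is assumed measurable in \<open>x\<close> only for each fixed second
  argument.\<close>

lemma borel_measurable_AE_cong:
  fixes h h' :: "'a \<Rightarrow> real"
  assumes h: "h \<in> borel_measurable M" and eq: "AE x in M. h x = h' x"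
  shows "h' \<in> borel_measurable M"
proof -
  obtain N where N: "{x \<in> space M. \<not> h x = h' x} \<subseteq> N" "emeasure M N = 0" "N \<in> sets M"
    by (rule AE_E[OF eq]) blast
  then have null: "N \<in> null_sets M" by (simp add: null_sets_def)
  have "h \<in> borel_measurable (lebesgue_on (\<Omega> - N))"
    using h borel_measurable_diff_null[OF null domain_sets] by blast
  then have "h' \<in> borel_measurable (lebesgue_on (\<Omega> - N))"
    by (rule measurable_cong[THEN iffD1, rotated]) (use N(1) in \<open>auto simp: space_restrict_space\<close>)
  then show ?thesis using borel_measurable_diff_null[OF null domain_sets] by blast
qed

lemma autonomous_nonlinearity:
  assumes str: "structural_condition \<Omega> f" and lip: "local_lipschitz_condition \<Omega> f"
  obtains f0 where "AE x in M. f x = f0" "f0 0 = 0" "mono f0" "continuous_on UNIV f0"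
    "\<And>K. K > 0 \<Longrightarrow> \<exists>L>0. \<forall>a b. \<bar>a\<bar> \<le> K \<and> \<bar>b\<bar> \<le> K \<longrightarrow> \<bar>f0 a - f0 b\<bar> \<le> L * \<bar>a - b\<bar>"
proof -
  define P where "P K L x y \<longleftrightarrow> (\<forall>u1 u2. \<bar>u1\<bar> \<le> K \<and> \<bar>u2\<bar> \<le> K \<longrightarrow> \<bar>f x u1 - f y u2\<bar> \<le> L * \<bar>u1 - u2\<bar>)" for K L :: real and x y
  have "\<exists>L>0. AE x in M. AE y in M. P (real (Suc n)) L x y" for n
    using lip[unfolded local_lipschitz_condition_def, rule_format, of "real (Suc n)"] by (simp add: P_def)
  then obtain L where L: "\<And>n. L n > 0" "\<And>n. AE x in M. AE y in M. P (real (Suc n)) (L n) x y" by metis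
  \<comment> \<open>Countably many radii, so that one exceptional null set serves them all and a
    single \<open>x0\<close> can be chosen.\<close>
  have "AE x in M. \<forall>n. AE y in M. P (real (Suc n)) (L n) x y"
    using L(2) by (simp add: AE_all_countable)
  moreover have "AE x in M. strict_mono (f x) \<and> continuous_on UNIV (f x) \<and> f x 0 = 0"
    using str unfolding structural_condition_def by (auto elim: eventually_mono)
  ultimately have "AE x in M. (\<forall>n. AE y in M. P (real (Suc n)) (L n) x y) \<and> strict_mono (f x) \<and> continuous_on UNIV (f x) \<and> f x 0 = 0"
    by eventually_elim blast
  then obtain x0 where x0: "\<And>n. AE y in M. P (real (Suc n)) (L n) x0 y" "strict_mono (f x0)"
    "continuous_on UNIV (f x0)" "f x0 0 = 0"
    by (rule AE_witness) blast
  have all: "AE y in M. \<forall>n. P (real (Suc n)) (L n) x0 y"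
    using x0(1) by (simp add: AE_all_countable)
  have ae: "AE y in M. f y = f x0"
    using all
  proof eventually_elim
    case (elim y)
    show ?case
    proof
      fix t
      obtain n where "\<bar>t\<bar> \<le> real n" using real_arch_simple by blast
      then have "\<bar>t\<bar> \<le> real (Suc n)" by simp
      moreover have "P (real (Suc n)) (L n) x0 y" using elim by blast
      ultimately have "\<bar>f x0 t - f y t\<bar> \<le> L n * \<bar>t - t\<bar>" unfolding P_def by blast
      then show "f y t = f x0 t" by simp
    qed
  qed
  \<comment> \<open>A second point \<open>y\<close> at which \<open>f y\<close> and
    \<open>f x0\<close> coincide turns the bound between two points into a Lipschitz bound for
    \<open>f x0\<close> alone.\<close>
  from all ae have "AE y in M. (\<forall>n. P (real (Suc n)) (L n) x0 y) \<and> f y = f x0" by eventually_elim blast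
  then obtain y where y: "\<And>n. P (real (Suc n)) (L n) x0 y" "f y = f x0" by (rule AE_witness) blast
  show thesis
  proof (rule that[OF ae x0(4) strict_mono_mono[OF x0(2)] x0(3)])
    fix K :: real assume "K > 0"
    obtain n where n: "K \<le> real n" using real_arch_simple by blast
    have "\<bar>f x0 a - f x0 b\<bar> \<le> L n * \<bar>a - b\<bar>" if "\<bar>a\<bar> \<le> K" "\<bar>b\<bar> \<le> K" for a b
    proof -
      have "\<bar>a\<bar> \<le> real (Suc n)" "\<bar>b\<bar> \<le> real (Suc n)" using that n by auto
      then show ?thesis using y(1)[of n] unfolding P_def y(2) by blast
    qed
    then show "\<exists>L>0. \<forall>a b. \<bar>a\<bar> \<le> K \<and> \<bar>b\<bar> \<le> K \<longrightarrow> \<bar>f x0 a - f x0 b\<bar> \<le> L * \<bar>a - b\<bar>"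
      using L(1) by blast
  qed
qed

text \<open>Membership is reduced to an integrable majorant: the primitive at \<open>u\<close>
  itself for the excess of \<open>u\<close>, a constant for test functions.\<close>

lemma orlicz_space_bounded_by:
  assumes f0: "AE x in M. f x = f0" "f0 0 = 0" "mono f0" "continuous_on UNIV f0"
    and v: "v \<in> borel_measurable M" and B: "integrable M B" "AE x in M. integral {0..\<bar>v x\<bar>} f0 \<le> B x"
  shows "v \<in> orlicz_space \<Omega> f"
proof -
  have [measurable]: "(\<lambda>t. integral {0..t} f0) \<in> borel_measurable borel"
    by (rule borel_measurable_mono[OF mono_primitive(1)[OF f0(4,3,2)]])
  have m: "(\<lambda>x. integral {0..\<bar>v x\<bar>} f0) \<in> borel_measurable M"
    using v by measurable
  have ae: "AE x in M. integral {0..\<bar>v x\<bar>} f0 = primitive_of f x (v x)"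
    using f0(1) by eventually_elim (simp add: primitive_of_def)
  have "integrable M (\<lambda>x. integral {0..\<bar>v x\<bar>} f0)"
  proof (rule Bochner_Integration.integrable_bound[OF B(1) m])
    show "AE x in M. norm (integral {0..\<bar>v x\<bar>} f0) \<le> norm (B x)"
      using B(2)
    proof eventually_elim
      case (elim x)
      then show ?case using mono_primitive(2)[OF f0(4,3,2), of "\<bar>v x\<bar>"] by simp
    qed
  qed
  then have "integrable M (\<lambda>x. primitive_of f x (v x))"
    using integrable_cong_AE[OF m borel_measurable_AE_cong[OF m ae] ae] by blast
  with v show ?thesis by (simp add: orlicz_space_def)
qed

section \<open>The scale of spectral spaces and the energy form\<close>

lemma spectral_space_mono:
  assumes "u \<in> spectral_space \<Omega> lam \<phi> r" "r' \<le> r"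
  shows "u \<in> spectral_space \<Omega> lam \<phi> r'"
proof -
  have "summable (\<lambda>n. lam n powr r' * (coeff u n)\<^sup>2)"
  proof (rule summable_comparison_test')
    show "summable (\<lambda>n. lam 0 powr (r' - r) * (lam n powr r * (coeff u n)\<^sup>2))"
      using assms(1) by (intro summable_mult) (simp add: spectral_space_iff)
    fix n
    have "lam n powr r' = lam n powr (r' - r) * lam n powr r" using lam_pos[of n] by (simp add: powr_add[symmetric])
    also have "\<dots> \<le> lam 0 powr (r' - r) * lam n powr r"
      using assms(2) lam_pos[of 0] monoD[OF mono_lam, of 0 n] by (intro mult_right_mono powr_mono2') auto
    finally have "lam n powr r' * (coeff u n)\<^sup>2 \<le> lam 0 powr (r' - r) * lam n powr r * (coeff u n)\<^sup>2"
      by (rule mult_right_mono) simp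
    then show "norm (lam n powr r' * (coeff u n)\<^sup>2) \<le> lam 0 powr (r' - r) * (lam n powr r * (coeff u n)\<^sup>2)"
      by (simp add: abs_mult mult.assoc)
  qed
  then show ?thesis using assms(1) by (simp add: spectral_space_iff)
qed

lemma spectral_space_diff:
  assumes u: "u \<in> spectral_space \<Omega> lam \<phi> r" and v: "v \<in> spectral_space \<Omega> lam \<phi> r"
  shows "(\<lambda>x. u x - v x) \<in> spectral_space \<Omega> lam \<phi> r"
proof -
  have sq: "sq_integrable M u" "sq_integrable M v" using u v by (simp_all add: spectral_space_iff)
  have "summable (\<lambda>n. lam n powr r * (coeff u n - coeff v n)\<^sup>2)"
  proof (rule summable_comparison_test')
    show "summable (\<lambda>n. 2 * (lam n powr r * (coeff u n)\<^sup>2) + 2 * (lam n powr r * (coeff v n)\<^sup>2))"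
      using u v by (intro summable_add summable_mult) (simp_all add: spectral_space_iff)
    fix n
    have "(a - b)\<^sup>2 \<le> 2 * a\<^sup>2 + 2 * b\<^sup>2" for a b :: real
    proof -
      have "2 * a\<^sup>2 + 2 * b\<^sup>2 - (a - b)\<^sup>2 = (a + b)\<^sup>2" by algebra
      then show ?thesis by (metis diff_ge_0_iff_ge zero_le_power2)
    qed
    then have "lam n powr r * (coeff u n - coeff v n)\<^sup>2 \<le> lam n powr r * (2 * (coeff u n)\<^sup>2 + 2 * (coeff v n)\<^sup>2)"
      by (intro mult_left_mono) auto
    then show "norm (lam n powr r * (coeff u n - coeff v n)\<^sup>2) \<le> 2 * (lam n powr r * (coeff u n)\<^sup>2) + 2 * (lam n powr r * (coeff v n)\<^sup>2)"
      by (simp add: abs_mult algebra_simps)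
  qed
  then show ?thesis using sq by (auto simp: spectral_space_iff coeff_diff)
qed

text \<open>Because \<open>lam n powr s\<close> is at most \<open>1 + lam n\<close>. Approximation
  in \<open>H10_space\<close> thereby becomes approximation in the energy of order
  \<open>s\<close>.\<close>

lemma H10_spectral_space:
  assumes z: "z \<in> H10_space \<Omega>" and s: "0 \<le> s" "s \<le> 1"
  shows "z \<in> spectral_space \<Omega> lam \<phi> s" "energy s z \<le> sq_norm M z + sq_norm M (weak_gradient \<Omega> z)"
proof -
  have le: "lam n powr s * (coeff z n)\<^sup>2 \<le> (coeff z n)\<^sup>2 + lam n * (coeff z n)\<^sup>2" for n
  proof -
    have "lam n powr s \<le> 1 + lam n"
    proof (cases "lam n \<le> 1")
      case True
      then have "lam n powr s \<le> 1" using lam_pos[of n] s by (intro powr_le1) auto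
      then show ?thesis using lam_pos[of n] by linarith
    next
      case False
      then have "lam n powr s \<le> lam n powr 1" using s by (intro powr_mono) auto
      then show ?thesis using lam_pos[of n] by simp
    qed
    then have "lam n powr s * (coeff z n)\<^sup>2 \<le> (1 + lam n) * (coeff z n)\<^sup>2" by (rule mult_right_mono) simp
    then show ?thesis by (simp add: distrib_right)
  qed
  note P = Parseval[OF H10_L2[OF z]]
  have sum: "summable (\<lambda>n. (coeff z n)\<^sup>2 + lam n * (coeff z n)\<^sup>2)"
    using P H10_summable(1)[OF z] by (intro summable_add) (auto simp: sums_iff)
  have s1: "summable (\<lambda>n. lam n powr s * (coeff z n)\<^sup>2)"
    by (rule summable_comparison_test'[OF sum]) (use le in simp)
  then show "z \<in> spectral_space \<Omega> lam \<phi> s" using H10_L2[OF z] by (simp add: spectral_space_iff)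
  have "energy s z \<le> (\<Sum>n. (coeff z n)\<^sup>2 + lam n * (coeff z n)\<^sup>2)"
    unfolding energy_def by (rule suminf_le[OF le s1 sum])
  also have "\<dots> = sq_norm M z + (\<Sum>n. lam n * (coeff z n)\<^sup>2)"
    using P H10_summable(1)[OF z] by (subst suminf_add[symmetric]) (auto simp: sums_iff)
  finally show "energy s z \<le> sq_norm M z + sq_norm M (weak_gradient \<Omega> z)"
    using H10_summable(2)[OF z] by linarith
qed

lemma energy_form_eq_integral:
  assumes "u \<in> spectral_space \<Omega> lam \<phi> s" "v \<in> spectral_space \<Omega> lam \<phi> s"
  shows "energy_form s u v = (LINT x|M. frac_laplacian \<Omega> lam \<phi> (s / 2) u x * frac_laplacian \<Omega> lam \<phi> (s / 2) v x)"
  using energy_form_sums[OF assms] by (simp add: energy_form_def sums_iff)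

lemma energy_form_self: "energy_form s u u = energy s u"
  by (simp add: energy_form_def energy_def power2_eq_square)

lemma energy_form_Cauchy_Schwarz:
  assumes u: "u \<in> spectral_space \<Omega> lam \<phi> s" and v: "v \<in> spectral_space \<Omega> lam \<phi> s"
  shows "\<bar>energy_form s u v\<bar> \<le> sqrt (energy s u) * sqrt (energy s v)"
proof -
  have sq: "sq_integrable M (frac_laplacian \<Omega> lam \<phi> (s / 2) w)" if "w \<in> spectral_space \<Omega> lam \<phi> s" for w
    using frac_laplacian_expansion[of w "s / 2"] that by (simp add: L2_expansion_def L2_space_iff)
  have en: "sq_norm M (frac_laplacian \<Omega> lam \<phi> (s / 2) w) = energy s w" if "w \<in> spectral_space \<Omega> lam \<phi> s" for w
    using energy_form_eq_integral[OF that that] by (simp add: energy_form_self sq_norm_def power2_eq_square)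
  have "(energy_form s u v)\<^sup>2 \<le> energy s u * energy s v"
    using Cauchy_Schwarz_integral[OF sq[OF u] sq[OF v]] energy_form_eq_integral[OF u v] by (simp add: en u v)
  then show ?thesis by (metis real_sqrt_abs real_sqrt_le_mono real_sqrt_mult)
qed

lemma energy_form_diff:
  assumes "u \<in> spectral_space \<Omega> lam \<phi> s" "v \<in> spectral_space \<Omega> lam \<phi> s" "w \<in> spectral_space \<Omega> lam \<phi> s"
  shows "energy_form s u (\<lambda>x. v x - w x) = energy_form s u v - energy_form s u w"
proof -
  have sq: "sq_integrable M v" "sq_integrable M w" using assms by (simp_all add: spectral_space_iff)
  show ?thesis
    unfolding energy_form_def coeff_diff[OF sq]
    using suminf_diff[OF energy_form_summable[OF assms(1,2)] energy_form_summable[OF assms(1,3)]]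
    by (simp add: right_diff_distrib)
qed

text \<open>Test functions are dense in \<open>H\<^sup>1\<^sub>0\<close>, so the equation may be tested with the eigenfunctions
  although these are not known to be bounded.\<close>

lemma coeff_eq_if_weak_equation:
  assumes s: "0 \<le> s" "s \<le> 1" and u: "u \<in> spectral_space \<Omega> lam \<phi> s" and h: "sq_integrable M h"
    and eq: "\<And>\<psi>. \<psi> \<in> test_functions \<Omega> \<Longrightarrow> energy_form s u \<psi> = (LINT x|M. h x * \<psi> x)"
  shows "lam n powr s * coeff u n = coeff h n"
proof -
  note \<phi>H = eigenfunction_H10[of n]
  have \<phi>s: "\<phi> n \<in> spectral_space \<Omega> lam \<phi> s" by (rule H10_spectral_space[OF \<phi>H s])
  have form_\<phi>: "energy_form s u (\<phi> n) = lam n powr s * coeff u n"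
  proof -
    have "(\<lambda>m. lam m powr s * (coeff u m * coeff (\<phi> n) m)) sums (\<Sum>m\<in>{n}. lam m powr s * (coeff u m * coeff (\<phi> n) m))"
      by (rule sums_finite) (auto simp: coeff_eigenfunction)
    then show ?thesis by (simp add: energy_form_def sums_iff coeff_eigenfunction)
  qed
  \<comment> \<open>\<open>sqrt 2\<close> because the function and the gradient of the error
    \<open>z\<close> each contribute at most \<open>e\<^sup>2\<close> to its energy.\<close>
  define c where "c = sqrt (energy s u) * sqrt 2 + sqrt (sq_norm M h)"
  have "\<bar>lam n powr s * coeff u n - coeff h n\<bar> \<le> c * e" if e: "e > 0" for e
  proof -
    obtain \<psi> where \<psi>: "\<psi> \<in> test_functions \<Omega>" "sq_norm M (\<lambda>x. \<phi> n x - \<psi> x) < e\<^sup>2"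
      "sq_norm M (\<lambda>x. eigengradient n x - gradient \<psi> x) < e\<^sup>2"
      using H10_approx[OF \<phi>H, of "e\<^sup>2"] e by auto
    define z where "z x = \<phi> n x - \<psi> x" for x
    have zH: "z \<in> H10_space \<Omega>"
      using H10_add[OF \<phi>H H10_cmult[OF test_function_H10[OF \<psi>(1)], of "-1"]] by (simp add: z_def[abs_def])
    have zs: "z \<in> spectral_space \<Omega> lam \<phi> s" by (rule H10_spectral_space[OF zH s])
    have \<psi>s: "\<psi> \<in> spectral_space \<Omega> lam \<phi> s" by (rule H10_spectral_space[OF test_function_H10[OF \<psi>(1)] s])
    have "sq_norm M (weak_gradient \<Omega> z) = sq_norm M (\<lambda>x. eigengradient n x - gradient \<psi> x)"
      unfolding z_def[abs_def]
      by (intro sq_norm_weak_gradient has_L2_weak_gradient_diff sq_integrable_diff eigenfunction_L2 H10_weak_gradient[OF \<phi>H]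
          test_function_sq_integrable[OF \<psi>(1)] weak_gradient_test_function(1)[OF \<psi>(1)])
    then have "energy s z \<le> 2 * e\<^sup>2"
      using H10_spectral_space(2)[OF zH s] \<psi>(2,3) by (simp add: z_def[abs_def])
    then have "sqrt (energy s z) \<le> sqrt (2 * e\<^sup>2)" by (rule real_sqrt_le_mono)
    then have 1: "sqrt (energy s z) \<le> sqrt 2 * e" using e by (simp add: real_sqrt_mult)
    have zsq: "sq_integrable M z" using zs by (simp add: spectral_space_iff)
    have 2: "sqrt (sq_norm M z) \<le> e"
      using \<psi>(2) e by (intro real_le_lsqrt) (auto simp: z_def[abs_def])
    have "(LINT x|M. h x * z x) = coeff h n - (LINT x|M. h x * \<psi> x)"
      using integrable_inner[OF h eigenfunction_L2[of n]] integrable_inner[OF h test_function_sq_integrable[OF \<psi>(1)]]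
      by (simp add: z_def right_diff_distrib coeff_def L2_inner_def)
    then have "lam n powr s * coeff u n - coeff h n = energy_form s u z - (LINT x|M. h x * z x)"
      using energy_form_diff[OF u \<phi>s \<psi>s] eq[OF \<psi>(1)] form_\<phi> by (simp add: z_def[abs_def])
    also have "\<bar>\<dots>\<bar> \<le> \<bar>energy_form s u z\<bar> + \<bar>LINT x|M. h x * z x\<bar>" by simp
    also have "\<dots> \<le> sqrt (energy s u) * (sqrt 2 * e) + sqrt (sq_norm M h) * e"
    proof (rule add_mono)
      show "\<bar>energy_form s u z\<bar> \<le> sqrt (energy s u) * (sqrt 2 * e)"
        by (rule order_trans[OF energy_form_Cauchy_Schwarz[OF u zs]])
          (use 1 energy_nonneg[OF u] in \<open>auto intro!: mult_left_mono\<close>)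
      have "\<bar>LINT x|M. h x * z x\<bar> \<le> sqrt (sq_norm M h) * sqrt (sq_norm M z)"
        using Cauchy_Schwarz_integral[OF h zsq] by (metis inner_real_def real_sqrt_abs real_sqrt_le_mono real_sqrt_mult)
      also have "\<dots> \<le> sqrt (sq_norm M h) * e" using 2 by (intro mult_left_mono) auto
      finally show "\<bar>LINT x|M. h x * z x\<bar> \<le> sqrt (sq_norm M h) * e" .
    qed
    finally show ?thesis by (simp add: c_def algebra_simps)
  qed
  moreover have "((\<lambda>e. c * e) \<longlongrightarrow> c * 0) (at_right 0)" by (intro tendsto_intros)
  ultimately have "\<bar>lam n powr s * coeff u n - coeff h n\<bar> \<le> c * 0"
    by (rule at_right_lowerbound[rotated])
  then show ?thesis by simp
qed

text \<open>The regularity of \<open>g\<close> caps the bootstrap at order \<open>\<beta>\<close>,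
  and one last gain of \<open>2 * s\<close> is taken from there.\<close>

lemma spectral_regularity:
  assumes s: "0 < s" and \<beta>: "0 \<le> \<beta>" "\<beta> < 1" and g: "g \<in> spectral_space \<Omega> lam \<phi> \<beta>" and u: "sq_integrable M u"
    and lip: "\<And>x y. \<bar>\<Phi> x - \<Phi> y\<bar> \<le> L * \<bar>x - y :: real\<bar>" and \<Phi>0: "\<Phi> 0 = 0"
    and eq: "\<And>n. lam n powr s * coeff u n = coeff (\<lambda>x. g x - \<Phi> (u x)) n"
  shows "u \<in> spectral_space \<Omega> lam \<phi> (2 * s + \<beta>)"
proof -
  have gain: "u \<in> spectral_space \<Omega> lam \<phi> (2 * s + r)" if r: "0 \<le> r" "r \<le> \<beta>" and ur: "u \<in> spectral_space \<Omega> lam \<phi> r" for r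
  proof -
    have "(\<lambda>x. \<Phi> (u x)) \<in> spectral_space \<Omega> lam \<phi> r"
    proof (cases "r = 0")
      \<comment> \<open>At order 0 the spectral space is L2 itself; the composition result covers
        positive orders only.\<close>
      case True
      note \<Phi>u = lipschitz_compose_sq_integrable[OF u lip \<Phi>0]
      then show ?thesis using True summable_coeff_sq[OF \<Phi>u] lam_pos by (simp add: spectral_space_iff less_imp_neq[symmetric])
    next
      case False
      then show ?thesis using r \<beta> by (intro lipschitz_compose_spectral_space[OF _ _ ur lip \<Phi>0]) auto
    qed
    then have "(\<lambda>x. g x - \<Phi> (u x)) \<in> spectral_space \<Omega> lam \<phi> r"
      using spectral_space_mono[OF g r(2)] by (intro spectral_space_diff)
    then have "summable (\<lambda>n. lam n powr r * (lam n powr s * coeff u n)\<^sup>2)"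
      by (simp add: spectral_space_iff eq)
    moreover have "lam n powr r * (lam n powr s * coeff u n)\<^sup>2 = lam n powr (2 * s + r) * (coeff u n)\<^sup>2" for n
    proof -
      have "lam n powr (2 * s + r) = lam n powr s * lam n powr s * lam n powr r"
        by (simp add: powr_add[symmetric])
      then show ?thesis by (simp add: power2_eq_square mult_ac)
    qed
    ultimately show ?thesis using u by (simp add: spectral_space_iff)
  qed
  \<comment> \<open>Only \<open>s\<close> of the available \<open>2 * s\<close> is counted per
    round; any \<open>k \<ge> \<beta> / s\<close> rounds reach \<open>\<beta>\<close>.\<close>
  have "u \<in> spectral_space \<Omega> lam \<phi> (min (real k * s) \<beta>)" for k
  proof (induction k)
    case 0
    then show ?case using u summable_coeff_sq[OF u] \<beta> lam_pos by (simp add: spectral_space_iff less_imp_neq[symmetric])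
  next
    case (Suc k)
    have "u \<in> spectral_space \<Omega> lam \<phi> (2 * s + min (real k * s) \<beta>)"
      using s \<beta> by (intro gain Suc.IH) auto
    then show ?case
      by (rule spectral_space_mono) (use s in \<open>auto simp: algebra_simps min_def\<close>)
  qed
  moreover obtain k where "\<beta> / s \<le> real k" using real_arch_simple by blast
  then have "min (real k * s) \<beta> = \<beta>" using s by (simp add: field_simps)
  ultimately have "u \<in> spectral_space \<Omega> lam \<phi> \<beta>" by metis
  then show ?thesis using \<beta> by (intro gain) auto
qed

end

theorem corollary2p15:
  fixes \<Omega> :: "'a::euclidean_space set"
    and f :: "'a \<Rightarrow> real \<Rightarrow> real"
    and g u :: "'a \<Rightarrow> real"
    and lam :: "nat \<Rightarrow> real" and \<phi> :: "nat \<Rightarrow> 'a \<Rightarrow> real"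
    and s \<beta> :: real and p :: ereal
  assumes "open \<Omega>" "bounded \<Omega>" "lipschitz_boundary \<Omega>"
    and "dirichlet_eigensystem \<Omega> lam \<phi>"
    and "0 < s" "s < 1"
    and "structural_condition \<Omega> f"
    and "global_Delta2 \<Omega> f"
    and "local_lipschitz_condition \<Omega> f"
    and "0 \<le> \<beta>" "\<beta> < 1"
    and "real DIM('a) > 2 * s \<longrightarrow> p > ereal (real DIM('a) / (2 * s))"
    and "real DIM('a) = 2 * s \<longrightarrow> p > 1"
    and "real DIM('a) < 2 * s \<longrightarrow> p = 1"
    and "g \<in> spectral_space \<Omega> lam \<phi> \<beta> \<inter> Lp_space \<Omega> p"
    and "weak_solution \<Omega> lam \<phi> s f (\<lambda>v. LINT x|lebesgue_on \<Omega>. g x * v x) u"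
  shows "u \<in> spectral_space \<Omega> lam \<phi> (2 * s + \<beta>)"
proof -
  interpret dirichlet_system \<Omega> lam \<phi>
    by unfold_locales (use assms(1,2,4) in auto)
  note s = assms(5,6)
  have g: "g \<in> spectral_space \<Omega> lam \<phi> \<beta>" and gsq: "sq_integrable M g"
    using assms(15) by (auto simp: spectral_space_iff)
  obtain f0 where f0: "AE x in M. f x = f0" "f0 0 = 0" "mono f0" "continuous_on UNIV f0"
    and f0_lip: "\<And>K. K > 0 \<Longrightarrow> \<exists>L>0. \<forall>a b. \<bar>a\<bar> \<le> K \<and> \<bar>b\<bar> \<le> K \<longrightarrow> \<bar>f0 a - f0 b\<bar> \<le> L * \<bar>a - b\<bar>"
    using autonomous_nonlinearity[OF assms(7,9)] by blast
  have u: "u \<in> spectral_space \<Omega> lam \<phi> s" and uF: "u \<in> orlicz_space \<Omega> f"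
    using assms(16) by (auto simp: weak_solution_def energy_space_def)
  have usq: "sq_integrable M u" using u by (simp add: spectral_space_iff)
  have um [measurable]: "u \<in> borel_measurable M" by (rule sq_integrable_measurable[OF usq])
  have equation: "energy_form s u v + (LINT x|M. f x (u x) * v x) = (LINT x|M. g x * v x)"
    if "v \<in> spectral_space \<Omega> lam \<phi> s" "v \<in> orlicz_space \<Omega> f" for v
    using assms(16) that energy_form_eq_integral[OF u that(1)] by (auto simp: weak_solution_def energy_space_def)
  obtain q where q: "q \<ge> 2" "q > DIM('a) / (2 * s)" "integrable M (\<lambda>x. \<bar>g x\<bar> powr q)"
    using Lp_space_exponent[OF _ s(1) assms(12), of g] assms(15) by (auto simp: spectral_space_def)
  obtain d where d: "d > 0" "AE x in M. \<bar>u x\<bar> \<le> d"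
  proof (rule bounded_if_excess_dominated[OF s u gsq q(3,1,2)])
    fix k :: real assume k: "0 \<le> k"
    define w where "w x = u x - truncate k (u x)" for x
    have w: "w \<in> spectral_space \<Omega> lam \<phi> s" using energy_excess(1)[OF s u k] by (simp add: w_def[abs_def])
    have abs_w: "\<bar>w x\<bar> \<le> \<bar>u x\<bar>" for x using abs_excess[OF k, of "u x"] k by (simp add: w_def)
    have "w \<in> orlicz_space \<Omega> f"
    proof (rule orlicz_space_bounded_by[OF f0])
      show "w \<in> borel_measurable M" using w by (simp add: spectral_space_iff sq_integrable_def)
      show "integrable M (\<lambda>x. primitive_of f x (u x))" using uF by (simp add: orlicz_space_def)
      show "AE x in M. integral {0..\<bar>w x\<bar>} f0 \<le> primitive_of f x (u x)"
        using f0(1)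
      proof eventually_elim
        case (elim x)
        then show ?case using monoD[OF mono_primitive(1)[OF f0(4,3,2)] abs_w[of x]] by (simp add: primitive_of_def)
      qed
    qed
    note equation[OF w this]
    \<comment> \<open>\<open>f0\<close> is monotone with \<open>f0 0 = 0\<close>, and the excess has
      the sign of \<open>u\<close> wherever it is not 0; the nonlinear term can therefore be
      dropped.\<close>
    moreover have "0 \<le> (LINT x|M. f x (u x) * w x)"
    proof (rule integral_nonneg_AE)
      show "AE x in M. 0 \<le> f x (u x) * w x"
        using f0(1)
      proof eventually_elim
        case (elim x)
        have "0 \<le> f0 (u x) \<and> 0 \<le> w x \<or> f0 (u x) \<le> 0 \<and> w x \<le> 0"
          using monoD[OF f0(3), of 0 "u x"] monoD[OF f0(3), of "u x" 0] f0(2) k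
          unfolding w_def truncate_def max_def min_def by (smt (verit))
        then show ?case using elim by (auto simp: zero_le_mult_iff)
      qed
    qed
    ultimately show "energy_form s u (\<lambda>x. u x - truncate k (u x)) \<le> (LINT x|M. g x * (u x - truncate k (u x)))"
      by (simp add: w_def[abs_def])
  qed
  \<comment> \<open>Since \<open>\<bar>u x\<bar> \<le> d\<close> almost everywhere, cutting off the
    argument changes nothing along \<open>u\<close> and makes the Lipschitz bound global.\<close>
  define \<Phi> where "\<Phi> t = f0 (truncate d t)" for t
  obtain L where L: "L > 0" "\<And>a b. \<bar>a\<bar> \<le> d \<Longrightarrow> \<bar>b\<bar> \<le> d \<Longrightarrow> \<bar>f0 a - f0 b\<bar> \<le> L * \<bar>a - b\<bar>"
    using f0_lip[OF d(1)] by blast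
  have lip: "\<bar>\<Phi> x - \<Phi> y\<bar> \<le> L * \<bar>x - y\<bar>" for x y
  proof -
    have "\<bar>truncate d t\<bar> \<le> d" for t using d(1) unfolding truncate_def max_def min_def by (smt (verit))
    then have "\<bar>\<Phi> x - \<Phi> y\<bar> \<le> L * \<bar>truncate d x - truncate d y\<bar>" unfolding \<Phi>_def by (intro L(2))
    also have "\<dots> \<le> L * \<bar>x - y\<bar>" using truncate_lipschitz[of d x y] L(1) by (intro mult_left_mono) auto
    finally show ?thesis .
  qed
  have \<Phi>0: "\<Phi> 0 = 0" using d(1) f0(2) by (simp add: \<Phi>_def truncate_zero)
  have \<Phi>u: "sq_integrable M (\<lambda>x. \<Phi> (u x))" by (rule lipschitz_compose_sq_integrable[OF usq lip \<Phi>0])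
  have fu: "AE x in M. f x (u x) = \<Phi> (u x)"
    using f0(1) d(2)
  proof eventually_elim
    case (elim x)
    then have "truncate d (u x) = u x" by (simp add: truncate_def abs_le_iff)
    then show ?case using elim(1) by (simp add: \<Phi>_def)
  qed
  have "lam n powr s * coeff u n = coeff (\<lambda>x. g x - \<Phi> (u x)) n" for n
  proof (rule coeff_eq_if_weak_equation)
    show "sq_integrable M (\<lambda>x. g x - \<Phi> (u x))" using gsq \<Phi>u by auto
    fix \<psi> assume \<psi>: "\<psi> \<in> test_functions \<Omega>"
    note \<psi>sq = test_function_sq_integrable[OF \<psi>]
    have [measurable]: "\<psi> \<in> borel_measurable M" by (rule sq_integrable_measurable[OF \<psi>sq])
    obtain B where B: "\<And>x. \<bar>\<psi> x\<bar> \<le> B" using test_function_bounded[OF \<psi>] by blast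
    \<comment> \<open>A bounded function has a bounded primitive, and constants are integrable on
      the bounded domain.\<close>
    have "\<psi> \<in> orlicz_space \<Omega> f"
      by (rule orlicz_space_bounded_by[OF f0, where B="\<lambda>_. integral {0..B} f0"])
        (use monoD[OF mono_primitive(1)[OF f0(4,3,2)] B] in auto)
    moreover have "\<psi> \<in> spectral_space \<Omega> lam \<phi> s"
      using s by (intro H10_spectral_space[OF test_function_H10[OF \<psi>]]) auto
    ultimately have "energy_form s u \<psi> + (LINT x|M. f x (u x) * \<psi> x) = (LINT x|M. g x * \<psi> x)"
      by (intro equation)
    moreover have "(LINT x|M. f x (u x) * \<psi> x) = (LINT x|M. \<Phi> (u x) * \<psi> x)"
    proof (rule integral_cong_AE)
      show m: "(\<lambda>x. \<Phi> (u x) * \<psi> x) \<in> borel_measurable M"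
        using sq_integrable_measurable[OF \<Phi>u] by measurable
      have ae: "AE x in M. \<Phi> (u x) * \<psi> x = f x (u x) * \<psi> x" using fu by eventually_elim simp
      then show "AE x in M. f x (u x) * \<psi> x = \<Phi> (u x) * \<psi> x" by eventually_elim (rule sym)
      show "(\<lambda>x. f x (u x) * \<psi> x) \<in> borel_measurable M" by (rule borel_measurable_AE_cong[OF m ae])
    qed
    ultimately show "energy_form s u \<psi> = (LINT x|M. (g x - \<Phi> (u x)) * \<psi> x)"
      using integrable_inner[OF gsq \<psi>sq] integrable_inner[OF \<Phi>u \<psi>sq] by (simp add: left_diff_distrib)
  qed (use s u in auto)
  then show ?thesis
    by (rule spectral_regularity[OF s(1) assms(10,11) g usq lip \<Phi>0])
qed

end
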